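(* Among the patterns of length four that avoid $1324$, the $f$-compatible ones are exactly $$1432,\ 4231,\ 4321,$$ and among the patterns of length five that avoid $1324$, the $f$-compatible ones are exactly $$14523,\ 14532,\ 15342,\ 15423,\ 15432,\ 34125,\ 52341,\ 52431,\ 53241,\ 53421,\ 54231,\ 54321.$$ Furthermore, if $p\in S_m$ is any pattern such that $p_1=m$ and $p_m=1$, then $p$ is $f$-compatible.
   Context: Notation. $\mathrm{Av}(B)$ is the set of permutations avoiding all patterns in $B$ (no subsequence order-isomorphic to a pattern in $B$). For $\pi\in S_n$ and a value $e\in[n]$, $\pi\smallsetminus e$ is the permutation order-isomorphic to the sequence obtained by deleting the entry with value $e$ from $\pi$. The direct sum $\sigma\oplus\tau$ of $\sigma\in S_a,\tau\in S_b$ is $\sigma$ followed by $\tau$ with all values shifted up by $a$. A permutation is decomposable if it is a direct sum of two nonempty permutations, and indecomposable otherwise. $\mathrm{id}_m$ is the identity permutation of length $m$ ($\mathrm{id}_0$ is empty). The reverse-complement of $\pi\in S_n$ is $\pi^{\mathrm{rc}}$ with $\pi^{\mathrm{rc}}_i=n+1-\pi_{n+1-i}$. A permutation $\pi\in S_n$ is almost decomposable if it is indecomposable but $\pi\smallsetminus e$ is decomposable for some $e\in\{1,\pi_1,n,\pi_n\}$. The map $f$. Every decomposable $1324$-avoider can be written uniquely as $\pi=\sigma\oplus\mathrm{id}_m\oplus\tau$ with $m\ge0$, $\sigma$ an indecomposable $132$-avoider and $\tau$ an indecomposable $213$-avoider (both nonempty); set $\widetilde f(\pi)=\sigma\oplus\mathrm{id}_{m+1}\oplus\tau$.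 For a decomposable $1324$-avoider set $f(\pi)=\widetilde f(\pi)$. For an almost decomposable $1324$-avoider $\pi$ define $f(\pi)$ (of length $|\pi|+1$) as follows: (1) if $\pi\smallsetminus\pi_1$ is decomposable, $f(\pi)$ is the permutation with $f(\pi)_1=\pi_1$ and $f(\pi)\smallsetminus\pi_1=\widetilde f(\pi\smallsetminus\pi_1)$; (2) if $\pi\smallsetminus 1$ is decomposable, $f(\pi)=f(\pi^{-1})^{-1}$; (3) otherwise (both $\pi\smallsetminus\pi_1$ and $\pi\smallsetminus1$ indecomposable), $f(\pi)=f(\pi^{\mathrm{rc}})^{\mathrm{rc}}$. (For almost decomposable $1324$-avoiders, cases (1) and (2) cannot occur simultaneously.) A pattern $p$ is $f$-compatible if $f(\pi)$ avoids $p$ for every decomposable or almost decomposable permutation $\pi\in\mathrm{Av}(1324,p)$. *)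

theory Defs
  imports Main "HOL-Library.Sublist"
begin

text \<open>
  A permutation of length \<open>n\<close> is its one-line notation: a list of naturals in which each of
  \<open>1, \<dots>, n\<close> occurs exactly once. List positions start at 0, entries at 1.
\<close>

definition is_perm :: "nat list \<Rightarrow> bool" where
  "is_perm \<pi> \<longleftrightarrow> distinct \<pi> \<and> set \<pi> = {1..length \<pi>}"

definition order_iso :: "nat list \<Rightarrow> nat list \<Rightarrow> bool" where
  "order_iso xs ys \<longleftrightarrow> length xs = length ys \<and>
     (\<forall>i < length xs. \<forall>j < length xs. xs ! i < xs ! j \<longleftrightarrow> ys ! i < ys ! j)"

definition avoids :: "nat list \<Rightarrow> nat list \<Rightarrow> bool" where
  "avoids \<pi> p \<longleftrightarrow> \<not> (\<exists>xs. subseq xs \<pi> \<and> order_iso xs p)"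

definition Av :: "nat list set \<Rightarrow> nat list set" where
  "Av B = {\<pi>. is_perm \<pi> \<and> (\<forall>p \<in> B. avoids \<pi> p)}"

definition standardize :: "nat list \<Rightarrow> nat list" where
  "standardize xs = map (\<lambda>x. card {y \<in> set xs. y \<le> x}) xs"

lemma card_le_less_iff:
  fixes A :: "nat set"
  assumes "finite A" "x \<in> A" "y \<in> A"
  shows "card {z \<in> A. z \<le> x} < card {z \<in> A. z \<le> y} \<longleftrightarrow> x < y"
proof (cases "x < y")
  case True
  have "y \<in> {z \<in> A. z \<le> y}" "y \<notin> {z \<in> A. z \<le> x}" using assms True by auto
  then have "{z \<in> A. z \<le> x} \<noteq> {z \<in> A. z \<le> y}" by blast
  moreover have "{z \<in> A. z \<le> x} \<subseteq> {z \<in> A. z \<le> y}" using True by auto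
  ultimately have "{z \<in> A. z \<le> x} \<subset> {z \<in> A. z \<le> y}" by blast
  moreover have "finite {z \<in> A. z \<le> y}" using assms by simp
  ultimately have "card {z \<in> A. z \<le> x} < card {z \<in> A. z \<le> y}"
    by (rule psubset_card_mono[rotated])
  then show ?thesis using True by blast
next
  case False
  then have "{z \<in> A. z \<le> y} \<subseteq> {z \<in> A. z \<le> x}" by auto
  then have "card {z \<in> A. z \<le> y} \<le> card {z \<in> A. z \<le> x}"
    using assms by (intro card_mono) auto
  then show ?thesis using False by (meson not_le)
qed

lemma standardize_order_iso: "order_iso (standardize xs) xs"
proof -
  have "standardize xs ! i < standardize xs ! j \<longleftrightarrow> xs ! i < xs ! j"
    if "i < length xs" "j < length xs" for i j
    unfolding standardize_def nth_map[OF that(1)] nth_map[OF that(2)]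
    using that by (intro card_le_less_iff) (rule List.finite_set nth_mem, assumption?)+
  moreover have "length (standardize xs) = length xs"
    by (simp only: standardize_def length_map)
  ultimately show ?thesis unfolding order_iso_def by metis
qed

lemma standardize_is_perm:
  assumes "distinct xs"
  shows "is_perm (standardize xs)"
proof -
  have inj: "inj_on (\<lambda>x. card {y \<in> set xs. y \<le> x}) (set xs)"
  proof (rule inj_onI, rule ccontr)
    fix x y
    assume "x \<in> set xs" "y \<in> set xs" "x \<noteq> y"
      and eq: "card {z \<in> set xs. z \<le> x} = card {z \<in> set xs. z \<le> y}"
    then show False
      using card_le_less_iff[OF List.finite_set, of x xs y]
        card_le_less_iff[OF List.finite_set, of y xs x] by linarith
  qed
  have sub: "set (standardize xs) \<subseteq> {1..length xs}"
  proof -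
    have "1 \<le> card {y \<in> set xs. y \<le> x} \<and> card {y \<in> set xs. y \<le> x} \<le> length xs"
      if "x \<in> set xs" for x
    proof
      have "card {x} \<le> card {y \<in> set xs. y \<le> x}" using that by (intro card_mono) auto
      then show "1 \<le> card {y \<in> set xs. y \<le> x}" by simp
      have "card {y \<in> set xs. y \<le> x} \<le> card (set xs)" by (intro card_mono) auto
      then show "card {y \<in> set xs. y \<le> x} \<le> length xs"
        using card_length[of xs] by linarith
    qed
    then show ?thesis by (auto simp: standardize_def)
  qed
  have dist: "distinct (standardize xs)"
    using assms inj by (simp add: standardize_def distinct_map)
  then have "card (set (standardize xs)) = length xs"
    by (simp add: distinct_card) (simp add: standardize_def)
  with sub have "set (standardize xs) = {1..length xs}"
    by (intro card_subset_eq) auto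
  with dist show ?thesis by (simp add: is_perm_def standardize_def)
qed

definition delete_value :: "nat list \<Rightarrow> nat \<Rightarrow> nat list"  (infixl "\<setminus>" 65) where
  "\<pi> \<setminus> e = standardize (removeAll e \<pi>)"

definition direct_sum :: "nat list \<Rightarrow> nat list \<Rightarrow> nat list"  (infixr "\<oplus>" 65) where
  "\<sigma> \<oplus> \<tau> = \<sigma> @ map (\<lambda>v. v + length \<sigma>) \<tau>"

definition decomposable :: "nat list \<Rightarrow> bool" where
  "decomposable \<pi> \<longleftrightarrow>
     (\<exists>\<sigma> \<tau>. is_perm \<sigma> \<and> is_perm \<tau> \<and> \<sigma> \<noteq> [] \<and> \<tau> \<noteq> [] \<and> \<pi> = \<sigma> \<oplus> \<tau>)"

definition id_perm :: "nat \<Rightarrow> nat list" where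
  "id_perm m = [1..<Suc m]"

definition reverse_complement :: "nat list \<Rightarrow> nat list" where
  "reverse_complement \<pi> = map (\<lambda>v. length \<pi> + 1 - v) (rev \<pi>)"

definition inverse_perm :: "nat list \<Rightarrow> nat list" where
  "inverse_perm \<pi> =
     map (\<lambda>v. Suc (inv_into {..<length \<pi>} ((!) \<pi>) v)) [1..<Suc (length \<pi>)]"

definition almost_decomposable :: "nat list \<Rightarrow> bool" where
  "almost_decomposable \<pi> \<longleftrightarrow> is_perm \<pi> \<and> \<pi> \<noteq> [] \<and> \<not> decomposable \<pi> \<and>
     (\<exists>e \<in> {1, hd \<pi>, length \<pi>, last \<pi>}. decomposable (\<pi> \<setminus> e))"

definition f_tilde :: "nat list \<Rightarrow> nat list" where
  "f_tilde \<pi> = (THE \<rho>. \<exists>\<sigma> m \<tau>.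
     is_perm \<sigma> \<and> \<sigma> \<noteq> [] \<and> \<not> decomposable \<sigma> \<and> avoids \<sigma> [1,3,2] \<and>
     is_perm \<tau> \<and> \<tau> \<noteq> [] \<and> \<not> decomposable \<tau> \<and> avoids \<tau> [2,1,3] \<and>
     \<pi> = \<sigma> \<oplus> id_perm m \<oplus> \<tau> \<and> \<rho> = \<sigma> \<oplus> id_perm (m + 1) \<oplus> \<tau>)"

text \<open>
  The map \<open>f\<close> on almost decomposable 1324-avoiders is defined by three cases, the last two of
  which refer back to \<open>f\<close>. Deleting the value 1 from \<open>\<pi>\<close> corresponds to deleting the first entry
  of the inverse, so case (2) always falls back on case (1). Deleting the last entry, resp. the
  largest value, corresponds to deleting the first entry, resp. the value 1, of the
  reverse-complement, so case (3) always falls back on case (1) or (2). The recursion is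
  therefore unrolled into three stages. The values outside the decomposable and almost
  decomposable 1324-avoiders are irrelevant.
\<close>

definition f_case1 :: "nat list \<Rightarrow> nat list" where
  "f_case1 \<pi> = (THE \<rho>. is_perm \<rho> \<and> \<rho> \<noteq> [] \<and> hd \<rho> = hd \<pi> \<and>
     \<rho> \<setminus> hd \<pi> = f_tilde (\<pi> \<setminus> hd \<pi>))"

definition f_case12 :: "nat list \<Rightarrow> nat list" where
  "f_case12 \<pi> =
     (if decomposable (\<pi> \<setminus> hd \<pi>) then f_case1 \<pi>
      else inverse_perm (f_case1 (inverse_perm \<pi>)))"

definition f_map :: "nat list \<Rightarrow> nat list" where
  "f_map \<pi> =
     (if decomposable \<pi> then f_tilde \<pi>
      else if decomposable (\<pi> \<setminus> hd \<pi>) \<or> decomposable (\<pi> \<setminus> 1) then f_case12 \<pi>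
      else reverse_complement (f_case12 (reverse_complement \<pi>)))"

definition f_compatible :: "nat list \<Rightarrow> bool" where
  "f_compatible p \<longleftrightarrow>
     (\<forall>\<pi> \<in> Av {[1,3,2,4], p}. decomposable \<pi> \<or> almost_decomposable \<pi> \<longrightarrow> avoids (f_map \<pi>) p)"

end

theory Submission
  imports Defs
begin

text \<open>
  On a decomposable \<open>1324\<close>-avoider \<open>\<alpha> \<oplus> \<beta>\<close> the map inserts one entry at an arbitrary cut, giving
  \<open>\<alpha> \<oplus> [1] \<oplus> \<beta>\<close>; in case (1) the same insertion happens behind the first entry \<open>c\<close>, whose value is
  kept, so that \<open>c\<close> drops below exactly one entry of \<open>\<beta>\<close> that it used to exceed. An occurrence of \<open>p\<close>
  in the image that has no counterpart in \<open>\<pi>\<close> must use the new entry, or \<open>c\<close> together with that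
  entry of \<open>\<beta>\<close>. For a compatible \<open>p\<close> the offending entry can be exchanged for another entry of
  \<open>\<alpha>\<close> or \<open>\<beta>\<close>, or the occurrence produces a \<open>213\<close> inside \<open>\<beta>\<close>, hence a \<open>1324\<close> in \<open>\<pi>\<close>. The other
  cases follow by inverses and reverse-complements, which act on the set of points of a permutation.
  Every other pattern of length four or five is refuted by a witness of length at most six.
\<close>

section \<open>Points of a permutation and symmetries\<close>

text \<open>The obstacle that shapes the proof is that compatibility is not invariant under the
  reverse-complement: 1432 is compatible, but its reverse-complement 3214 is not, since 4213 avoids
  3214 and has image 42135. The damage is done when the first entry \<open>c\<close> is the maximum:
  the one entry that overtakes \<open>c\<close> is then the only entry above it in the image, and
  nothing in \<pi> can replace it. Case (3) is reached only when cases (1) and (2) fail. After the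
  symmetries this failure forces \<open>c\<close> below the maximum, so a larger entry is available
  for the exchange; hence two versions of the case (1) statement. Indecomposability is the recurring
  hypothesis because of where the new entry sits: above and behind all of \<alpha>, below and before
  all of \<beta>. An indecomposable list of at least two entries cannot cross such a cut, so the new
  entry can only act as a detachable minimum or maximum of an occurrence, and then an entry of
  \<alpha> or \<beta> can take its place.\<close>

definition pts :: "nat list \<Rightarrow> (nat \<times> nat) set" where
  "pts xs = (\<lambda>i. (Suc i, xs ! i)) ` {..<length xs}"

text \<open>Both coordinates enter in the same way, so that transposing the diagram (inverse) or
  turning it by 180 degrees (reverse-complement) needs no reasoning about subsequences. Positions in
  \<open>pts\<close> count from 1 to share the range of the values, which allows the coordinates to
  be exchanged.\<close>

definition pattern_emb :: "(nat \<times> nat) set \<Rightarrow> (nat \<times> nat) set \<Rightarrow> bool" where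
  "pattern_emb P Q \<longleftrightarrow> (\<exists>g. g ` P \<subseteq> Q \<and>
     (\<forall>a \<in> P. \<forall>b \<in> P. (fst (g a) < fst (g b) \<longleftrightarrow> fst a < fst b) \<and>
                          (snd (g a) < snd (g b) \<longleftrightarrow> snd a < snd b)))"

text \<open>Makes sense for any set of points, in particular for a diagram with a row or a column
  removed and not renumbered.\<close>

definition point_dec :: "(nat \<times> nat) set \<Rightarrow> bool" where
  "point_dec P \<longleftrightarrow> (\<exists>A B. P = A \<union> B \<and> A \<noteq> {} \<and> B \<noteq> {} \<and>
     (\<forall>a \<in> A. \<forall>b \<in> B. fst a < fst b \<and> snd a < snd b))"

text \<open>Decomposability without normalised values: it can be tested on
  \<open>removeAll e \<pi>\<close> without \<open>standardize\<close>, and on single occurrences of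
  a pattern.\<close>

definition list_dec :: "nat list \<Rightarrow> bool" where
  "list_dec xs \<longleftrightarrow> (\<exists>ys zs. xs = ys @ zs \<and> ys \<noteq> [] \<and> zs \<noteq> [] \<and>
     (\<forall>y \<in> set ys. \<forall>z \<in> set zs. y < z))"

lemma pattern_embE:
  assumes "pattern_emb P Q"
  obtains g where "\<And>a. a \<in> P \<Longrightarrow> g a \<in> Q"
    "\<And>a b. a \<in> P \<Longrightarrow> b \<in> P \<Longrightarrow> fst (g a) < fst (g b) \<longleftrightarrow> fst a < fst b"
    "\<And>a b. a \<in> P \<Longrightarrow> b \<in> P \<Longrightarrow> snd (g a) < snd (g b) \<longleftrightarrow> snd a < snd b"
proof -
  obtain g where g: "g ` P \<subseteq> Q" "\<forall>a \<in> P. \<forall>b \<in> P. (fst (g a) < fst (g b) \<longleftrightarrow> fst a < fst b) \<and>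
      (snd (g a) < snd (g b) \<longleftrightarrow> snd a < snd b)"
    using assms unfolding pattern_emb_def by (elim exE conjE)
  show ?thesis
  proof (rule that)
    show "g a \<in> Q" if "a \<in> P" for a using g(1) that by (rule subsetD[OF _ imageI])
  qed (use g(2) in simp_all)
qed

section \<open>Occurrences as index maps and as embeddings of diagrams\<close>

lemma subseq_map_imp_ex:
  "subseq xs (map f ys) \<Longrightarrow> \<exists>zs. subseq zs ys \<and> xs = map f zs"
proof (induction ys arbitrary: xs)
  case (Cons y ys)
  show ?case
  proof (cases xs)
    case Nil
    then show ?thesis by (intro exI[of _ "[]"]) auto
  next
    case (Cons x xs')
    show ?thesis
    proof (cases "x = f y")
      case True
      then have "subseq xs' (map f ys)" using Cons.prems Cons by auto
      then obtain zs where "subseq zs ys" "xs' = map f zs" using Cons.IH by blast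
      then show ?thesis using Cons True by (intro exI[of _ "y # zs"]) auto
    next
      case False
      then have "subseq xs (map f ys)" using Cons.prems Cons by auto
      then obtain zs where "subseq zs ys" "xs = map f zs" using Cons.IH by blast
      then show ?thesis by (intro exI[of _ zs]) auto
    qed
  qed
qed auto

text \<open>Subsequences of \<open>ys\<close> are the images under \<open>(!) ys\<close> of
  subsequences of \<open>[0..<length ys]\<close>, and these are the strictly increasing lists of
  indices.\<close>

lemma subseq_iff_index:
  "subseq xs ys \<longleftrightarrow> (\<exists>h. (\<forall>i < length xs. h i < length ys \<and> ys ! h i = xs ! i) \<and>
     (\<forall>i j. i < j \<longrightarrow> j < length xs \<longrightarrow> h i < (h j :: nat)))"
proof
  assume "subseq xs ys"
  then have "subseq xs (map ((!) ys) [0..<length ys])" by (simp add: map_nth)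
  from subseq_map_imp_ex[OF this] obtain zs
    where zs: "subseq zs [0..<length ys]" "xs = map ((!) ys) zs" by blast
  then obtain N where N: "zs = nths [0..<length ys] N" by (auto simp: subseq_conv_nths)
  have "sorted zs" "distinct zs" unfolding N by (auto intro: sorted_nths distinct_nthsI)
  then have lt: "zs ! i < zs ! j" if "i < j" "j < length zs" for i j
    using that by (meson sorted_wrt_nth_less strict_sorted_iff)
  have "set zs \<subseteq> {..<length ys}" unfolding N using set_nths_subset[of "[0..<length ys]" N] by auto
  then have "zs ! i < length ys" if "i < length zs" for i using that nth_mem by blast
  with lt zs(2) show "\<exists>h. (\<forall>i < length xs. h i < length ys \<and> ys ! h i = xs ! i) \<and>
     (\<forall>i j. i < j \<longrightarrow> j < length xs \<longrightarrow> h i < (h j :: nat))"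
    by (intro exI[of _ "(!) zs"]) auto
next
  assume "\<exists>h. (\<forall>i < length xs. h i < length ys \<and> ys ! h i = xs ! i) \<and>
     (\<forall>i j. i < j \<longrightarrow> j < length xs \<longrightarrow> h i < (h j :: nat))"
  then obtain h where h: "\<And>i. i < length xs \<Longrightarrow> h i < length ys"
    "\<And>i. i < length xs \<Longrightarrow> ys ! h i = xs ! i"
    "\<And>i j. i < j \<Longrightarrow> j < length xs \<Longrightarrow> h i < (h j :: nat)" by blast
  define zs where "zs = map h [0..<length xs]"
  have "sorted_wrt (<) zs" unfolding zs_def using h(3) by (auto simp: sorted_wrt_iff_nth_less)
  then have "sorted zs" "distinct zs" by (auto simp: strict_sorted_iff)
  moreover have "set zs \<subseteq> set [0..<length ys]" unfolding zs_def using h(1) by auto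
  ultimately have "subseq zs [0..<length ys]"
    by (intro sorted_subset_imp_subseq) (auto simp: strict_sorted_iff)
  then have "subseq (map ((!) ys) zs) (map ((!) ys) [0..<length ys])" by (rule subseq_map)
  moreover have "map ((!) ys) zs = xs" unfolding zs_def using h(2) by (auto intro!: nth_equalityI)
  ultimately show "subseq xs ys" by (simp add: map_nth)
qed

text \<open>The first coordinates of an embedding give the index map of an occurrence; the second
  coordinates are then forced, since the points lie in \<open>pts \<pi>\<close>.\<close>

lemma avoids_iff_pattern_emb: "avoids \<pi> p \<longleftrightarrow> \<not> pattern_emb (pts p) (pts \<pi>)"
proof -
  have "(\<exists>xs. subseq xs \<pi> \<and> order_iso xs p) \<longleftrightarrow> pattern_emb (pts p) (pts \<pi>)"
  proof
    assume "\<exists>xs. subseq xs \<pi> \<and> order_iso xs p"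
    then obtain xs where xs: "subseq xs \<pi>" "order_iso xs p" by blast
    then obtain h where h: "\<And>i. i < length xs \<Longrightarrow> h i < length \<pi>"
      "\<And>i. i < length xs \<Longrightarrow> \<pi> ! h i = xs ! i"
      "\<And>i j. i < j \<Longrightarrow> j < length xs \<Longrightarrow> h i < h j" unfolding subseq_iff_index by blast
    have hh: "h i < h j \<longleftrightarrow> i < j" if "i < length xs" "j < length xs" for i j
      using h(3)[of i j] h(3)[of j i] that by (cases i j rule: linorder_cases) auto
    show "pattern_emb (pts p) (pts \<pi>)"
      unfolding pattern_emb_def
      using xs(2) h hh
      by (intro exI[of _ "\<lambda>a. (Suc (h (fst a - 1)), \<pi> ! h (fst a - 1))"])
        (auto simp: pts_def order_iso_def)
  next
    assume "pattern_emb (pts p) (pts \<pi>)"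
    then obtain g where g1: "\<And>a. a \<in> pts p \<Longrightarrow> g a \<in> pts \<pi>"
      and g2: "\<And>a b. a \<in> pts p \<Longrightarrow> b \<in> pts p \<Longrightarrow> fst (g a) < fst (g b) \<longleftrightarrow> fst a < fst b"
      and g3: "\<And>a b. a \<in> pts p \<Longrightarrow> b \<in> pts p \<Longrightarrow> snd (g a) < snd (g b) \<longleftrightarrow> snd a < snd b"
      using pattern_embE by blast
    define h where "h i = fst (g (Suc i, p ! i)) - 1" for i
    have mem: "(Suc i, p ! i) \<in> pts p" if "i < length p" for i using that by (auto simp: pts_def)
    have gi: "h i < length \<pi>" "g (Suc i, p ! i) = (Suc (h i), \<pi> ! h i)" if "i < length p" for i
      using g1[OF mem[OF that]] by (auto simp: pts_def h_def)
    define xs where "xs = map (\<lambda>i. \<pi> ! h i) [0..<length p]"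
    have "subseq xs \<pi>" unfolding subseq_iff_index
      using gi g2[OF mem mem] by (intro exI[of _ h]) (auto simp: xs_def)
    moreover have "order_iso xs p" unfolding order_iso_def
      using gi g3[OF mem mem] by (auto simp: xs_def)
    ultimately show "\<exists>xs. subseq xs \<pi> \<and> order_iso xs p" by blast
  qed
  then show ?thesis by (simp add: avoids_def)
qed

text \<open>Reduces the involution laws for inverse and reverse-complement to computations with sets
  of points.\<close>

lemma pts_inject:
  assumes "pts xs = pts ys"
  shows "xs = ys"
proof (rule nth_equalityI)
  have card: "card (pts zs) = length zs" for zs
    unfolding pts_def by (subst card_image) (auto intro: inj_onI)
  show len: "length xs = length ys" using assms card by metis
  fix i assume "i < length xs"
  then have "(Suc i, xs ! i) \<in> pts ys" unfolding assms[symmetric] by (auto simp: pts_def)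
  then show "xs ! i = ys ! i" by (auto simp: pts_def)
qed

section \<open>Inverse and reverse-complement as symmetries of the diagram\<close>

definition reflect :: "nat \<Rightarrow> nat \<times> nat \<Rightarrow> nat \<times> nat" where
  "reflect n q = (n + 1 - fst q, n + 1 - snd q)"

lemma is_perm_nth:
  assumes "is_perm \<pi>" "i < length \<pi>"
  shows "1 \<le> \<pi> ! i" "\<pi> ! i \<le> length \<pi>"
  using assms nth_mem[of i \<pi>] by (auto simp: is_perm_def)

lemma pts_bounds:
  assumes "is_perm \<pi>" "q \<in> pts \<pi>"
  shows "1 \<le> fst q" "fst q \<le> length \<pi>" "1 \<le> snd q" "snd q \<le> length \<pi>"
  using assms is_perm_nth by (auto simp: pts_def)

lemma is_permI_inj:
  assumes "length xs = n" "inj_on ((!) xs) {..<n}" "\<And>i. i < n \<Longrightarrow> 1 \<le> xs ! i \<and> xs ! i \<le> n"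
  shows "is_perm xs"
proof -
  have d: "distinct xs" using assms(1,2) by (simp add: distinct_conv_nth inj_on_def) blast
  have "set xs \<subseteq> {1..n}" using assms by (auto simp: in_set_conv_nth)
  moreover have "card (set xs) = n" using d assms(1) by (simp add: distinct_card)
  ultimately have "set xs = {1..n}" by (intro card_subset_eq) auto
  then show ?thesis using d assms(1) by (simp add: is_perm_def)
qed

lemma is_perm_bij:
  assumes "is_perm \<pi>"
  shows "bij_betw ((!) \<pi>) {..<length \<pi>} {1..length \<pi>}"
  using assms bij_betw_nth[of \<pi> "{..<length \<pi>}" "set \<pi>"] by (simp add: is_perm_def)

text \<open>Replaces the \<open>inv_into\<close> of the definition by its characteristic property;
  \<open>v - 1\<close> converts a value into a list index.\<close>

lemma inverse_perm_nth:
  assumes "is_perm \<pi>" "1 \<le> v" "v \<le> length \<pi>"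
  obtains i where "i < length \<pi>" "\<pi> ! i = v" "inverse_perm \<pi> ! (v - 1) = Suc i"
proof -
  have im: "v \<in> (!) \<pi> ` {..<length \<pi>}"
    using is_perm_bij[OF assms(1)] assms by (auto simp: bij_betw_def)
  have "inv_into {..<length \<pi>} ((!) \<pi>) v < length \<pi>" using inv_into_into[OF im] by simp
  moreover have "\<pi> ! inv_into {..<length \<pi>} ((!) \<pi>) v = v" using f_inv_into_f[OF im] by simp
  moreover have "inverse_perm \<pi> ! (v - 1) = Suc (inv_into {..<length \<pi>} ((!) \<pi>) v)"
    using assms nth_upt[of 1 "v - 1" "Suc (length \<pi>)"] unfolding inverse_perm_def
    by (simp del: upt_Suc)
  ultimately show ?thesis using that by blast
qed

lemma length_inverse_perm [simp]: "length (inverse_perm \<pi>) = length \<pi>"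
  by (simp add: inverse_perm_def del: upt_Suc)

lemma pts_inverse_perm:
  assumes "is_perm \<pi>"
  shows "pts (inverse_perm \<pi>) = prod.swap ` pts \<pi>"
proof
  show "pts (inverse_perm \<pi>) \<subseteq> prod.swap ` pts \<pi>"
  proof
    fix q assume "q \<in> pts (inverse_perm \<pi>)"
    then obtain j where j: "j < length \<pi>" "q = (Suc j, inverse_perm \<pi> ! j)" by (auto simp: pts_def)
    obtain i where "i < length \<pi>" "\<pi> ! i = Suc j" "inverse_perm \<pi> ! (Suc j - 1) = Suc i"
      using inverse_perm_nth[OF assms, of "Suc j"] j by auto
    then show "q \<in> prod.swap ` pts \<pi>" using j by (auto simp: pts_def intro!: rev_image_eqI)
  qed
next
  show "prod.swap ` pts \<pi> \<subseteq> pts (inverse_perm \<pi>)"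
  proof
    fix q assume "q \<in> prod.swap ` pts \<pi>"
    then obtain k where k: "k < length \<pi>" "q = (\<pi> ! k, Suc k)" by (auto simp: pts_def)
    obtain i where i: "i < length \<pi>" "\<pi> ! i = \<pi> ! k" "inverse_perm \<pi> ! (\<pi> ! k - 1) = Suc i"
      using inverse_perm_nth[OF assms, of "\<pi> ! k"] is_perm_nth[OF assms k(1)] by auto
    then have "i = k" using assms k by (simp add: is_perm_def nth_eq_iff_index_eq)
    then show "q \<in> pts (inverse_perm \<pi>)" using i k is_perm_nth[OF assms k(1)]
      by (auto simp: pts_def intro!: rev_image_eqI[of "\<pi> ! k - 1"])
  qed
qed

lemma is_perm_inverse_perm:
  assumes "is_perm \<pi>"
  shows "is_perm (inverse_perm \<pi>)"
proof (rule is_permI_inj)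
  show "length (inverse_perm \<pi>) = length \<pi>" by simp
  show "inj_on ((!) (inverse_perm \<pi>)) {..<length \<pi>}"
  proof (rule inj_onI)
    fix x y assume xy: "x \<in> {..<length \<pi>}" "y \<in> {..<length \<pi>}"
      "inverse_perm \<pi> ! x = inverse_perm \<pi> ! y"
    obtain i where i: "\<pi> ! i = Suc x" "inverse_perm \<pi> ! (Suc x - 1) = Suc i"
      using inverse_perm_nth[OF assms, of "Suc x"] xy(1) by auto
    obtain j where j: "\<pi> ! j = Suc y" "inverse_perm \<pi> ! (Suc y - 1) = Suc j"
      using inverse_perm_nth[OF assms, of "Suc y"] xy(2) by auto
    show "x = y" using i j xy(3) by simp
  qed
  fix x assume "x < length \<pi>"
  then obtain i where "i < length \<pi>" "inverse_perm \<pi> ! (Suc x - 1) = Suc i"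
    using inverse_perm_nth[OF assms, of "Suc x"] by auto
  then show "1 \<le> inverse_perm \<pi> ! x \<and> inverse_perm \<pi> ! x \<le> length \<pi>" by simp
qed

lemma inverse_perm_inverse_perm:
  assumes "is_perm \<pi>"
  shows "inverse_perm (inverse_perm \<pi>) = \<pi>"
  by (rule pts_inject)
    (simp add: pts_inverse_perm is_perm_inverse_perm assms image_image)

lemma length_reverse_complement [simp]: "length (reverse_complement \<pi>) = length \<pi>"
  by (simp add: reverse_complement_def)

lemma is_perm_reverse_complement:
  assumes "is_perm \<pi>"
  shows "is_perm (reverse_complement \<pi>)"
proof -
  have "inj_on (\<lambda>v. length \<pi> + 1 - v) (set \<pi>)"
    using assms by (auto simp: is_perm_def inj_on_def)
  then have "distinct (reverse_complement \<pi>)"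
    using assms by (simp add: reverse_complement_def distinct_map is_perm_def)
  then have "inj_on ((!) (reverse_complement \<pi>)) {..<length \<pi>}"
    by (simp add: inj_on_nth)
  moreover have "1 \<le> reverse_complement \<pi> ! i \<and> reverse_complement \<pi> ! i \<le> length \<pi>"
    if "i < length \<pi>" for i
  proof -
    have "length \<pi> - Suc i < length \<pi>" using that by simp
    from is_perm_nth[OF assms this] show ?thesis using that
      by (auto simp: reverse_complement_def rev_nth)
  qed
  ultimately show ?thesis by (intro is_permI_inj[of _ "length \<pi>"]) auto
qed

lemma pts_reverse_complement:
  assumes "is_perm \<pi>"
  shows "pts (reverse_complement \<pi>) = reflect (length \<pi>) ` pts \<pi>"
proof -
  have "(\<lambda>i. (Suc i, length \<pi> + 1 - \<pi> ! (length \<pi> - Suc i))) ` {..<length \<pi>} =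
    (\<lambda>i. (length \<pi> - i, length \<pi> + 1 - \<pi> ! i)) ` {..<length \<pi>}" (is "?f ` ?A = ?g ` ?A")
  proof
    show "?f ` ?A \<subseteq> ?g ` ?A"
    proof
      fix q assume "q \<in> ?f ` ?A"
      then obtain i where "i < length \<pi>" "q = ?f i" by blast
      then show "q \<in> ?g ` ?A" by (intro image_eqI[of _ _ "length \<pi> - Suc i"]) auto
    qed
    show "?g ` ?A \<subseteq> ?f ` ?A"
    proof
      fix q assume "q \<in> ?g ` ?A"
      then obtain i where "i < length \<pi>" "q = ?g i" by blast
      then show "q \<in> ?f ` ?A" by (intro image_eqI[of _ _ "length \<pi> - Suc i"]) auto
    qed
  qed
  moreover have "pts (reverse_complement \<pi>) = ?f ` ?A"
    unfolding pts_def by (intro image_cong) (auto simp: reverse_complement_def rev_nth)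
  ultimately show ?thesis by (simp add: pts_def reflect_def image_image)
qed

lemma reflect_reflect:
  assumes "fst q \<le> n" "snd q \<le> n"
  shows "reflect n (reflect n q) = q"
  using assms by (simp add: reflect_def)

lemma reverse_complement_reverse_complement:
  assumes "is_perm \<pi>"
  shows "reverse_complement (reverse_complement \<pi>) = \<pi>"
proof (rule pts_inject)
  have "reflect (length \<pi>) ` reflect (length \<pi>) ` pts \<pi> = pts \<pi>"
    using pts_bounds[OF assms] by (auto simp: image_image reflect_reflect intro!: rev_image_eqI)
  then show "pts (reverse_complement (reverse_complement \<pi>)) = pts \<pi>"
    by (simp add: pts_reverse_complement is_perm_reverse_complement assms)
qed

lemma pattern_emb_swap: "pattern_emb P Q \<Longrightarrow> pattern_emb (prod.swap ` P) (prod.swap ` Q)"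
  unfolding pattern_emb_def
proof (elim exE conjE)
  fix g
  assume "g ` P \<subseteq> Q" "\<forall>a\<in>P. \<forall>b\<in>P. (fst (g a) < fst (g b) \<longleftrightarrow> fst a < fst b) \<and>
                          (snd (g a) < snd (g b) \<longleftrightarrow> snd a < snd b)"
  then show "\<exists>g. g ` prod.swap ` P \<subseteq> prod.swap ` Q \<and>
     (\<forall>a \<in> prod.swap ` P. \<forall>b \<in> prod.swap ` P. (fst (g a) < fst (g b) \<longleftrightarrow> fst a < fst b) \<and>
                          (snd (g a) < snd (g b) \<longleftrightarrow> snd a < snd b))"
    by (intro exI[of _ "prod.swap \<circ> g \<circ> prod.swap"]) (auto simp: image_comp)
qed

lemma avoids_inverse_perm:
  assumes "is_perm \<pi>" "is_perm p"
  shows "avoids (inverse_perm \<pi>) (inverse_perm p) \<longleftrightarrow> avoids \<pi> p"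
  using pattern_emb_swap[of "pts p" "pts \<pi>"]
    pattern_emb_swap[of "prod.swap ` pts p" "prod.swap ` pts \<pi>"] assms
  by (auto simp: avoids_iff_pattern_emb pts_inverse_perm image_image)

lemma pattern_emb_reflect:
  assumes "\<And>q. q \<in> P \<Longrightarrow> fst q \<le> m \<and> snd q \<le> m" "\<And>q. q \<in> Q \<Longrightarrow> fst q \<le> n \<and> snd q \<le> n"
    "pattern_emb P Q"
  shows "pattern_emb (reflect m ` P) (reflect n ` Q)"
proof -
  obtain g where g: "\<And>a. a \<in> P \<Longrightarrow> g a \<in> Q"
    "\<And>a b. a \<in> P \<Longrightarrow> b \<in> P \<Longrightarrow> fst (g a) < fst (g b) \<longleftrightarrow> fst a < fst b"
    "\<And>a b. a \<in> P \<Longrightarrow> b \<in> P \<Longrightarrow> snd (g a) < snd (g b) \<longleftrightarrow> snd a < snd b"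
    using assms(3) pattern_embE by blast
  \<comment> \<open>Subtraction is truncated, so reversal of the order is available only within the
    bound \<open>n\<close>.\<close>
  have *: "n + 1 - u < n + 1 - v \<longleftrightarrow> v < u" if "u \<le> n" "v \<le> n" for n u v :: nat
    using that by auto
  show ?thesis unfolding pattern_emb_def
  proof (intro exI[of _ "reflect n \<circ> g \<circ> reflect m"] conjI ballI)
    show "(reflect n \<circ> g \<circ> reflect m) ` reflect m ` P \<subseteq> reflect n ` Q"
      using g(1) assms(1) by (auto simp: reflect_reflect)
    fix a b assume "a \<in> reflect m ` P" "b \<in> reflect m ` P"
    then obtain a' b' where ab: "a' \<in> P" "b' \<in> P" "a = reflect m a'" "b = reflect m b'" by blast
    note bd = assms(1)[OF ab(1)] assms(1)[OF ab(2)] assms(2)[OF g(1)[OF ab(1)]]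
      assms(2)[OF g(1)[OF ab(2)]]
    have r: "reflect m a = a'" "reflect m b = b'" using ab bd by (auto simp: reflect_reflect)
    show "fst ((reflect n \<circ> g \<circ> reflect m) a) < fst ((reflect n \<circ> g \<circ> reflect m) b) \<longleftrightarrow> fst a < fst b"
      using g(2)[OF ab(2,1)] bd unfolding o_def r by (simp add: ab reflect_def *[simplified])
    show "snd ((reflect n \<circ> g \<circ> reflect m) a) < snd ((reflect n \<circ> g \<circ> reflect m) b) \<longleftrightarrow> snd a < snd b"
      using g(3)[OF ab(2,1)] bd unfolding o_def r by (simp add: ab reflect_def *[simplified])
  qed
qed

lemma avoids_reverse_complement_imp:
  assumes "is_perm \<pi>" "is_perm p" "avoids (reverse_complement \<pi>) (reverse_complement p)"
  shows "avoids \<pi> p"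
  using pattern_emb_reflect[of "pts p" "length p" "pts \<pi>" "length \<pi>"] assms
    pts_bounds[OF assms(1)] pts_bounds[OF assms(2)]
  by (auto simp: avoids_iff_pattern_emb pts_reverse_complement)

lemma avoids_reverse_complement:
  assumes "is_perm \<pi>" "is_perm p"
  shows "avoids (reverse_complement \<pi>) (reverse_complement p) \<longleftrightarrow> avoids \<pi> p"
  using avoids_reverse_complement_imp[OF assms] avoids_reverse_complement_imp[of
      "reverse_complement \<pi>" "reverse_complement p"] assms
  by (auto simp: is_perm_reverse_complement reverse_complement_reverse_complement)

section \<open>Decomposability of diagrams and of lists\<close>

lemma point_dec_swap: "point_dec P \<Longrightarrow> point_dec (prod.swap ` P)"
  unfolding point_dec_def
  by (elim exE conjE, rule_tac x="prod.swap ` A" in exI, rule_tac x="prod.swap ` B" in exI) auto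

lemma point_dec_reflect:
  assumes "\<And>q. q \<in> P \<Longrightarrow> fst q \<le> n \<and> snd q \<le> n" "point_dec P"
  shows "point_dec (reflect n ` P)"
proof -
  obtain A B where AB: "P = A \<union> B" "A \<noteq> {}" "B \<noteq> {}"
    "\<And>a b. a \<in> A \<Longrightarrow> b \<in> B \<Longrightarrow> fst a < fst b \<and> snd a < snd b"
    using assms(2) unfolding point_dec_def by blast
  show ?thesis unfolding point_dec_def
  proof (intro exI conjI ballI)
    show "reflect n ` P = reflect n ` B \<union> reflect n ` A" using AB by auto
    fix b a assume "b \<in> reflect n ` B" "a \<in> reflect n ` A"
    then obtain a' b' where ab: "a' \<in> A" "b' \<in> B" "a = reflect n a'" "b = reflect n b'" by blast
    have bd: "fst b' \<le> n" "snd b' \<le> n" using assms(1)[of b'] AB ab by auto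
    show "fst b < fst a" "snd b < snd a" using AB(4)[OF ab(1,2)] ab bd by (auto simp: reflect_def)
  qed (use AB in auto)
qed

text \<open>Lifts a cut of \<open>removeAll e xs\<close> to a cut of \<open>xs\<close>, where it can
  be expressed by positions.\<close>

lemma filter_eq_appendE:
  assumes "filter P xs = ys @ zs"
  obtains us vs where "xs = us @ vs" "filter P us = ys" "filter P vs = zs"
  using assms
proof (induction xs arbitrary: ys thesis)
  case (Cons x xs)
  show ?case
  proof (cases "P x \<and> ys \<noteq> []")
    case True
    then obtain ys' where "ys = x # ys'" "filter P xs = ys' @ zs"
      using Cons.prems(2) by (cases ys) auto
    with Cons.IH[OF _ this(2)] True show ?thesis
      by (metis Cons.prems(1) append_Cons filter.simps(2))
  next
    case False
    show ?thesis
    proof (cases "P x")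
      case True
      then have "ys = []" using False by simp
      then show ?thesis using Cons.prems(1)[of "[]" "x # xs"] Cons.prems(2) by simp
    next
      case f: False
      then have "filter P xs = ys @ zs" using Cons.prems(2) by simp
      with Cons.IH[OF _ this] f show ?thesis
        by (metis Cons.prems(1) append_Cons filter.simps(2))
    qed
  qed
qed auto

text \<open>A cut of the list is a vertical line through the diagram. Deletion is a filter on values
  in both descriptions, so neither positions nor values have to be renumbered.\<close>

lemma list_dec_removeAll_iff:
  "list_dec (removeAll e xs) \<longleftrightarrow> point_dec {q \<in> pts xs. snd q \<noteq> e}"
proof
  assume "list_dec (removeAll e xs)"
  then obtain ys zs where yz: "removeAll e xs = ys @ zs" "ys \<noteq> []" "zs \<noteq> []"
    "\<And>y z. y \<in> set ys \<Longrightarrow> z \<in> set zs \<Longrightarrow> y < z" unfolding list_dec_def by blast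
  obtain us vs where uv: "xs = us @ vs" "filter ((\<noteq>) e) us = ys" "filter ((\<noteq>) e) vs = zs"
    using filter_eq_appendE[OF yz(1)[unfolded removeAll_filter_not_eq]] by blast
  define A where "A = {q \<in> pts xs. snd q \<noteq> e \<and> fst q \<le> length us}"
  define B where "B = {q \<in> pts xs. snd q \<noteq> e \<and> fst q > length us}"
  have memA: "snd q \<in> set ys" if "q \<in> A" for q
  proof -
    obtain i where "i < length xs" "q = (Suc i, xs ! i)" "snd q \<noteq> e" "fst q \<le> length us"
      using \<open>q \<in> A\<close> unfolding A_def by (auto simp: pts_def)
    then have "snd q \<in> set us" "snd q \<noteq> e" by (auto simp: uv(1) nth_append)
    then show ?thesis by (auto simp: uv(2)[symmetric])
  qed
  have memB: "snd q \<in> set zs" if "q \<in> B" for q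
  proof -
    obtain i where "i < length xs" "q = (Suc i, xs ! i)" "snd q \<noteq> e" "fst q > length us"
      using \<open>q \<in> B\<close> unfolding B_def by (auto simp: pts_def)
    then have "snd q \<in> set vs" "snd q \<noteq> e" by (auto simp: uv(1) nth_append)
    then show ?thesis by (auto simp: uv(3)[symmetric])
  qed
  have "A \<noteq> {}"
  proof -
    obtain y where "y \<in> set us" "y \<noteq> e" using yz(2) uv(2) by (auto simp: filter_empty_conv)
    then obtain i where "i < length us" "us ! i \<noteq> e" by (auto simp: in_set_conv_nth)
    then have "(Suc i, us ! i) \<in> A"
      by (auto simp: A_def pts_def uv(1) nth_append intro!: image_eqI[of _ _ i])
    then show ?thesis by blast
  qed
  moreover have "B \<noteq> {}"
  proof -
    obtain z where "z \<in> set vs" "z \<noteq> e" using yz(3) uv(3) by (auto simp: filter_empty_conv)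
    then obtain i where "i < length vs" "vs ! i \<noteq> e" by (auto simp: in_set_conv_nth)
    then have "(Suc (length us + i), vs ! i) \<in> B"
      by (auto simp: B_def pts_def uv(1) nth_append intro!: image_eqI[of _ _ "length us + i"])
    then show ?thesis by blast
  qed
  moreover have "{q \<in> pts xs. snd q \<noteq> e} = A \<union> B" by (auto simp: A_def B_def)
  moreover have "fst a < fst b \<and> snd a < snd b" if "a \<in> A" "b \<in> B" for a b
    using that memA memB yz(4) by (force simp: A_def B_def)
  ultimately show "point_dec {q \<in> pts xs. snd q \<noteq> e}" unfolding point_dec_def by blast
next
  assume "point_dec {q \<in> pts xs. snd q \<noteq> e}"
  then obtain A B where AB: "{q \<in> pts xs. snd q \<noteq> e} = A \<union> B" "A \<noteq> {}" "B \<noteq> {}"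
    "\<And>a b. a \<in> A \<Longrightarrow> b \<in> B \<Longrightarrow> fst a < fst b \<and> snd a < snd b"
    unfolding point_dec_def by blast
  have "finite (pts xs)" by (simp add: pts_def)
  moreover have "A \<subseteq> pts xs" using AB(1) by blast
  ultimately have fin: "finite A" by (rule finite_subset[rotated])
  \<comment> \<open>The last column occupied by \<open>A\<close> is where the list is cut; the
    deleted entry may fall on either side.\<close>
  define k where "k = Max (fst ` A)"
  have A1: "fst a \<le> k" if "a \<in> A" for a using that fin by (auto simp: k_def)
  have B1: "k < fst b" if "b \<in> B" for b
  proof -
    have "k \<in> fst ` A" unfolding k_def using fin AB(2) by (intro Max_in) auto
    then show ?thesis using AB(4) \<open>b \<in> B\<close> by blast
  qed
  define ys where "ys = removeAll e (take k xs)"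
  define zs where "zs = removeAll e (drop k xs)"
  have sub: "a \<in> pts xs" "snd a \<noteq> e" if "a \<in> A \<union> B" for a using AB(1) that by blast+
  have ya: "\<exists>a \<in> A. snd a = y" if "y \<in> set ys" for y
  proof -
    obtain i where i: "i < length xs" "i < k" "xs ! i = y" "y \<noteq> e"
      using \<open>y \<in> set ys\<close> by (auto simp: ys_def in_set_conv_nth)
    then have "(Suc i, y) \<in> A \<union> B" unfolding AB(1)[symmetric] by (auto simp: pts_def)
    moreover have "(Suc i, y) \<notin> B" using B1[of "(Suc i, y)"] i by auto
    ultimately show ?thesis by force
  qed
  have zb: "\<exists>b \<in> B. snd b = z" if "z \<in> set zs" for z
  proof -
    have "z \<in> set (drop k xs)" and ze: "z \<noteq> e" using that by (auto simp: zs_def)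
    then obtain j where "j < length (drop k xs)" "drop k xs ! j = z" by (metis in_set_conv_nth)
    then have "k + j < length xs \<and> xs ! (k + j) = z \<and> z \<noteq> e" using ze by auto
    then obtain i where i: "k + i < length xs" "xs ! (k + i) = z" "z \<noteq> e" by blast
    then have "(Suc (k + i), z) \<in> A \<union> B" unfolding AB(1)[symmetric] by (auto simp: pts_def)
    moreover have "(Suc (k + i), z) \<notin> A" using A1[of "(Suc (k + i), z)"] i by auto
    ultimately show ?thesis by force
  qed
  have "ys \<noteq> []"
  proof -
    obtain a where a: "a \<in> A" using AB(2) by blast
    obtain i where i: "i < length xs" "a = (Suc i, xs ! i)" using sub[of a] a by (auto simp: pts_def)
    have "i < k" using A1[OF a] i by simp
    then have "xs ! i \<in> set (take k xs)" using i
      by (metis in_set_conv_nth length_take min_less_iff_conj nth_take)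
    then have "xs ! i \<in> set ys" using sub(2)[of a] a i by (simp add: ys_def)
    then show ?thesis by auto
  qed
  moreover have "zs \<noteq> []"
  proof -
    obtain b where b: "b \<in> B" using AB(3) by blast
    obtain i where i: "i < length xs" "b = (Suc i, xs ! i)" using sub[of b] b by (auto simp: pts_def)
    have "k \<le> i" using B1[OF b] i by simp
    then have "drop k xs ! (i - k) = xs ! i" "i - k < length (drop k xs)" using i by auto
    then have "xs ! i \<in> set (drop k xs)" by (metis nth_mem)
    then have "xs ! i \<in> set zs" using sub(2)[of b] b i by (simp add: zs_def)
    then show ?thesis by auto
  qed
  moreover have "removeAll e xs = ys @ zs"
    unfolding ys_def zs_def by (metis append_take_drop_id removeAll_append)
  moreover have "y < z" if "y \<in> set ys" "z \<in> set zs" for y z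
    using ya[OF that(1)] zb[OF that(2)] AB(4) by blast
  ultimately show "list_dec (removeAll e xs)" unfolding list_dec_def by blast
qed

lemma list_dec_map:
  assumes "\<And>x y. x \<in> set xs \<Longrightarrow> y \<in> set xs \<Longrightarrow> g x < g y \<longleftrightarrow> x < y"
  shows "list_dec (map g xs) \<longleftrightarrow> list_dec xs"
proof
  assume "list_dec (map g xs)"
  then obtain ys zs where *: "map g xs = ys @ zs" "ys \<noteq> []" "zs \<noteq> []"
    "\<And>y z. y \<in> set ys \<Longrightarrow> z \<in> set zs \<Longrightarrow> y < z" unfolding list_dec_def by blast
  obtain us vs where uv: "xs = us @ vs" "ys = map g us" "zs = map g vs"
    using *(1) by (auto simp: map_eq_append_conv)
  have "u < v" if "u \<in> set us" "v \<in> set vs" for u v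
    using *(4)[of "g u" "g v"] assms[of u v] that uv by auto
  then show "list_dec xs" using * uv unfolding list_dec_def by blast
next
  assume "list_dec xs"
  then obtain ys zs where *: "xs = ys @ zs" "ys \<noteq> []" "zs \<noteq> []"
    "\<And>y z. y \<in> set ys \<Longrightarrow> z \<in> set zs \<Longrightarrow> y < z" unfolding list_dec_def by blast
  show "list_dec (map g xs)" unfolding list_dec_def
    using * assms by (intro exI[of _ "map g ys"] exI[of _ "map g zs"]) auto
qed

text \<open>Every value below the maximum of \<open>S\<close> lies in \<open>S\<close> or
  \<open>T\<close>, and \<open>T\<close> starts only above that maximum. This makes the first block
  of a cut permutation a permutation without renumbering.\<close>

lemma lower_set_eq:
  assumes "S \<union> T = {1..n}" "S \<noteq> {}" "\<And>s t. s \<in> S \<Longrightarrow> t \<in> T \<Longrightarrow> s < t"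
  shows "S = {1..card S}"
proof -
  have fin: "finite S" using assms(1) by (metis finite_Un finite_atLeastAtMost)
  have mx: "Max S \<in> S" using fin assms(2) by simp
  have "S = {1..Max S}"
  proof
    show "S \<subseteq> {1..Max S}" using fin assms(1) by auto
    show "{1..Max S} \<subseteq> S"
    proof
      fix v assume v: "v \<in> {1..Max S}"
      moreover have "Max S \<le> n" using mx assms(1) by auto
      ultimately have "v \<in> S \<union> T" using assms(1) by auto
      then show "v \<in> S" using assms(3)[OF mx, of v] v by auto
    qed
  qed
  moreover from this have "card S = Max S" by (metis card_atLeastAtMost diff_Suc_1)
  ultimately show ?thesis by simp
qed

lemma decomposable_iff_list_dec:
  assumes "is_perm \<pi>"
  shows "decomposable \<pi> \<longleftrightarrow> list_dec \<pi>"
proof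
  assume "decomposable \<pi>"
  then obtain \<sigma> \<tau> where *: "is_perm \<sigma>" "is_perm \<tau>" "\<sigma> \<noteq> []" "\<tau> \<noteq> []" "\<pi> = \<sigma> \<oplus> \<tau>"
    unfolding decomposable_def by blast
  show "list_dec \<pi>" unfolding list_dec_def
    using * by (intro exI[of _ \<sigma>] exI[of _ "map (\<lambda>v. v + length \<sigma>) \<tau>"])
      (auto simp: direct_sum_def is_perm_def)
next
  assume "list_dec \<pi>"
  then obtain ys zs where *: "\<pi> = ys @ zs" "ys \<noteq> []" "zs \<noteq> []"
    "\<And>y z. y \<in> set ys \<Longrightarrow> z \<in> set zs \<Longrightarrow> y < z" unfolding list_dec_def by blast
  have U: "set ys \<union> set zs = {1..length ys + length zs}" and d: "distinct ys" "distinct zs"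
    using assms *(1) by (auto simp: is_perm_def)
  have sy: "set ys = {1..length ys}"
  proof -
    have "set ys = {1..card (set ys)}" using U *(2,4) by (intro lower_set_eq[of _ "set zs"]) auto
    then show ?thesis using d(1) by (simp only: distinct_card)
  qed
  have "set zs = (set ys \<union> set zs) - set ys" using *(4) less_irrefl by blast
  also have "\<dots> = {1..length ys + length zs} - {1..length ys}" by (simp only: U) (simp only: sy)
  also have "\<dots> = {Suc (length ys)..length ys + length zs}" by auto
  finally have sz: "set zs = {Suc (length ys)..length ys + length zs}" .
  define \<tau> where "\<tau> = map (\<lambda>v. v - length ys) zs"
  have "inj_on (\<lambda>v. v - length ys) (set zs)" unfolding sz by (auto simp: inj_on_def)
  then have "distinct \<tau>" unfolding \<tau>_def using d by (simp add: distinct_map)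
  moreover have "set \<tau> = {1..length \<tau>}"
  proof -
    have "(\<lambda>v. v - length ys) ` {Suc (length ys)..length ys + length zs} = {1..length zs}"
      by (auto intro!: image_eqI[of _ _ "_ + length ys"])
    then show ?thesis by (simp add: \<tau>_def sz)
  qed
  ultimately have "is_perm \<tau>" by (simp add: is_perm_def)
  moreover have "is_perm ys" using sy d by (simp add: is_perm_def)
  moreover have "\<pi> = ys \<oplus> \<tau>"
  proof -
    have "map ((\<lambda>v. v + length ys) \<circ> (\<lambda>v. v - length ys)) zs = zs"
      by (rule map_idI) (use sz in auto)
    then show ?thesis by (simp add: *(1) direct_sum_def \<tau>_def)
  qed
  moreover have "\<tau> \<noteq> []" using *(3) by (simp add: \<tau>_def)
  ultimately show "decomposable \<pi>" unfolding decomposable_def using *(2) by blast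
qed

lemma list_dec_standardize: "list_dec (standardize xs) \<longleftrightarrow> list_dec xs"
  unfolding standardize_def
  by (rule list_dec_map) (rule card_le_less_iff; simp)

lemma decomposable_delete_value:
  assumes "is_perm \<pi>"
  shows "decomposable (\<pi> \<setminus> e) \<longleftrightarrow> point_dec {q \<in> pts \<pi>. snd q \<noteq> e}"
proof -
  have "is_perm (\<pi> \<setminus> e)" unfolding delete_value_def
    using assms by (intro standardize_is_perm) (simp add: is_perm_def distinct_removeAll)
  then show ?thesis
    by (simp add: decomposable_iff_list_dec delete_value_def list_dec_standardize
        list_dec_removeAll_iff)
qed

lemma decomposable_iff_point_dec:
  assumes "is_perm \<pi>"
  shows "decomposable \<pi> \<longleftrightarrow> point_dec (pts \<pi>)"
proof -
  \<comment> \<open>No permutation contains 0, so the statement is the deletion lemma for the value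
    0.\<close>
  have "0 \<notin> set \<pi>" using assms by (simp add: is_perm_def)
  then have "removeAll 0 \<pi> = \<pi>" "{q \<in> pts \<pi>. snd q \<noteq> 0} = pts \<pi>"
    using pts_bounds(3)[OF assms] by (fastforce simp: removeAll_id)+
  then show ?thesis
    using list_dec_removeAll_iff[of 0 \<pi>] by (simp add: decomposable_iff_list_dec assms)
qed

section \<open>The map on direct sums\<close>

lemma length_direct_sum [simp]: "length (\<sigma> \<oplus> \<tau>) = length \<sigma> + length \<tau>"
  by (simp add: direct_sum_def)

lemma direct_sum_Nil [simp]: "[] \<oplus> \<tau> = \<tau>" "\<sigma> \<oplus> [] = \<sigma>"
  by (simp_all add: direct_sum_def)

lemma direct_sum_assoc: "(\<rho> \<oplus> \<sigma>) \<oplus> \<tau> = \<rho> \<oplus> \<sigma> \<oplus> \<tau>"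
  by (simp add: direct_sum_def add.assoc add.commute)

lemma direct_sum_eq_iff:
  assumes "length \<sigma> = length \<sigma>'"
  shows "\<sigma> \<oplus> \<tau> = \<sigma>' \<oplus> \<tau>' \<longleftrightarrow> \<sigma> = \<sigma>' \<and> \<tau> = \<tau>'"
proof -
  have "inj (\<lambda>v. v + length \<sigma>')" by (auto simp: inj_def)
  then have "map (\<lambda>v. v + length \<sigma>') \<tau> = map (\<lambda>v. v + length \<sigma>') \<tau>' \<longleftrightarrow> \<tau> = \<tau>'"
    by (rule inj_map_eq_map)
  then show ?thesis using assms by (simp add: direct_sum_def)
qed

lemma set_shift_perm:
  assumes "is_perm \<tau>"
  shows "set (map (\<lambda>v. v + k) \<tau>) = {Suc k..k + length \<tau>}"
proof -
  have "(\<lambda>v. v + k) ` {1..length \<tau>} = {Suc k..k + length \<tau>}"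
    by (auto intro!: image_eqI[of _ _ "_ - k"])
  then show ?thesis using assms by (simp add: is_perm_def)
qed

lemma is_perm_direct_sum:
  assumes "is_perm \<sigma>" "is_perm \<tau>"
  shows "is_perm (\<sigma> \<oplus> \<tau>)"
proof -
  have s: "set \<sigma> = {1..length \<sigma>}" "distinct \<sigma>" using assms by (auto simp: is_perm_def)
  note t = set_shift_perm[OF assms(2), of "length \<sigma>"]
  have "distinct (map (\<lambda>v. v + length \<sigma>) \<tau>)"
    using assms by (auto simp: is_perm_def distinct_map inj_on_def)
  then have "distinct (\<sigma> \<oplus> \<tau>)" unfolding direct_sum_def distinct_append t using s by auto
  moreover have "set (\<sigma> \<oplus> \<tau>) = {1..length (\<sigma> \<oplus> \<tau>)}"
    unfolding direct_sum_def set_append t s(1) by auto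
  ultimately show ?thesis by (simp add: is_perm_def)
qed

lemma is_perm_Nil [simp]: "is_perm []" by (simp add: is_perm_def)

lemma decomposable_direct_sum:
  "is_perm \<sigma> \<Longrightarrow> is_perm \<tau> \<Longrightarrow> \<sigma> \<noteq> [] \<Longrightarrow> \<tau> \<noteq> [] \<Longrightarrow> decomposable (\<sigma> \<oplus> \<tau>)"
  unfolding decomposable_def by blast

section \<open>Outer components and small patterns\<close>

lemma first_component:
  assumes "is_perm \<pi>" "\<pi> \<noteq> []"
  obtains \<sigma> \<rho> where "is_perm \<sigma>" "\<sigma> \<noteq> []" "\<not> decomposable \<sigma>" "is_perm \<rho>" "\<pi> = \<sigma> \<oplus> \<rho>"
  using assms
proof (induction "length \<pi>" arbitrary: \<pi> thesis rule: less_induct)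
  case less
  show ?case
  proof (cases "decomposable \<pi>")
    case True
    then obtain \<sigma> \<tau> where *: "is_perm \<sigma>" "is_perm \<tau>" "\<sigma> \<noteq> []" "\<tau> \<noteq> []" "\<pi> = \<sigma> \<oplus> \<tau>"
      unfolding decomposable_def by blast
    then have "length \<sigma> < length \<pi>" by simp
    from less.hyps[OF this _ *(1,3)] obtain \<sigma>' \<rho> where
      "is_perm \<sigma>'" "\<sigma>' \<noteq> []" "\<not> decomposable \<sigma>'" "is_perm \<rho>" "\<sigma> = \<sigma>' \<oplus> \<rho>" by blast
    then show ?thesis using less.prems(1) * by (metis direct_sum_assoc is_perm_direct_sum)
  next
    case False
    then show ?thesis using less.prems by (metis direct_sum_Nil(2) is_perm_Nil)
  qed
qed

lemma last_component:
  assumes "is_perm \<pi>" "\<pi> \<noteq> []"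
  obtains \<rho> \<tau> where "is_perm \<tau>" "\<tau> \<noteq> []" "\<not> decomposable \<tau>" "is_perm \<rho>" "\<pi> = \<rho> \<oplus> \<tau>"
  using assms
proof (induction "length \<pi>" arbitrary: \<pi> thesis rule: less_induct)
  case less
  show ?case
  proof (cases "decomposable \<pi>")
    case True
    then obtain \<sigma> \<tau> where *: "is_perm \<sigma>" "is_perm \<tau>" "\<sigma> \<noteq> []" "\<tau> \<noteq> []" "\<pi> = \<sigma> \<oplus> \<tau>"
      unfolding decomposable_def by blast
    then have "length \<tau> < length \<pi>" by simp
    from less.hyps[OF this _ *(2,4)] obtain \<rho> \<tau>' where
      "is_perm \<tau>'" "\<tau>' \<noteq> []" "\<not> decomposable \<tau>'" "is_perm \<rho>" "\<tau> = \<rho> \<oplus> \<tau>'" by blast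
    then show ?thesis using less.prems(1) * by (metis direct_sum_assoc is_perm_direct_sum)
  next
    case False
    then show ?thesis using less.prems by (metis direct_sum_Nil(1) is_perm_Nil)
  qed
qed

text \<open>Expands \<open>order_iso\<close> with an explicit pattern into finitely many
  comparisons.\<close>

lemma all_less_numeral_Suc: "(\<forall>i < Suc n. P i) \<longleftrightarrow> P 0 \<and> (\<forall>i < n. P (Suc i))"
  by (auto simp: less_Suc_eq_0_disj)

lemma order_iso_1324_iff: "order_iso [a,b,c,d] [1,3,2,4] \<longleftrightarrow> a < c \<and> c < b \<and> b < d"
  by (simp add: order_iso_def all_less_numeral_Suc) auto

lemma order_iso_132_iff: "order_iso xs [1,3,2] \<longleftrightarrow> (\<exists>a b c. xs = [a,b,c] \<and> a < c \<and> c < b)"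
proof -
  have "order_iso [a,b,c] [1,3,2] \<longleftrightarrow> a < c \<and> c < b" for a b c
    by (simp add: order_iso_def all_less_numeral_Suc) auto
  moreover have "\<exists>a b c. xs = [a,b,c]" if "order_iso xs [1,3,2]"
    using that by (auto simp: order_iso_def numeral_3_eq_3 length_Suc_conv)
  ultimately show ?thesis by blast
qed

lemma order_iso_213_iff: "order_iso xs [2,1,3] \<longleftrightarrow> (\<exists>a b c. xs = [a,b,c] \<and> b < a \<and> a < c)"
proof -
  have "order_iso [a,b,c] [2,1,3] \<longleftrightarrow> b < a \<and> a < c" for a b c
    by (simp add: order_iso_def all_less_numeral_Suc) auto
  moreover have "\<exists>a b c. xs = [a,b,c]" if "order_iso xs [2,1,3]"
    using that by (auto simp: order_iso_def numeral_3_eq_3 length_Suc_conv)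
  ultimately show ?thesis by blast
qed

lemma avoids_1324D:
  "avoids \<pi> [1,3,2,4] \<Longrightarrow> subseq [a,b,c,d] \<pi> \<Longrightarrow> a < c \<Longrightarrow> c < b \<Longrightarrow> b < d \<Longrightarrow> False"
  unfolding avoids_def using order_iso_1324_iff by blast

lemma length_id_perm [simp]: "length (id_perm m) = m" by (simp add: id_perm_def del: upt_Suc)

lemma id_perm_1: "id_perm 1 = [1]"
  by (simp add: id_perm_def)

lemma id_perm_direct_sum: "id_perm a \<oplus> id_perm b = id_perm (a + b)"
proof (rule nth_equalityI)
  fix i assume "i < length (id_perm a \<oplus> id_perm b)"
  then show "(id_perm a \<oplus> id_perm b) ! i = id_perm (a + b) ! i"
    by (auto simp: direct_sum_def nth_append id_perm_def nth_upt simp del: upt_Suc)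
qed simp

lemma sorted_perm_eq_id_perm:
  assumes "is_perm \<pi>" "sorted \<pi>"
  shows "\<pi> = id_perm (length \<pi>)"
proof -
  have "set \<pi> = {1..<Suc (length \<pi>)}" "distinct \<pi>"
    using assms by (simp_all add: is_perm_def atLeastLessThanSuc_atLeastAtMost)
  then show ?thesis using assms(2) unfolding id_perm_def
    by (intro sorted_distinct_set_unique) (simp_all del: upt_Suc)
qed

lemma not_sorted_descent:
  assumes "\<not> sorted (xs :: nat list)"
  obtains y z where "subseq [y, z] xs" "z < y"
proof -
  obtain i j where ij: "i < j" "j < length xs" "xs ! j < xs ! i"
    using assms by (force simp: sorted_iff_nth_mono_less not_le)
  have "subseq [xs ! i, xs ! j] xs" unfolding subseq_iff_index
    using ij by (intro exI[of _ "\<lambda>k. if k = 0 then i else j"]) (auto simp: less_Suc_eq)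
  then show ?thesis using that ij by blast
qed

lemma sorted_map_add: "sorted (map (\<lambda>v. v + k) xs) \<longleftrightarrow> sorted (xs :: nat list)"
  by (induction xs) auto

lemma subseq_set: "subseq xs ys \<Longrightarrow> set xs \<subseteq> set ys"
  by (auto simp: subseq_conv_nths dest: in_set_nthsD)

lemma subseq_append_both: "subseq xs xs' \<Longrightarrow> subseq ys ys' \<Longrightarrow> subseq (xs @ ys) (xs' @ ys')"
  by (rule list_emb_append_mono)

text \<open>If \<sigma> were longer than \<alpha>, then \<alpha> would be a proper prefix of
  \<sigma> consisting of its smallest values, and \<sigma> would split there.\<close>

lemma indecomposable_prefix_le:
  assumes "is_perm \<sigma>" "\<not> decomposable \<sigma>" "is_perm \<alpha>" "\<alpha> \<noteq> []" "\<sigma> \<oplus> \<rho> = \<alpha> \<oplus> \<beta>"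
  shows "length \<sigma> \<le> length \<alpha>"
proof (rule ccontr)
  assume *: "\<not> length \<sigma> \<le> length \<alpha>"
  have "take (length \<alpha>) (\<sigma> \<oplus> \<rho>) = \<alpha>" unfolding assms(5) by (simp add: direct_sum_def)
  then have al: "\<alpha> = take (length \<alpha>) \<sigma>" using * by (simp add: direct_sum_def)
  then have split: "\<sigma> = \<alpha> @ drop (length \<alpha>) \<sigma>" by (metis append_take_drop_id)
  have "y < z" if "y \<in> set \<alpha>" "z \<in> set (drop (length \<alpha>) \<sigma>)" for y z
  proof -
    have "distinct \<sigma>" "set \<sigma> = {1..length \<sigma>}" using assms(1) by (auto simp: is_perm_def)
    then have "z \<notin> set \<alpha>" "1 \<le> z" using that split in_set_dropD[OF that(2)]
      by (metis disjoint_iff distinct_append, simp)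
    then show ?thesis using that(1) assms(3) by (auto simp: is_perm_def)
  qed
  then have "list_dec \<sigma>" unfolding list_dec_def using split assms(4) *
    by (intro exI[of _ \<alpha>] exI[of _ "drop (length \<alpha>) \<sigma>"]) auto
  then show False using assms by (simp add: decomposable_iff_list_dec)
qed

text \<open>A cut strictly inside \<tau> would split it. Together with the version for prefixes this
  confines every cut of \<open>\<sigma> \<oplus> id_perm m \<oplus> \<tau>\<close> to the identity
  block.\<close>

lemma indecomposable_suffix_le:
  assumes "is_perm \<tau>" "\<not> decomposable \<tau>" "is_perm \<alpha>" "is_perm \<beta>" "\<beta> \<noteq> []" "\<rho> \<oplus> \<tau> = \<alpha> \<oplus> \<beta>"
  shows "length \<tau> \<le> length \<beta>"
proof (rule ccontr)
  assume *: "\<not> length \<tau> \<le> length \<beta>"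
  define T where "T = map (\<lambda>v. v + length \<rho>) \<tau>"
  define B where "B = map (\<lambda>v. v + length \<alpha>) \<beta>"
  have eq: "\<rho> @ T = \<alpha> @ B" using assms(6) by (simp add: direct_sum_def T_def B_def)
  have len: "length T > length B" using * by (simp add: T_def B_def)
  have "length \<rho> < length \<alpha>" using arg_cong[OF eq, of length] len by simp
  then obtain us where us: "\<alpha> = \<rho> @ us" "T = us @ B" "us \<noteq> []"
    using eq len by (auto simp: append_eq_append_conv2)
  have "y < z" if "y \<in> set us" "z \<in> set B" for y z
  proof -
    have "y \<in> set \<alpha>" using that us by simp
    then have "y \<le> length \<alpha>" using assms(3) by (simp add: is_perm_def)
    moreover have "length \<alpha> < z" using that(2) assms(4) unfolding B_def
      by (auto simp: is_perm_def)
    ultimately show ?thesis by simp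
  qed
  then have "list_dec T" unfolding list_dec_def us(2) using us(3) assms(5)
    by (intro exI[of _ us] exI[of _ B]) (auto simp: B_def)
  then have "list_dec \<tau>" unfolding T_def by (subst (asm) list_dec_map) auto
  then show False using assms by (simp add: decomposable_iff_list_dec)
qed

text \<open>The middle of a \<open>1324\<close>-avoider is increasing, so every cut \<open>\<alpha> \<oplus> \<beta>\<close> differs from
  \<open>\<sigma> \<oplus> id_perm m \<oplus> \<tau>\<close> only by the position of the cut inside \<open>id_perm m\<close>.\<close>

lemma f_tilde_direct_sum:
  assumes "is_perm \<alpha>" "is_perm \<beta>" "\<alpha> \<noteq> []" "\<beta> \<noteq> []" "avoids (\<alpha> \<oplus> \<beta>) [1,3,2,4]"
  shows "f_tilde (\<alpha> \<oplus> \<beta>) = \<alpha> \<oplus> [1] \<oplus> \<beta>"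
  unfolding f_tilde_def
proof (rule the_equality)
  obtain \<sigma> \<alpha>' where s: "is_perm \<sigma>" "\<sigma> \<noteq> []" "\<not> decomposable \<sigma>" "is_perm \<alpha>'" "\<alpha> = \<sigma> \<oplus> \<alpha>'"
    using first_component[OF assms(1,3)] by blast
  obtain \<beta>' \<tau> where t: "is_perm \<tau>" "\<tau> \<noteq> []" "\<not> decomposable \<tau>" "is_perm \<beta>'" "\<beta> = \<beta>' \<oplus> \<tau>"
    using last_component[OF assms(2,4)] by blast
  have st: "\<alpha> \<oplus> \<beta> = \<sigma> \<oplus> (\<alpha>' \<oplus> \<beta>') \<oplus> \<tau>" by (simp add: s(5) t(5) direct_sum_assoc)
  define M where "M = map (\<lambda>v. v + length \<sigma>) (\<alpha>' \<oplus> \<beta>')"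
  define k where "k = length \<sigma> + length (\<alpha>' \<oplus> \<beta>')"
  define T where "T = map (\<lambda>v. v + k) \<tau>"
  have stl: "\<alpha> \<oplus> \<beta> = \<sigma> @ M @ T" unfolding st by (simp add: direct_sum_def M_def T_def k_def add_ac)
  have mid: "is_perm (\<alpha>' \<oplus> \<beta>')" using s t by (simp add: is_perm_direct_sum)
  have S_le: "v \<le> length \<sigma>" if "v \<in> set \<sigma>" for v using s(1) that by (simp add: is_perm_def)
  have M_b: "length \<sigma> < v \<and> v \<le> k" if "v \<in> set M" for v
    using that unfolding M_def set_shift_perm[OF mid] by (auto simp: k_def)
  have T_b: "k < v" if "v \<in> set T" for v using that unfolding T_def set_shift_perm[OF t(1)] by auto
  have kl: "length \<sigma> \<le> k" by (simp add: k_def)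
  have memS: "hd \<sigma> \<in> set \<sigma>" using s(2) by simp
  have memT: "hd T \<in> set T" using t(2) by (intro hd_in_set) (simp add: T_def)
  have s1: "subseq [hd \<sigma>] \<sigma>" and t1: "subseq [hd T] T"
    using memS memT by (simp_all only: subseq_singleton_left)
  \<comment> \<open>A descent in the middle, framed by one entry of \<sigma> and one of \<tau>, is a
    1324. The same two outer entries complete a 132 in \<sigma> or a 213 in \<tau> further
    down.\<close>
  have "sorted M"
  proof (rule ccontr)
    assume "\<not> sorted M"
    then obtain y z where yz: "subseq [y, z] M" "z < y" using not_sorted_descent by blast
    have "subseq ([hd \<sigma>] @ [y, z] @ [hd T]) (\<sigma> @ M @ T)"
      by (intro subseq_append_both s1 t1 yz)
    then have "subseq [hd \<sigma>, y, z, hd T] (\<alpha> \<oplus> \<beta>)" by (simp only: stl append.simps)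
    moreover have "y \<in> set M" "z \<in> set M" using subseq_set[OF yz(1)] by auto
    then have "hd \<sigma> < z" "y < hd T"
      using M_b[of y] M_b[of z] S_le[OF memS] T_b[OF memT] by linarith+
    ultimately show False using avoids_1324D[OF assms(5)] yz(2) by blast
  qed
  then have "sorted (\<alpha>' \<oplus> \<beta>')" unfolding M_def by (simp only: sorted_map_add)
  then have srt: "sorted \<alpha>'" "sorted \<beta>'"
    by (simp_all add: direct_sum_def sorted_append sorted_map_add)
  define a b where "a = length \<alpha>'" and "b = length \<beta>'"
  have ab: "\<alpha>' = id_perm a" "\<beta>' = id_perm b"
    unfolding a_def b_def using srt s t by (simp_all add: sorted_perm_eq_id_perm[symmetric])
  have av132: "avoids \<sigma> [1,3,2]" unfolding avoids_def
  proof safe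
    fix xs assume "subseq xs \<sigma>" "order_iso xs [1,3,2]"
    then obtain u v w where uvw: "subseq [u,v,w] \<sigma>" "u < w" "w < v" unfolding order_iso_132_iff by auto
    have "subseq ([u,v,w] @ [hd T]) (\<sigma> @ (M @ T))"
      using t1 by (intro subseq_append_both uvw subseq_drop_many)
    then have "subseq [u, v, w, hd T] (\<alpha> \<oplus> \<beta>)" by (simp only: stl append.simps)
    moreover have "v \<in> set \<sigma>" using subseq_set[OF uvw(1)] by auto
    then have "v < hd T" using S_le[of v] T_b[OF memT] kl by linarith
    ultimately show False using avoids_1324D[OF assms(5)] uvw(2,3) by blast
  qed
  have av213: "avoids \<tau> [2,1,3]" unfolding avoids_def
  proof safe
    fix xs assume "subseq xs \<tau>" "order_iso xs [2,1,3]"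
    then obtain u v w where uvw: "subseq [u,v,w] \<tau>" "v < u" "u < w" unfolding order_iso_213_iff by auto
    have "subseq (map (\<lambda>v. v + k) [u,v,w]) T" unfolding T_def using uvw(1) by (rule subseq_map)
    then have sT: "subseq [u+k,v+k,w+k] T" by simp
    then have "subseq ([hd \<sigma>] @ [u+k,v+k,w+k]) (\<sigma> @ (M @ T))"
      by (intro subseq_append_both s1 subseq_drop_many)
    then have "subseq [hd \<sigma>, u+k, v+k, w+k] (\<alpha> \<oplus> \<beta>)" by (simp only: stl append.simps)
    moreover have "v + k \<in> set T" using subseq_set[OF sT] by auto
    then have "hd \<sigma> < v + k" using S_le[OF memS] T_b[of "v+k"] kl by linarith
    moreover have "v + k < u + k" "u + k < w + k" using uvw by simp_all
    ultimately show False using avoids_1324D[OF assms(5)] by blast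
  qed
  have e1: "\<alpha> \<oplus> \<beta> = \<sigma> \<oplus> id_perm (a + b) \<oplus> \<tau>" unfolding st ab id_perm_direct_sum ..
  have "\<alpha> \<oplus> [1] \<oplus> \<beta> = \<sigma> \<oplus> (id_perm a \<oplus> id_perm 1 \<oplus> id_perm b) \<oplus> \<tau>"
    by (simp only: s(5) t(5) ab direct_sum_assoc id_perm_1)
  then have e2: "\<alpha> \<oplus> [1] \<oplus> \<beta> = \<sigma> \<oplus> id_perm (a + b + 1) \<oplus> \<tau>"
    unfolding id_perm_direct_sum by (simp add: add_ac)
  show "\<exists>\<sigma> m \<tau>. is_perm \<sigma> \<and> \<sigma> \<noteq> [] \<and> \<not> decomposable \<sigma> \<and> avoids \<sigma> [1,3,2] \<and>
     is_perm \<tau> \<and> \<tau> \<noteq> [] \<and> \<not> decomposable \<tau> \<and> avoids \<tau> [2,1,3] \<and>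
     \<alpha> \<oplus> \<beta> = \<sigma> \<oplus> id_perm m \<oplus> \<tau> \<and> \<alpha> \<oplus> [1] \<oplus> \<beta> = \<sigma> \<oplus> id_perm (m + 1) \<oplus> \<tau>"
    using s(1-3) t(1-3) av132 av213 e1 e2 by blast
next
  fix \<rho> assume "\<exists>\<sigma> m \<tau>. is_perm \<sigma> \<and> \<sigma> \<noteq> [] \<and> \<not> decomposable \<sigma> \<and> avoids \<sigma> [1,3,2] \<and>
     is_perm \<tau> \<and> \<tau> \<noteq> [] \<and> \<not> decomposable \<tau> \<and> avoids \<tau> [2,1,3] \<and>
     \<alpha> \<oplus> \<beta> = \<sigma> \<oplus> id_perm m \<oplus> \<tau> \<and> \<rho> = \<sigma> \<oplus> id_perm (m + 1) \<oplus> \<tau>"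
  then obtain \<sigma> m \<tau> where *: "is_perm \<sigma>" "\<not> decomposable \<sigma>" "is_perm \<tau>" "\<not> decomposable \<tau>"
    "\<sigma> \<oplus> id_perm m \<oplus> \<tau> = \<alpha> \<oplus> \<beta>" "\<rho> = \<sigma> \<oplus> id_perm (m + 1) \<oplus> \<tau>" by metis
  have l1: "length \<sigma> \<le> length \<alpha>" using indecomposable_prefix_le[OF *(1,2) assms(1,3) *(5)] .
  have l2: "length \<tau> \<le> length \<beta>"
    using indecomposable_suffix_le[OF *(3,4) assms(1,2,4), of "\<sigma> \<oplus> id_perm m"] *(5)
    by (simp add: direct_sum_assoc)
  have l3: "length \<sigma> + m + length \<tau> = length \<alpha> + length \<beta>"
    using arg_cong[OF *(5), of length] by simp
  \<comment> \<open>The given cut lies \<open>j\<close> entries deep in the identity block, with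
    \<open>j \<le> m\<close> by the length bounds. An entry inserted there only lengthens the block
    by one, whatever \<open>j\<close> is.\<close>
  define j where "j = length \<alpha> - length \<sigma>"
  have m: "m = j + (m - j)" using l1 l2 l3 by (simp add: j_def)
  have "(\<sigma> \<oplus> id_perm j) \<oplus> (id_perm (m - j) \<oplus> \<tau>) = \<sigma> \<oplus> (id_perm j \<oplus> id_perm (m - j)) \<oplus> \<tau>"
    by (simp only: direct_sum_assoc)
  also have "\<dots> = \<alpha> \<oplus> \<beta>" unfolding id_perm_direct_sum using *(5) m by simp
  finally have "\<sigma> \<oplus> id_perm j = \<alpha> \<and> id_perm (m - j) \<oplus> \<tau> = \<beta>"
    using l1 by (subst (asm) direct_sum_eq_iff) (simp_all add: j_def)
  then have "\<alpha> \<oplus> [1] \<oplus> \<beta> = \<sigma> \<oplus> (id_perm j \<oplus> id_perm 1 \<oplus> id_perm (m - j)) \<oplus> \<tau>"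
    by (auto simp only: direct_sum_assoc id_perm_1)
  also have "\<dots> = \<rho>" unfolding id_perm_direct_sum using *(6) m by simp
  finally show "\<rho> = \<alpha> \<oplus> [1] \<oplus> \<beta>" ..
qed

section \<open>The image of case (1) in one-line notation\<close>

definition skip :: "nat \<Rightarrow> nat \<Rightarrow> nat" where
  "skip c v = (if v < c then v else Suc v)"

lemma skip_less_iff: "skip c u < skip c v \<longleftrightarrow> u < v"
  by (auto simp: skip_def)

lemma inj_skip: "inj (skip c)"
  by (auto simp: inj_def skip_def split: if_splits)

text \<open>\<open>skip c\<close> enumerates the naturals other than \<open>c\<close> in increasing
  order and so undoes the standardisation of the tail. The tail is thus determined by
  \<open>c\<close> and its standardisation, which settles uniqueness in the \<open>THE\<close> of
  \<open>f_case1\<close>.\<close>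

lemma perm_Cons_eq_map_skip:
  assumes "is_perm (c # r)"
  shows "r = map (skip c) (standardize r)"
proof -
  have S: "set r = {1..Suc (length r)} - {c}" "c \<in> {1..Suc (length r)}"
    using assms by (auto simp: is_perm_def)
  have "skip c (card {y \<in> set r. y \<le> v}) = v" if "v \<in> set r" for v
  proof -
    have v: "1 \<le> v" "v \<le> Suc (length r)" "v \<noteq> c" using that S by auto
    have eq: "{y \<in> set r. y \<le> v} = {1..v} - {c}" unfolding S using v by auto
    show ?thesis
    proof (cases "v < c")
      case True
      then have "{y \<in> set r. y \<le> v} = {1..v}" unfolding eq by auto
      then show ?thesis using True by (simp add: skip_def)
    next
      case False
      then have "card {y \<in> set r. y \<le> v} = v - 1" unfolding eq using S(2) by simp
      then show ?thesis using False v by (simp add: skip_def)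
    qed
  qed
  then show ?thesis unfolding standardize_def by (simp add: map_idI)
qed

lemma is_perm_Cons_map_skip:
  assumes "is_perm w" "1 \<le> c" "c \<le> Suc (length w)"
  shows "is_perm (c # map (skip c) w)"
proof -
  have "skip c ` {1..length w} = {1..Suc (length w)} - {c}"
  proof
    show "skip c ` {1..length w} \<subseteq> {1..Suc (length w)} - {c}" by (auto simp: skip_def)
    show "{1..Suc (length w)} - {c} \<subseteq> skip c ` {1..length w}"
    proof
      fix v assume v: "v \<in> {1..Suc (length w)} - {c}"
      show "v \<in> skip c ` {1..length w}"
        by (rule image_eqI[of _ _ "if v < c then v else v - 1"])
          (use v assms(2,3) in \<open>auto simp: skip_def\<close>)
    qed
  qed
  then show ?thesis using assms
    by (auto simp: is_perm_def distinct_map inj_on_subset[OF inj_skip])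
qed

lemma delete_hd_Cons: "is_perm (c # r) \<Longrightarrow> (c # r) \<setminus> c = standardize r"
  by (simp add: delete_value_def is_perm_def removeAll_id)

text \<open>The bound \<open>length r \<le> length w\<close> keeps \<open>c\<close> a legitimate
  value for a permutation of length \<open>Suc (length w)\<close>.\<close>

lemma f_case1_Cons:
  assumes "is_perm (c # r)" "f_tilde (standardize r) = w" "is_perm w" "length r \<le> length w"
  shows "f_case1 (c # r) = c # map (skip c) w"
  unfolding f_case1_def
proof (rule the_equality)
  have "c \<in> {1..Suc (length r)}" using assms(1) by (auto simp: is_perm_def)
  then have p: "is_perm (c # map (skip c) w)"
    using assms by (intro is_perm_Cons_map_skip) auto
  then have "map (skip c) (standardize (map (skip c) w)) = map (skip c) w"
    using perm_Cons_eq_map_skip by metis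
  then have "standardize (map (skip c) w) = w" using inj_skip by (metis inj_map_eq_map)
  then show "is_perm (c # map (skip c) w) \<and> c # map (skip c) w \<noteq> [] \<and>
    hd (c # map (skip c) w) = hd (c # r) \<and>
    (c # map (skip c) w) \<setminus> hd (c # r) = f_tilde ((c # r) \<setminus> hd (c # r))"
    using p assms by (simp add: delete_hd_Cons)
next
  fix \<rho> assume *: "is_perm \<rho> \<and> \<rho> \<noteq> [] \<and> hd \<rho> = hd (c # r) \<and>
     \<rho> \<setminus> hd (c # r) = f_tilde ((c # r) \<setminus> hd (c # r))"
  then obtain r' where r': "\<rho> = c # r'" by (cases \<rho>) auto
  have p': "is_perm (c # r')" and d: "(c # r') \<setminus> c = f_tilde ((c # r) \<setminus> c)"
    using * by (simp_all add: r')
  have "standardize r' = w"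
    using d unfolding delete_hd_Cons[OF p'] delete_hd_Cons[OF assms(1)] assms(2) .
  then show "\<rho> = c # map (skip c) w" using perm_Cons_eq_map_skip[OF p'] r' by simp
qed

text \<open>The tail inherits avoidance of 1324, so \<open>f_tilde\<close> may be computed at the
  given cut, which need not isolate the outer components.\<close>

lemma f_case1_direct_sum:
  assumes "is_perm \<pi>" "\<pi> \<noteq> []" "\<pi> \<setminus> hd \<pi> = \<alpha> \<oplus> \<beta>"
    "is_perm \<alpha>" "is_perm \<beta>" "\<alpha> \<noteq> []" "\<beta> \<noteq> []" "avoids \<pi> [1,3,2,4]"
  shows "\<pi> = hd \<pi> # map (skip (hd \<pi>)) (\<alpha> \<oplus> \<beta>)"
    "f_case1 \<pi> = hd \<pi> # map (skip (hd \<pi>)) (\<alpha> \<oplus> [1] \<oplus> \<beta>)"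
    "is_perm (f_case1 \<pi>)"
proof -
  obtain c r where cr: "\<pi> = c # r" using assms(2) by (cases \<pi>) auto
  have st: "standardize r = \<alpha> \<oplus> \<beta>" using assms(1,3) by (simp add: cr delete_hd_Cons)
  have r: "r = map (skip c) (\<alpha> \<oplus> \<beta>)" using perm_Cons_eq_map_skip[of c r] assms(1) cr st by simp
  then show "\<pi> = hd \<pi> # map (skip (hd \<pi>)) (\<alpha> \<oplus> \<beta>)" by (simp add: cr)
  have "avoids (\<alpha> \<oplus> \<beta>) [1,3,2,4]" unfolding avoids_def
  proof safe
    fix xs assume xs: "subseq xs (\<alpha> \<oplus> \<beta>)" "order_iso xs [1,3,2,4]"
    then have "subseq (map (skip c) xs) r" unfolding r by (intro subseq_map)
    then have "subseq (map (skip c) xs) \<pi>" unfolding cr by (rule list_emb_Cons)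
    moreover have "order_iso (map (skip c) xs) [1,3,2,4]"
      using xs(2) by (simp add: order_iso_def skip_less_iff)
    ultimately show False using assms(8) unfolding avoids_def by blast
  qed
  then have ft: "f_tilde (standardize r) = \<alpha> \<oplus> [1] \<oplus> \<beta>"
    unfolding st using assms by (intro f_tilde_direct_sum)
  have p: "is_perm (\<alpha> \<oplus> [1] \<oplus> \<beta>)"
    using assms by (intro is_perm_direct_sum) (auto simp: is_perm_def)
  have l: "length r \<le> length (\<alpha> \<oplus> [1] \<oplus> \<beta>)" by (simp add: r)
  show f: "f_case1 \<pi> = hd \<pi> # map (skip (hd \<pi>)) (\<alpha> \<oplus> [1] \<oplus> \<beta>)"
    using f_case1_Cons[OF assms(1)[unfolded cr] ft p l] by (simp add: cr)
  have "c \<in> {1..Suc (length r)}" using assms(1) by (auto simp: is_perm_def cr)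
  then show "is_perm (f_case1 \<pi>)"
    unfolding f using p l by (intro is_perm_Cons_map_skip) (auto simp: cr)
qed

section \<open>Occurrences in the image\<close>

lemma order_iso_trans: "order_iso xs ys \<Longrightarrow> order_iso ys zs \<Longrightarrow> order_iso xs zs"
  by (auto simp: order_iso_def)

lemma order_iso_map:
  assumes "\<And>u v. u \<in> set xs \<Longrightarrow> v \<in> set xs \<Longrightarrow> g u < g v \<longleftrightarrow> u < (v :: nat)"
  shows "order_iso (map g xs) xs"
  using assms by (simp add: order_iso_def)

lemma list_dec_iff_nth:
  "list_dec xs \<longleftrightarrow> (\<exists>k. 0 < k \<and> k < length xs \<and> (\<forall>i < k. \<forall>j < length xs. k \<le> j \<longrightarrow> xs ! i < xs ! j))"
proof
  assume "list_dec xs"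
  then obtain ys zs where *: "xs = ys @ zs" "ys \<noteq> []" "zs \<noteq> []"
    "\<And>y z. y \<in> set ys \<Longrightarrow> z \<in> set zs \<Longrightarrow> y < z" unfolding list_dec_def by blast
  have "xs ! i < xs ! j" if "i < length ys" "j < length xs" "length ys \<le> j" for i j
  proof -
    have "xs ! i \<in> set ys" "xs ! j \<in> set zs" using that by (auto simp: *(1) nth_append)
    then show ?thesis by (rule *(4))
  qed
  then show "\<exists>k. 0 < k \<and> k < length xs \<and> (\<forall>i < k. \<forall>j < length xs. k \<le> j \<longrightarrow> xs ! i < xs ! j)"
    using * by (intro exI[of _ "length ys"]) auto
next
  assume "\<exists>k. 0 < k \<and> k < length xs \<and> (\<forall>i < k. \<forall>j < length xs. k \<le> j \<longrightarrow> xs ! i < xs ! j)"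
  then obtain k where k: "0 < k" "k < length xs"
    "\<And>i j. i < k \<Longrightarrow> j < length xs \<Longrightarrow> k \<le> j \<Longrightarrow> xs ! i < xs ! j" by blast
  have "y < z" if yz: "y \<in> set (take k xs)" "z \<in> set (drop k xs)" for y z
  proof -
    obtain i where "i < k" "xs ! i = y" using yz(1) by (auto simp: in_set_conv_nth)
    moreover obtain j where "j < length (drop k xs)" "drop k xs ! j = z"
      using yz(2) by (metis in_set_conv_nth)
    ultimately show ?thesis using k(3)[of i "k + j"] k(2) by auto
  qed
  then show "list_dec xs" unfolding list_dec_def using k
    by (intro exI[of _ "take k xs"] exI[of _ "drop k xs"]) auto
qed

text \<open>A cut at index \<open>k\<close> is a set of comparisons between fixed positions, all
  preserved by \<open>order_iso\<close>. Used contrapositively: occurrences of indecomposable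
  patterns are indecomposable.\<close>

lemma order_iso_list_dec:
  assumes "order_iso xs ys" "list_dec xs"
  shows "list_dec ys"
proof -
  have len: "length xs = length ys" using assms(1) by (simp add: order_iso_def)
  obtain k where k: "0 < k" "k < length xs"
    "\<And>i j. i < k \<Longrightarrow> j < length xs \<Longrightarrow> k \<le> j \<Longrightarrow> xs ! i < xs ! j"
    using assms(2) unfolding list_dec_iff_nth by blast
  have "ys ! i < ys ! j" if "i < k" "j < length ys" "k \<le> j" for i j
    using k(3)[of i j] that assms(1) k(2) len unfolding order_iso_def by auto
  then show ?thesis unfolding list_dec_iff_nth using k len by (intro exI[of _ k]) auto
qed

lemma list_dec_Cons_max:
  assumes "\<And>v. v \<in> set t \<Longrightarrow> v < a"
  shows "\<not> list_dec (a # t)"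
proof
  assume "list_dec (a # t)"
  then obtain ys zs where *: "a # t = ys @ zs" "ys \<noteq> []" "zs \<noteq> []"
    "\<And>y z. y \<in> set ys \<Longrightarrow> z \<in> set zs \<Longrightarrow> y < z" unfolding list_dec_def by blast
  then have "a \<in> set ys" "hd zs \<in> set zs" "hd zs \<in> set t" by (auto simp: Cons_eq_append_conv)
  then show False using *(4)[of a "hd zs"] assms[of "hd zs"] by simp
qed

section \<open>Patterns with an extremal first or last entry\<close>

lemma order_iso_Cons_iff:
  "order_iso (z # ys) (a # t) \<longleftrightarrow> order_iso ys t \<and>
     (\<forall>i < length t. (z < ys ! i \<longleftrightarrow> a < t ! i) \<and> (ys ! i < z \<longleftrightarrow> t ! i < a))"
  by (auto simp: order_iso_def all_less_numeral_Suc)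

lemma order_iso_Cons_min:
  assumes "\<And>v. v \<in> set t \<Longrightarrow> a < v"
  shows "order_iso (z # ys) (a # t) \<longleftrightarrow> order_iso ys t \<and> (\<forall>v \<in> set ys. z < v)"
proof -
  have "a < t ! i" "\<not> t ! i < a" if "i < length t" for i
    using assms[OF nth_mem[OF that]] by auto
  then show ?thesis unfolding order_iso_Cons_iff all_set_conv_all_nth
    by (fastforce simp: order_iso_def)
qed

lemma order_iso_Cons_max:
  assumes "\<And>v. v \<in> set t \<Longrightarrow> v < a"
  shows "order_iso (z # ys) (a # t) \<longleftrightarrow> order_iso ys t \<and> (\<forall>v \<in> set ys. v < z)"
proof -
  have "t ! i < a" "\<not> a < t ! i" if "i < length t" for i
    using assms[OF nth_mem[OF that]] by auto
  then show ?thesis unfolding order_iso_Cons_iff all_set_conv_all_nth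
    by (fastforce simp: order_iso_def)
qed

lemma order_iso_snoc_max:
  assumes "\<And>v. v \<in> set s \<Longrightarrow> v < q"
  shows "order_iso (ys @ [z]) (s @ [q]) \<longleftrightarrow> order_iso ys s \<and> (\<forall>v \<in> set ys. v < z)"
proof -
  have sq: "s ! i < q" "\<not> q < s ! i" if "i < length s" for i
    using assms[OF nth_mem[OF that]] by auto
  show ?thesis
  proof
    assume L: "order_iso (ys @ [z]) (s @ [q])"
    then have len: "length ys = length s" by (simp add: order_iso_def)
    have L': "(ys @ [z]) ! i < (ys @ [z]) ! j \<longleftrightarrow> (s @ [q]) ! i < (s @ [q]) ! j"
      if "i < Suc (length s)" "j < Suc (length s)" for i j
      using L that len by (auto simp: order_iso_def)
    have "ys ! i < ys ! j \<longleftrightarrow> s ! i < s ! j" if "i < length s" "j < length s" for i j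
      using L'[of i j] that len by (simp add: nth_append)
    moreover have "ys ! i < z" if "i < length s" for i
      using L'[of i "length s"] that len sq by (simp add: nth_append)
    ultimately show "order_iso ys s \<and> (\<forall>v \<in> set ys. v < z)"
      using len by (auto simp: order_iso_def in_set_conv_nth)
  next
    assume "order_iso ys s \<and> (\<forall>v \<in> set ys. v < z)"
    moreover from this have "ys ! i < z" "\<not> z < ys ! i" if "i < length s" for i
      using that nth_mem[of i ys] by (fastforce simp: order_iso_def)+
    ultimately show "order_iso (ys @ [z]) (s @ [q])"
      using sq by (auto simp: order_iso_def nth_append less_Suc_eq)
  qed
qed

section \<open>Occurrences at a cut\<close>

lemma subseq_append_disjoint:
  assumes "subseq ys (A @ C)" "set ys \<inter> set A = {}"
  shows "subseq ys C"
proof -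
  obtain u v where uv: "ys = u @ v" "subseq u A" "subseq v C"
    using assms(1) by (auto simp: subseq_append_iff)
  have "set u \<subseteq> set A" using uv(2) by (rule subseq_set)
  then have "u = []" using assms(2) uv(1) by (cases u) auto
  then show ?thesis using uv by simp
qed

lemma subseq_append_not_list_dec:
  assumes "subseq ys (A @ C)" "\<not> list_dec ys" "\<And>a c. a \<in> set A \<Longrightarrow> c \<in> set C \<Longrightarrow> a < c"
  shows "subseq ys A \<or> subseq ys C"
proof -
  obtain u v where uv: "ys = u @ v" "subseq u A" "subseq v C"
    using assms(1) by (auto simp: subseq_append_iff)
  have "\<And>y z. y \<in> set u \<Longrightarrow> z \<in> set v \<Longrightarrow> y < z"
    using assms(3) subseq_set[OF uv(2)] subseq_set[OF uv(3)] by blast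
  then have "u = [] \<or> v = []" using assms(2) uv(1) unfolding list_dec_def by blast
  then show ?thesis using uv by auto
qed

text \<open>Cutting before and behind \<open>x\<close> leaves \<open>A\<close>, the single entry
  \<open>x\<close>, or \<open>B\<close> as the place of \<open>ys\<close>; the length bound excludes
  \<open>x\<close>.\<close>

lemma subseq_cut_not_list_dec:
  assumes "subseq ys (A @ x # B)" "\<not> list_dec ys" "2 \<le> length ys"
    "\<And>a. a \<in> set A \<Longrightarrow> a < x" "\<And>b. b \<in> set B \<Longrightarrow> x < b"
  shows "subseq ys A \<or> subseq ys B"
proof -
  have lt: "a < b" if "a \<in> set A" "b \<in> set (x # B)" for a b
    using that assms(4)[of a] assms(5)[of b] by auto
  consider "subseq ys A" | "subseq ys (x # B)"
    using subseq_append_not_list_dec[OF assms(1,2) lt] by blast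
  then show ?thesis
  proof cases
    case 2
    then have "subseq ys ([x] @ B)" by simp
    then have "subseq ys [x] \<or> subseq ys B"
      using assms(2,5) by (intro subseq_append_not_list_dec) auto
    moreover have "\<not> subseq ys [x]"
      using assms(3) by (intro not_subseq_length) simp
    ultimately show ?thesis by blast
  qed simp
qed

text \<open>\<open>x\<close> models the inserted entry: the property says that no occurrence of
  \<open>p\<close> depends on it when both sides are nonempty. It serves \<open>f_tilde\<close>
  directly and \<open>f_case1\<close> for the occurrences that do not start at the first
  entry.\<close>

definition middle_free :: "nat list \<Rightarrow> bool" where
  "middle_free p \<longleftrightarrow> (\<forall>A x B ys. A \<noteq> [] \<longrightarrow> B \<noteq> [] \<longrightarrow> (\<forall>a \<in> set A. a < x) \<longrightarrow>
     (\<forall>b \<in> set B. x < b) \<longrightarrow> subseq ys (A @ x # B) \<longrightarrow> order_iso ys p \<longrightarrow>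
     (\<exists>zs. subseq zs (A @ B) \<and> order_iso zs p))"

lemma middle_freeD:
  assumes "middle_free p" "A \<noteq> []" "B \<noteq> []" "\<And>a. a \<in> set A \<Longrightarrow> a < x" "\<And>b. b \<in> set B \<Longrightarrow> x < b"
    "subseq ys (A @ x # B)" "order_iso ys p"
  obtains zs where "subseq zs (A @ B)" "order_iso zs p"
  using assms unfolding middle_free_def by metis

lemma middle_free_not_list_dec:
  assumes "\<not> list_dec p" "2 \<le> length p"
  shows "middle_free p"
  unfolding middle_free_def
proof (intro allI impI)
  fix A B :: "nat list" and x ys
  assume *: "\<forall>a\<in>set A. a < x" "\<forall>b\<in>set B. x < b" "subseq ys (A @ x # B)" "order_iso ys p"
  have "\<not> list_dec ys" "2 \<le> length ys" using assms *(4) order_iso_list_dec by (auto simp: order_iso_def)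
  then have "subseq ys A \<or> subseq ys B" using *(1-3) by (intro subseq_cut_not_list_dec) auto
  then show "\<exists>zs. subseq zs (A @ B) \<and> order_iso zs p"
    using *(4) subseq_drop_many subseq_rev_drop_many by blast
qed

lemma subseq_hd_append: "A \<noteq> [] \<Longrightarrow> subseq ys B \<Longrightarrow> subseq (hd A # ys) (A @ B)"
  by (cases A) (auto intro: subseq_drop_many)

lemma subseq_append_hd: "B \<noteq> [] \<Longrightarrow> subseq ys A \<Longrightarrow> subseq (ys @ [hd B]) (A @ B)"
  by (intro subseq_append_both) (simp_all add: subseq_singleton_left)

text \<open>The indecomposable rest cannot cross the cut, so \<open>x\<close> can only act as the
  leading minimum. Any entry of \<open>A\<close> can take over: it precedes \<open>B\<close> and is
  smaller.\<close>

lemma middle_free_Cons_min: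
  assumes "\<not> list_dec t" "2 \<le> length t" "\<And>v. v \<in> set t \<Longrightarrow> a < v"
  shows "middle_free (a # t)"
  unfolding middle_free_def
proof (intro allI impI)
  fix A B :: "nat list" and x xs
  assume *: "A \<noteq> []" "\<forall>a\<in>set A. a < x" "\<forall>b\<in>set B. x < b" "subseq xs (A @ x # B)"
    "order_iso xs (a # t)"
  obtain z ys where xs: "xs = z # ys" using *(5) by (cases xs) (auto simp: order_iso_def)
  have oi: "order_iso ys t" "\<And>v. v \<in> set ys \<Longrightarrow> z < v"
    using *(5) order_iso_Cons_min[of t a z ys] assms(3) by (auto simp: xs)
  have ys: "\<not> list_dec ys" "2 \<le> length ys" using assms oi order_iso_list_dec by (auto simp: order_iso_def)
  obtain u v where uv: "xs = u @ v" "subseq u A" "subseq v (x # B)"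
    using *(4) by (auto simp: subseq_append_iff)
  show "\<exists>zs. subseq zs (A @ B) \<and> order_iso zs (a # t)"
  proof (cases u)
    case Nil
    then have xs': "subseq xs (x # B)" using uv by simp
    show ?thesis
    proof (cases "z = x")
      case True
      then have B: "subseq ys B" using xs' xs by simp
      then have "\<forall>v \<in> set ys. hd A < v" using subseq_set[OF B] *(1-3) hd_in_set[of A] by fastforce
      then have "order_iso (hd A # ys) (a # t)" using oi(1) assms(3) by (subst order_iso_Cons_min) auto
      then show ?thesis using subseq_hd_append[OF *(1) B] by blast
    next
      case False
      then have "subseq xs B" using xs' xs by simp
      then show ?thesis using *(5) subseq_drop_many by blast
    qed
  next
    case (Cons z' u')
    then have u: "u = z # u'" "ys = u' @ v" using uv(1) xs by auto
    have "subseq u' A" using uv(2) u(1) by (metis subseq_Cons')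
    then have "subseq ys (A @ x # B)" unfolding u(2) using uv(3) by (rule subseq_append_both)
    have vB: "subseq v B"
    \<comment> \<open>If some of \<open>ys\<close> already lies in \<open>A\<close>,
      indecomposability leaves nothing for \<open>x # B\<close>. Otherwise all of \<open>ys\<close>
      lies in \<open>x # B\<close>, and with at least two entries it cannot use
      \<open>x\<close>.\<close>
    proof (cases u')
      case Nil
      then have "subseq ys ([x] @ B)" using uv(3) u by simp
      then have "subseq ys [x] \<or> subseq ys B"
        using ys(1) *(3) by (intro subseq_append_not_list_dec) auto
      moreover have "\<not> subseq ys [x]" using ys(2) by (intro not_subseq_length) simp
      ultimately show ?thesis using u Nil by simp
    next
      case (Cons w u'')
      have "y < z" if "y \<in> set u'" "z \<in> set v" for y z
      proof -
        have "y < x" using that \<open>subseq u' A\<close> subseq_set *(2) by blast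
        moreover have "z = x \<or> z \<in> set B" using that(2) subseq_set[OF uv(3)] by auto
        then have "x \<le> z" using *(3) by auto
        ultimately show ?thesis by simp
      qed
      then have "v = []" using ys(1) u(2) Cons unfolding list_dec_def by blast
      then show ?thesis by simp
    qed
    then have "subseq xs (A @ B)" unfolding uv(1) using uv(2) by (intro subseq_append_both)
    then show ?thesis using *(5) by blast
  qed
qed

text \<open>If the indecomposable part lies in \<open>A\<close>, then \<open>hd B\<close> can serve
  as the final maximum whether or not \<open>x\<close> did. If it lies in \<open>B\<close>, the
  final maximum is above \<open>x\<close> and the whole occurrence lies in \<open>B\<close>.\<close>

lemma middle_free_snoc_max:
  assumes "\<not> list_dec s" "2 \<le> length s" "\<And>v. v \<in> set s \<Longrightarrow> v < q"
  shows "middle_free (s @ [q])"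
  unfolding middle_free_def
proof (intro allI impI)
  fix A B :: "nat list" and x xs
  assume *: "B \<noteq> []" "\<forall>a\<in>set A. a < x" "\<forall>b\<in>set B. x < b" "subseq xs (A @ x # B)"
    "order_iso xs (s @ [q])"
  obtain z ys where xs: "xs = ys @ [z]" using *(5) by (cases xs rule: rev_cases) (auto simp: order_iso_def)
  have oi: "order_iso ys s" "\<And>v. v \<in> set ys \<Longrightarrow> v < z"
    using *(5) order_iso_snoc_max[of s q ys z] assms(3) by (auto simp: xs)
  have ys: "\<not> list_dec ys" "2 \<le> length ys" using assms oi order_iso_list_dec by (auto simp: order_iso_def)
  have "subseq ys (A @ x # B)" using *(4) unfolding xs by (metis subseq_order.trans subseq_rev_drop_many subseq_order.refl)
  then have "subseq ys A \<or> subseq ys B" using ys *(2,3) by (intro subseq_cut_not_list_dec) auto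
  then show "\<exists>zs. subseq zs (A @ B) \<and> order_iso zs (s @ [q])"
  proof
    assume A: "subseq ys A"
    then have "\<forall>v \<in> set ys. v < hd B" using subseq_set[OF A] *(1-3) hd_in_set[of B] by fastforce
    then have "order_iso (ys @ [hd B]) (s @ [q])" using oi(1) assms(3) by (subst order_iso_snoc_max) auto
    then show ?thesis using subseq_append_hd[OF *(1) A] by blast
  next
    assume B: "subseq ys B"
    have "hd ys \<in> set ys" using ys(2) by (cases ys) auto
    then have "x < z" using B subseq_set *(3) oi(2) by (metis less_trans subsetD)
    have "set xs \<inter> set (A @ [x]) = {}"
    proof -
      have "x < v" if "v \<in> set xs" for v
        using that \<open>x < z\<close> subseq_set[OF B] *(3) by (auto simp: xs)
      then show ?thesis using *(2) by fastforce
    qed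
    moreover have "subseq xs ((A @ [x]) @ B)" using *(4) by simp
    ultimately have "subseq xs B" by (rule subseq_append_disjoint[rotated])
    then show ?thesis using *(5) subseq_drop_many by blast
  qed
qed

text \<open>The first entry keeps its value while the new entry \<open>x\<close> pushes the entries of \<open>B\<close> up by one.
  Hence \<open>Suc c\<close> is the only entry of the image \<open>F\<close> whose position relative to \<open>c\<close> differs
  from the one in \<open>\<pi>\<close>; \<open>G\<close> is the relabelling from \<open>F\<close> back to \<open>\<pi>\<close>.\<close>

locale insertion =
  fixes c x :: nat and A B :: "nat list" and G :: "nat \<Rightarrow> nat" and \<pi> F :: "nat list"
  assumes pi: "\<pi> = c # map G (A @ B)" and F: "F = c # A @ x # B"
    and A_ne: "A \<noteq> []" and B_ne: "B \<noteq> []"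
    and A_less: "a \<in> set A \<Longrightarrow> a < x" and less_B: "b \<in> set B \<Longrightarrow> x < b"
    and x_less: "x < c" and c_notin: "c \<notin> set B"
    and G_mono: "u \<in> set (A @ B) \<Longrightarrow> v \<in> set (A @ B) \<Longrightarrow> G u < G v \<longleftrightarrow> u < v"
    and G_c: "u \<in> set (A @ B) \<Longrightarrow> u \<noteq> Suc c \<Longrightarrow> (G u < c \<longleftrightarrow> u < c) \<and> (c < G u \<longleftrightarrow> c < u)"
    and Suc_Suc_c: "c < length \<pi> \<Longrightarrow> Suc (Suc c) \<in> set B"
    and avoids_pi: "avoids \<pi> [1,3,2,4]"
begin

lemma contains_without:
  assumes "subseq ys (A @ B)" "order_iso ys p"
  shows "\<not> avoids \<pi> p"
proof -
  have "subseq (map G ys) \<pi>" unfolding pi using subseq_map[OF assms(1)] by (rule list_emb_Cons)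
  moreover have "order_iso (map G ys) ys"
    using subseq_set[OF assms(1)] by (intro order_iso_map G_mono) auto
  then have "order_iso (map G ys) p" using assms(2) order_iso_trans by blast
  ultimately show ?thesis unfolding avoids_def by blast
qed

lemma contains_with:
  assumes "subseq ys (A @ B)" "Suc c \<notin> set ys" "order_iso (c # ys) p"
  shows "\<not> avoids \<pi> p"
proof -
  have sub: "set ys \<subseteq> set (A @ B)" using assms(1) by (rule subseq_set)
  have c: "c \<notin> set ys" using sub A_less x_less c_notin by fastforce
  \<comment> \<open>\<open>G\<close> is specified only on the entries of \<open>A\<close> and
    \<open>B\<close>; the first entry has to stay where it is.\<close>
  define g where "g = G(c := c)"
  have g: "g v = G v" if "v \<in> set ys" for v using that c by (auto simp: g_def)
  have "map g ys = map G ys" using g by (intro map_cong) auto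
  then have "map g (c # ys) = c # map G ys" by (simp add: g_def)
  moreover have "subseq (c # map G ys) \<pi>" unfolding pi using subseq_map[OF assms(1)] by simp
  ultimately have 1: "subseq (map g (c # ys)) \<pi>" by (simp only:)
  have "g u < g v \<longleftrightarrow> u < v" if "u \<in> set (c # ys)" "v \<in> set (c # ys)" for u v
  proof -
    have gc: "g c = c" by (simp add: g_def)
    have w: "w \<in> set (A @ B) \<and> w \<noteq> Suc c" if "w \<in> set ys" for w using that sub assms(2) by auto
    show ?thesis
    proof (cases "u = c"; cases "v = c")
      assume "u \<noteq> c" "v \<noteq> c"
      then show ?thesis using that g w G_mono by simp
    next
      assume "u = c" "v \<noteq> c"
      then show ?thesis using that g w gc G_c[of v] by simp
    next
      assume "u \<noteq> c" "v = c"
      then show ?thesis using that g w gc G_c[of u] by simp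
    qed simp
  qed
  then have "order_iso (map g (c # ys)) (c # ys)" by (rule order_iso_map)
  then have "order_iso (map g (c # ys)) p" using assms(3) order_iso_trans by blast
  with 1 show ?thesis unfolding avoids_def by blast
qed

text \<open>Any entry of \<open>A\<close> precedes and is smaller than all of \<open>B\<close>, so
  it would complete a 1324 that avoids both \<open>c\<close> and \<open>x\<close> and hence pulls
  back to \<pi>.\<close>

lemma no_213_in_B:
  assumes "subseq [u,v,w] B" "v < u" "u < w"
  shows False
proof -
  have "v \<in> set B" using subseq_set[OF assms(1)] by auto
  moreover have "hd A \<in> set A" using A_ne by simp
  ultimately have "hd A < v" using A_less less_B by (meson less_trans)
  then have "order_iso [hd A,u,v,w] [1,3,2,4]" using assms by (simp only: order_iso_1324_iff)
  then show False using contains_without[OF subseq_hd_append[OF A_ne assms(1)]] avoids_pi by blast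
qed

lemma subseq_B:
  assumes "subseq ys (A @ x # B)" "\<And>v. v \<in> set ys \<Longrightarrow> x < v"
  shows "subseq ys B"
proof -
  have "subseq ys ((A @ [x]) @ B)" using assms(1) by simp
  moreover have "set ys \<inter> set (A @ [x]) = {}" using assms(2) A_less by fastforce
  ultimately show ?thesis by (rule subseq_append_disjoint)
qed

text \<open>Occurrences that do not start at \<open>c\<close> are settled by
  \<open>middle_free\<close>; each family of patterns then only has to treat those led by
  \<open>c\<close>.\<close>

lemma avoids_F:
  assumes "middle_free p" "avoids \<pi> p"
    and lead: "\<And>ys. subseq ys (A @ x # B) \<Longrightarrow> order_iso (c # ys) p \<Longrightarrow> \<not> avoids \<pi> p"
  shows "avoids F p"
  unfolding avoids_def
proof safe
  fix xs assume xs: "subseq xs F" "order_iso xs p"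
  show False
  proof (cases "\<exists>ys. xs = c # ys")
    case True
    then show ?thesis using lead xs assms(2) by (auto simp: F)
  next
    case False
    then have "subseq xs (A @ x # B)" using xs(1) unfolding F by (cases xs) auto
    from middle_freeD[OF assms(1) A_ne B_ne A_less less_B this xs(2)] obtain zs
      where "subseq zs (A @ B)" "order_iso zs p" by blast
    then show ?thesis using contains_without assms(2) by blast
  qed
qed

text \<open>All other entries of an occurrence led by \<open>c\<close> are below \<open>c\<close>,
  hence differ from \<open>Suc c\<close>. If there are at least two, indecomposability also keeps
  them off \<open>x\<close>, and the occurrence pulls back unchanged.\<close>

lemma avoids_F_Cons_max:
  assumes "\<not> list_dec t" "t \<noteq> []" "\<And>v. v \<in> set t \<Longrightarrow> v < a" "avoids \<pi> (a # t)"
  shows "avoids F (a # t)"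
proof (rule avoids_F)
  have "2 \<le> length (a # t)" using assms(2) by (cases t) auto
  then show "middle_free (a # t)" using assms(3) by (intro middle_free_not_list_dec list_dec_Cons_max)
  show "avoids \<pi> (a # t)" by fact
  fix ys assume *: "subseq ys (A @ x # B)" "order_iso (c # ys) (a # t)"
  have oi: "order_iso ys t" "\<And>v. v \<in> set ys \<Longrightarrow> v < c"
    using *(2) order_iso_Cons_max[of t a c ys] assms(3) by auto
  have ys: "\<not> list_dec ys" "length ys = length t" using assms oi order_iso_list_dec by (auto simp: order_iso_def)
  show "\<not> avoids \<pi> (a # t)"
  proof (cases "2 \<le> length ys")
    case True
    then have "subseq ys A \<or> subseq ys B" using *(1) ys A_less less_B by (intro subseq_cut_not_list_dec) auto
    then have "subseq ys (A @ B)" using subseq_drop_many subseq_rev_drop_many by blast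
    moreover have "Suc c \<notin> set ys" using oi(2) by fastforce
    ultimately show ?thesis using *(2) by (rule contains_with)
  next
    case False
    \<comment> \<open>A single remaining entry may be \<open>x\<close> itself; \<open>hd A\<close>
      is also below \<open>c\<close> and stands in for it.\<close>
    then have "length t = 1" using ys(2) assms(2) by (cases t) (auto simp: not_le)
    then have "order_iso [hd A] t" by (simp add: order_iso_def)
    moreover have hA: "hd A \<in> set A" using A_ne by simp
    then have lt: "hd A < c" using A_less x_less less_trans by blast
    ultimately have "order_iso (c # [hd A]) (a # t)" using assms(3) by (subst order_iso_Cons_max) auto
    moreover have "subseq [hd A] (A @ B)" using hA by (simp add: subseq_singleton_left)
    ultimately show ?thesis using lt by (intro contains_with) auto
  qed
qed

text \<open>Everything above \<open>c\<close> is above \<open>x\<close> and so lies in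
  \<open>B\<close>. An entry of \<open>A\<close> replaces \<open>c\<close> as the leading minimum,
  which also makes a use of \<open>Suc c\<close> harmless.\<close>

lemma avoids_F_Cons_min:
  assumes "\<not> list_dec t" "2 \<le> length t" "\<And>v. v \<in> set t \<Longrightarrow> a < v" "avoids \<pi> (a # t)"
  shows "avoids F (a # t)"
proof (rule avoids_F)
  show "middle_free (a # t)" using assms(1-3) by (rule middle_free_Cons_min)
  show "avoids \<pi> (a # t)" by fact
  fix ys assume *: "subseq ys (A @ x # B)" "order_iso (c # ys) (a # t)"
  have oi: "order_iso ys t" "\<And>v. v \<in> set ys \<Longrightarrow> c < v"
    using *(2) order_iso_Cons_min[of t a c ys] assms(3) by auto
  have B: "subseq ys B" using *(1) oi(2) x_less by (intro subseq_B) (auto intro: less_trans)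
  moreover have "hd A < c" using A_less[of "hd A"] A_ne x_less by auto
  ultimately have "order_iso (hd A # ys) (a # t)"
    using oi assms(3) by (subst order_iso_Cons_min) (auto intro: less_trans)
  then show "\<not> avoids \<pi> (a # t)" using contains_without[OF subseq_hd_append[OF A_ne B]] by blast
qed

text \<open>The second entry of an occurrence led by \<open>c\<close> exceeds \<open>c\<close>, so
  from there on it runs inside \<open>B\<close>. Its entries for the indices 1, \<open>j\<close>,
  \<open>k\<close> would be a 213 there, so no such occurrence exists.\<close>

lemma avoids_F_ascent:
  assumes "middle_free p" "p ! 0 < p ! 1" "1 < j" "j < k" "k < length p" "p ! j < p ! 1" "p ! 1 < p ! k"
    "avoids \<pi> p"
  shows "avoids F p"
proof (rule avoids_F)
  show "middle_free p" "avoids \<pi> p" by fact+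
  fix ys assume *: "subseq ys (A @ x # B)" "order_iso (c # ys) p"
  have oi: "(c # ys) ! i < (c # ys) ! i' \<longleftrightarrow> p ! i < p ! i'"
    if "i < length p" "i' < length p" for i i' using *(2) that by (auto simp: order_iso_def)
  have len: "Suc (length ys) = length p" using *(2) by (simp add: order_iso_def)
  obtain j' k' where jk: "j = Suc j'" "k = Suc k'" using assms by (cases j; cases k) auto
  have lt: "c < ys ! 0" "ys ! j' < ys ! 0" "ys ! 0 < ys ! k'"
    using oi[of 0 1] oi[of j 1] oi[of 1 k] assms(2-7) len by (fastforce simp: jk)+
  have ysB: "subseq ys B"
  proof -
    obtain u v where uv: "ys = u @ v" "subseq u A" "subseq v (x # B)"
      using *(1) by (auto simp: subseq_append_iff)
    have "u = []"
    proof (cases u)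
      case (Cons y u')
      then have "y \<in> set A" using subseq_set[OF uv(2)] by auto
      then show ?thesis using lt(1) uv(1) Cons A_less[of y] x_less by simp
    qed
    then have "subseq ys (x # B)" using uv by simp
    moreover obtain y ys' where y: "ys = y # ys'" using len assms by (cases ys) auto
    moreover have "y \<noteq> x" using lt(1) y x_less by auto
    ultimately show ?thesis by simp
  qed
  have "subseq [ys ! 0, ys ! j', ys ! k'] ys" unfolding subseq_iff_index
    using assms(3-5) jk len
    by (intro exI[of _ "\<lambda>i. [0, j', k'] ! i"]) (auto simp: less_Suc_eq)
  then have "subseq [ys ! 0, ys ! j', ys ! k'] B" using ysB subseq_order.trans by blast
  then show "\<not> avoids \<pi> p" using no_213_in_B lt by blast
qed

text \<open>The last entry may be \<open>Suc c\<close>, which corresponds to an entry below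
  \<open>c\<close> in \<pi>. The middle part cannot lie in \<open>B\<close>, where its descent and
  the last entry would form a 213; so it lies in \<open>A\<close>, and any entry of \<open>B\<close>
  above \<open>c\<close> may come last. The bound on \<open>c\<close> supplies
  \<open>Suc (Suc c)\<close>.\<close>

lemma avoids_F_Cons_snoc:
  assumes "\<not> list_dec t" "i < j" "j < length t" "t ! j < t ! i"
    "\<And>v. v \<in> set t \<Longrightarrow> v < a" "a < q" "c < length \<pi>" "avoids \<pi> (a # t @ [q])"
  shows "avoids F (a # t @ [q])"
proof (rule avoids_F)
  have max: "v < q" if "v \<in> set (a # t)" for v using that assms(5)[of v] assms(6) by auto
  have "2 \<le> length (a # t)" using assms(2,3) by simp
  then have "middle_free ((a # t) @ [q])"
    using max assms(5) by (intro middle_free_snoc_max list_dec_Cons_max)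
  then show "middle_free (a # t @ [q])" by simp
  show "avoids \<pi> (a # t @ [q])" by fact
  fix xs assume *: "subseq xs (A @ x # B)" "order_iso (c # xs) (a # t @ [q])"
  have "length xs = Suc (length t)" using *(2) by (simp add: order_iso_def)
  then obtain ys z where xs: "xs = ys @ [z]" by (cases xs rule: rev_cases) auto
  have "order_iso ((c # ys) @ [z]) ((a # t) @ [q])" using *(2) by (simp add: xs)
  then have "order_iso (c # ys) (a # t)" and z: "c < z" "\<And>v. v \<in> set ys \<Longrightarrow> v < z"
    using order_iso_snoc_max[of "a # t" q "c # ys" z] max by auto
  then have oi: "order_iso ys t" "\<And>v. v \<in> set ys \<Longrightarrow> v < c"
    using order_iso_Cons_max[of t a c ys] assms(5) by auto
  have ys: "\<not> list_dec ys" "length ys = length t" using assms oi order_iso_list_dec by (auto simp: order_iso_def)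
  have "subseq ys xs" unfolding xs by (simp add: subseq_rev_drop_many)
  then have "subseq ys (A @ x # B)" using *(1) subseq_order.trans by blast
  then have "subseq ys A \<or> subseq ys B"
    using ys assms(2,3) A_less less_B by (intro subseq_cut_not_list_dec) auto
  then have A: "subseq ys A"
  proof
    assume B: "subseq ys B"
    have "x < v" if "v \<in> set xs" for v
      using that subseq_set[OF B] less_B x_less z(1) by (auto simp: xs)
    then have "subseq xs B" using *(1) by (intro subseq_B)
    moreover have "subseq [ys ! i, ys ! j, z] xs" unfolding subseq_iff_index
      using assms(2,3) ys(2)
      by (intro exI[of _ "\<lambda>k. [i, j, length t] ! k"]) (auto simp: less_Suc_eq xs nth_append)
    ultimately have "subseq [ys ! i, ys ! j, z] B" using subseq_order.trans by blast
    moreover have "ys ! j < ys ! i" using oi(1) assms(2-4) by (auto simp: order_iso_def)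
    moreover have "ys ! i < z" using z(2) ys(2) assms(2,3) by simp
    ultimately show ?thesis using no_213_in_B by blast
  qed
  have "subseq (ys @ [Suc (Suc c)]) (A @ B)"
    using A Suc_Suc_c[OF assms(7)] by (intro subseq_append_both) (simp_all add: subseq_singleton_left)
  moreover have "Suc c \<notin> set (ys @ [Suc (Suc c)])" using oi(2) by fastforce
  moreover have "order_iso ((c # ys) @ [Suc (Suc c)]) ((a # t) @ [q])"
    using \<open>order_iso (c # ys) (a # t)\<close> oi(2) max
    by (subst order_iso_snoc_max) (auto intro: less_trans[of _ c])
  then have "order_iso (c # ys @ [Suc (Suc c)]) (a # t @ [q])" by simp
  ultimately show "\<not> avoids \<pi> (a # t @ [q])" by (rule contains_with)
qed

end

lemma f_case1_insertion:
  assumes "is_perm \<pi>" "avoids \<pi> [1,3,2,4]" "\<not> decomposable \<pi>" "decomposable (\<pi> \<setminus> hd \<pi>)"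
  shows "\<exists>x A B G. insertion (hd \<pi>) x A B G \<pi> (f_case1 \<pi>)"
proof -
  obtain \<alpha> \<beta> where ab: "is_perm \<alpha>" "is_perm \<beta>" "\<alpha> \<noteq> []" "\<beta> \<noteq> []" "\<pi> \<setminus> hd \<pi> = \<alpha> \<oplus> \<beta>"
    using assms(4) unfolding decomposable_def by blast
  have ne: "\<pi> \<noteq> []"
  proof
    assume "\<pi> = []"
    then have "\<pi> \<setminus> hd \<pi> = []" by (simp add: delete_value_def standardize_def)
    then show False using ab by (simp add: direct_sum_def)
  qed
  note fc = f_case1_direct_sum[OF assms(1) ne ab(5,1-4) assms(2)]
  define c where "c = hd \<pi>"
  define a where "a = length \<alpha>"
  define n where "n = length \<beta>"
  define B where "B = map (\<lambda>v. skip c (v + Suc a)) \<beta>"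
  \<comment> \<open>Raising \<beta> by one pushes the entry \<open>c - 1\<close> of \<pi> onto the
    occupied value \<open>c\<close> and hence on to \<open>Suc c\<close>; it alone rises by
    two.\<close>
  define G where "G v = (if v \<le> a then v else if v = Suc c then c - 1 else v - 1)" for v
  have pi: "\<pi> = c # map (skip c) (\<alpha> @ map (\<lambda>v. v + a) \<beta>)"
    using fc(1) by (simp add: c_def a_def direct_sum_def)
  have len: "length \<pi> = Suc (a + n)" using arg_cong[OF pi, of length] by (simp add: a_def n_def)
  have s\<alpha>: "set \<alpha> = {1..a}" and s\<beta>: "set \<beta> = {1..n}" using ab by (auto simp: is_perm_def a_def n_def)
  \<comment> \<open>Otherwise \<open>c\<close> and \<alpha> together would occupy the values up to
    \<open>Suc a\<close> and \<pi> would split behind them.\<close>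
  have c: "Suc (Suc a) \<le> c"
  proof (rule ccontr)
    assume nc: "\<not> Suc (Suc a) \<le> c"
    have "y < z" if yz: "y \<in> set (c # map (skip c) \<alpha>)" "z \<in> set (map (\<lambda>v. skip c (v + a)) \<beta>)" for y z
    proof -
      have "y \<le> Suc a" using yz(1) nc s\<alpha> by (auto simp: skip_def)
      moreover have "Suc a < z" using yz(2) nc s\<beta> by (auto simp: skip_def)
      ultimately show ?thesis by simp
    qed
    moreover have "\<pi> = (c # map (skip c) \<alpha>) @ map (\<lambda>v. skip c (v + a)) \<beta>" by (simp add: pi comp_def)
    ultimately have "list_dec \<pi>" unfolding list_dec_def using ab(4) by blast
    then show False using assms by (simp add: decomposable_iff_list_dec)
  qed
  have "c \<in> set \<pi>" using ne by (simp add: c_def)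
  then have c_le: "c \<le> Suc (a + n)" using assms(1) len by (simp add: is_perm_def)
  have sk\<alpha>: "map (skip c) \<alpha> = \<alpha>" using s\<alpha> c by (intro map_idI) (auto simp: skip_def)
  have F: "f_case1 \<pi> = c # \<alpha> @ Suc a # B"
    unfolding fc(2) using c sk\<alpha>
    by (simp add: c_def[symmetric] direct_sum_def a_def[symmetric] B_def skip_def comp_def add_ac)
  have "set B = skip c ` set (map (\<lambda>v. v + Suc a) \<beta>)" by (simp add: B_def image_image)
  also have "\<dots> = skip c ` {Suc (Suc a)..Suc (a + n)}"
    unfolding set_shift_perm[OF ab(2)] by (simp add: n_def)
  also have "\<dots> = {Suc (Suc a)..Suc (Suc (a + n))} - {c}"
  proof
    show "skip c ` {Suc (Suc a)..Suc (a + n)} \<subseteq> {Suc (Suc a)..Suc (Suc (a + n))} - {c}"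
      by (auto simp: skip_def)
    show "{Suc (Suc a)..Suc (Suc (a + n))} - {c} \<subseteq> skip c ` {Suc (Suc a)..Suc (a + n)}"
    proof
      fix v assume v: "v \<in> {Suc (Suc a)..Suc (Suc (a + n))} - {c}"
      show "v \<in> skip c ` {Suc (Suc a)..Suc (a + n)}"
        by (rule image_eqI[of _ _ "if v < c then v else v - 1"])
          (use v c c_le in \<open>auto simp: skip_def\<close>)
    qed
  qed
  finally have sB: "set B = {Suc (Suc a)..Suc (Suc (a + n))} - {c}" .
  have G_skip: "G (skip c (v + Suc a)) = skip c (v + a)" if "v \<in> set \<beta>" for v
    using that c s\<beta> by (auto simp: G_def skip_def)
  have "map G \<alpha> = \<alpha>" using s\<alpha> by (intro map_idI) (auto simp: G_def)
  then have pi': "\<pi> = c # map G (\<alpha> @ B)"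
    using G_skip sk\<alpha> by (simp add: pi B_def comp_def)
  have "insertion c (Suc a) \<alpha> B G \<pi> (f_case1 \<pi>)"
  proof
    show "\<pi> = c # map G (\<alpha> @ B)" "f_case1 \<pi> = c # \<alpha> @ Suc a # B" "\<alpha> \<noteq> []" "B \<noteq> []"
      "avoids \<pi> [1,3,2,4]"
      using pi' F ab assms(2) by (auto simp: B_def)
    show "a' < Suc a" if "a' \<in> set \<alpha>" for a' using that s\<alpha> by auto
    show "Suc a < b" if "b \<in> set B" for b using that sB by auto
    show "Suc a < c" using c by simp
    show "c \<notin> set B" using sB by simp
    have mem: "v \<le> a \<or> (Suc a < v \<and> v \<noteq> c)" if "v \<in> set (\<alpha> @ B)" for v
      using that s\<alpha> sB by auto
    show "G u < G v \<longleftrightarrow> u < v" if "u \<in> set (\<alpha> @ B)" "v \<in> set (\<alpha> @ B)" for u v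
      using mem[OF that(1)] mem[OF that(2)] c by (auto simp: G_def)
    show "(G u < c \<longleftrightarrow> u < c) \<and> (c < G u \<longleftrightarrow> c < u)" if "u \<in> set (\<alpha> @ B)" "u \<noteq> Suc c" for u
      using mem[OF that(1)] that(2) c by (auto simp: G_def)
    show "Suc (Suc c) \<in> set B" if "c < length \<pi>" using that c unfolding sB len by auto
  qed
  then show ?thesis unfolding c_def by blast
qed

lemma f_tilde_avoids:
  assumes "is_perm \<pi>" "decomposable \<pi>" "avoids \<pi> [1,3,2,4]" "avoids \<pi> p" "middle_free p"
  shows "avoids (f_tilde \<pi>) p"
proof -
  obtain \<alpha> \<beta> where ab: "is_perm \<alpha>" "is_perm \<beta>" "\<alpha> \<noteq> []" "\<beta> \<noteq> []" "\<pi> = \<alpha> \<oplus> \<beta>"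
    using assms(2) unfolding decomposable_def by blast
  define a where "a = length \<alpha>"
  define B where "B = map (\<lambda>v. v + Suc a) \<beta>"
  \<comment> \<open>Closes the gap at the value \<open>Suc a\<close> of the inserted entry.\<close>
  define G where "G v = (if v \<le> a then v else v - 1)" for v
  have A: "v \<le> a" if "v \<in> set \<alpha>" for v using that ab by (simp add: is_perm_def a_def)
  have B: "Suc a < v" if "v \<in> set B" for v using that ab by (auto simp: is_perm_def B_def)
  have ft: "f_tilde \<pi> = \<alpha> @ Suc a # B" unfolding ab(5)
    using f_tilde_direct_sum ab assms(3) by (simp add: direct_sum_def a_def B_def comp_def add_ac)
  have "map G (\<alpha> @ B) = \<pi>"
  proof -
    have "map G \<alpha> = \<alpha>" using A by (intro map_idI) (auto simp: G_def)
    moreover have "map G B = map (\<lambda>v. v + a) \<beta>" using ab(2) by (auto simp: B_def G_def is_perm_def)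
    ultimately show ?thesis by (simp add: ab(5) direct_sum_def a_def)
  qed
  have Bne: "B \<noteq> []" using ab by (simp add: B_def)
  show ?thesis unfolding avoids_def ft
  proof safe
    fix ys assume ys: "subseq ys (\<alpha> @ Suc a # B)" "order_iso ys p"
    have A': "\<And>v. v \<in> set \<alpha> \<Longrightarrow> v < Suc a" using A by (simp add: less_Suc_eq_le)
    obtain zs where zs: "subseq zs (\<alpha> @ B)" "order_iso zs p"
      using middle_freeD[OF assms(5) ab(3) Bne A' B ys] by blast
    have mem: "v \<le> a \<or> Suc a < v" if "v \<in> set zs" for v
      using that subseq_set[OF zs(1)] A B by auto
    have "order_iso (map G zs) zs"
    proof (rule order_iso_map)
      fix u v assume "u \<in> set zs" "v \<in> set zs"
      then show "G u < G v \<longleftrightarrow> u < v" using mem[of u] mem[of v] by (auto simp: G_def)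
    qed
    then have "order_iso (map G zs) p" using zs(2) order_iso_trans by blast
    moreover have "subseq (map G zs) \<pi>"
      using subseq_map[OF zs(1), of G] \<open>map G (\<alpha> @ B) = \<pi>\<close> by simp
    ultimately show False using assms(4) unfolding avoids_def by blast
  qed
qed

section \<open>Reduction to case (1)\<close>

text \<open>Isolates the part of compatibility that concerns case (1), so that case (2) becomes the
  same statement about the inverse pattern.\<close>

definition case1_avoids :: "nat list \<Rightarrow> bool" where
  "case1_avoids p \<longleftrightarrow> (\<forall>\<pi>. is_perm \<pi> \<longrightarrow> avoids \<pi> [1,3,2,4] \<longrightarrow> avoids \<pi> p \<longrightarrow>
     \<not> decomposable \<pi> \<longrightarrow> decomposable (\<pi> \<setminus> hd \<pi>) \<longrightarrow> avoids (f_case1 \<pi>) p)"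

text \<open>Case (3) applies case (1) or (2) to a reverse-complement, knowing that the deletions of cases
  (1) and (2) leave the original permutation indecomposable. After the symmetries, one of these
  deletions becomes that of the largest value.\<close>

definition strict_case1_avoids :: "nat list \<Rightarrow> bool" where
  "strict_case1_avoids p \<longleftrightarrow> (\<forall>\<pi>. is_perm \<pi> \<longrightarrow> avoids \<pi> [1,3,2,4] \<longrightarrow> avoids \<pi> p \<longrightarrow>
     \<not> decomposable \<pi> \<longrightarrow> decomposable (\<pi> \<setminus> hd \<pi>) \<longrightarrow> \<not> decomposable (\<pi> \<setminus> length \<pi>) \<longrightarrow>
     avoids (f_case1 \<pi>) p)"

section \<open>Decomposability and border deletions under the symmetries\<close>

lemma inverse_perm_eq_Nil_iff [simp]: "inverse_perm \<pi> = [] \<longleftrightarrow> \<pi> = []"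
  by (metis length_0_conv length_inverse_perm)

lemma reverse_complement_eq_Nil_iff [simp]: "reverse_complement \<pi> = [] \<longleftrightarrow> \<pi> = []"
  by (metis length_0_conv length_reverse_complement)

lemma point_dec_swap_iff: "point_dec (prod.swap ` P) \<longleftrightarrow> point_dec P"
  using point_dec_swap[of P] point_dec_swap[of "prod.swap ` P"] by (auto simp: image_image)

lemma decomposable_inverse_perm:
  "is_perm \<pi> \<Longrightarrow> decomposable (inverse_perm \<pi>) \<longleftrightarrow> decomposable \<pi>"
  by (simp add: decomposable_iff_point_dec is_perm_inverse_perm pts_inverse_perm point_dec_swap_iff)

lemma point_dec_reflect_iff:
  assumes "\<And>q. q \<in> P \<Longrightarrow> fst q \<le> n \<and> snd q \<le> n"
  shows "point_dec (reflect n ` P) \<longleftrightarrow> point_dec P"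
proof
  assume *: "point_dec (reflect n ` P)"
  show "point_dec P"
  proof (cases "\<exists>q \<in> P. fst q = 0 \<or> snd q = 0")
    case False
    have "reflect n ` reflect n ` P = P"
      using assms by (auto simp: image_image reflect_reflect intro!: rev_image_eqI)
    moreover have "fst q \<le> n \<and> snd q \<le> n" if "q \<in> reflect n ` P" for q
      using that False assms by (auto simp: reflect_def)
    ultimately show ?thesis using point_dec_reflect[OF _ *, of n] by auto
  next
    \<comment> \<open>A coordinate 0 is reflected to \<open>n + 1\<close>, beyond the bound required
      by \<open>point_dec_reflect\<close>, so the splitting is pulled back by hand.\<close>
    case True
    obtain A B where AB: "reflect n ` P = A \<union> B" "A \<noteq> {}" "B \<noteq> {}"
      "\<And>a b. a \<in> A \<Longrightarrow> b \<in> B \<Longrightarrow> fst a < fst b \<and> snd a < snd b"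
      using * unfolding point_dec_def by blast
    define A' where "A' = {q \<in> P. reflect n q \<in> A}"
    define B' where "B' = {q \<in> P. reflect n q \<in> B}"
    have "fst b < fst a \<and> snd b < snd a" if "a \<in> A'" "b \<in> B'" for a b
      using AB(4)[of "reflect n a" "reflect n b"] that by (auto simp: A'_def B'_def reflect_def)
    moreover have "P = B' \<union> A'" using AB(1) by (auto simp: A'_def B'_def)
    moreover have "A' \<noteq> {}" "B' \<noteq> {}" using AB(1-3) by (force simp: A'_def B'_def)+
    ultimately show ?thesis unfolding point_dec_def by blast
  qed
qed (use assms in \<open>rule point_dec_reflect\<close>)

lemma decomposable_reverse_complement:
  "is_perm \<pi> \<Longrightarrow> decomposable (reverse_complement \<pi>) \<longleftrightarrow> decomposable \<pi>"
  using pts_bounds[of \<pi>]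
  by (subst (1 2) decomposable_iff_point_dec)
    (auto simp: is_perm_reverse_complement pts_reverse_complement point_dec_reflect_iff)

text \<open>Entries are distinct, so deleting a value removes one column. The four deletions thus
  become removals of the four border lines of the diagram, which the symmetries permute.\<close>

lemma decomposable_delete_nth:
  assumes "is_perm \<pi>" "k < length \<pi>"
  shows "decomposable (\<pi> \<setminus> (\<pi> ! k)) \<longleftrightarrow> point_dec {q \<in> pts \<pi>. fst q \<noteq> Suc k}"
proof -
  have "{q \<in> pts \<pi>. snd q \<noteq> \<pi> ! k} = {q \<in> pts \<pi>. fst q \<noteq> Suc k}"
    using assms by (auto simp: pts_def is_perm_def nth_eq_iff_index_eq)
  then show ?thesis using assms by (simp add: decomposable_delete_value)
qed

lemma decomposable_delete_hd:
  "is_perm \<pi> \<Longrightarrow> \<pi> \<noteq> [] \<Longrightarrow> decomposable (\<pi> \<setminus> hd \<pi>) \<longleftrightarrow> point_dec {q \<in> pts \<pi>. fst q \<noteq> 1}"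
  using decomposable_delete_nth[of \<pi> 0] by (simp add: hd_conv_nth)

lemma decomposable_delete_last:
  "is_perm \<pi> \<Longrightarrow> \<pi> \<noteq> [] \<Longrightarrow>
    decomposable (\<pi> \<setminus> last \<pi>) \<longleftrightarrow> point_dec {q \<in> pts \<pi>. fst q \<noteq> length \<pi>}"
  using decomposable_delete_nth[of \<pi> "length \<pi> - 1"] by (simp add: last_conv_nth)

lemma decomposable_delete_inverse_perm:
  assumes "is_perm \<pi>" "\<pi> \<noteq> []"
  shows "decomposable (inverse_perm \<pi> \<setminus> hd (inverse_perm \<pi>)) \<longleftrightarrow> decomposable (\<pi> \<setminus> 1)"
    and "decomposable (inverse_perm \<pi> \<setminus> last (inverse_perm \<pi>)) \<longleftrightarrow> decomposable (\<pi> \<setminus> length \<pi>)"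
    and "decomposable (inverse_perm \<pi> \<setminus> 1) \<longleftrightarrow> decomposable (\<pi> \<setminus> hd \<pi>)"
    and "decomposable (inverse_perm \<pi> \<setminus> length \<pi>) \<longleftrightarrow> decomposable (\<pi> \<setminus> last \<pi>)"
proof -
  have i: "is_perm (inverse_perm \<pi>)" "inverse_perm \<pi> \<noteq> []"
    using assms by (auto simp: is_perm_inverse_perm)
  have s: "{q \<in> prod.swap ` P. fst q \<noteq> e} = prod.swap ` {q \<in> P. snd q \<noteq> e}"
    "{q \<in> prod.swap ` P. snd q \<noteq> e} = prod.swap ` {q \<in> P. fst q \<noteq> e}" for e and P :: "(nat \<times> nat) set"
    by auto
  \<comment> \<open>The rule for deleting an arbitrary value also matches the deletion of a first or
    last entry, so each claim below unfolds only the facts meant for its two sides.\<close>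
  note D = decomposable_delete_value[OF assms(1)] decomposable_delete_value[OF i(1)]
    decomposable_delete_hd[OF i] decomposable_delete_last[OF i]
    decomposable_delete_hd[OF assms] decomposable_delete_last[OF assms]
    pts_inverse_perm[OF assms(1)] s point_dec_swap_iff length_inverse_perm
  show "decomposable (inverse_perm \<pi> \<setminus> hd (inverse_perm \<pi>)) \<longleftrightarrow> decomposable (\<pi> \<setminus> 1)"
    unfolding D(1,3,7-) ..
  show "decomposable (inverse_perm \<pi> \<setminus> last (inverse_perm \<pi>)) \<longleftrightarrow> decomposable (\<pi> \<setminus> length \<pi>)"
    unfolding D(1,4,7-) ..
  show "decomposable (inverse_perm \<pi> \<setminus> 1) \<longleftrightarrow> decomposable (\<pi> \<setminus> hd \<pi>)"
    unfolding D(2,5,7-) ..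
  show "decomposable (inverse_perm \<pi> \<setminus> length \<pi>) \<longleftrightarrow> decomposable (\<pi> \<setminus> last \<pi>)"
    unfolding D(2,6,7-) ..
qed

lemma decomposable_delete_reverse_complement:
  assumes "is_perm \<pi>" "\<pi> \<noteq> []"
  shows "decomposable (reverse_complement \<pi> \<setminus> hd (reverse_complement \<pi>)) \<longleftrightarrow>
      decomposable (\<pi> \<setminus> last \<pi>)"
    and "decomposable (reverse_complement \<pi> \<setminus> last (reverse_complement \<pi>)) \<longleftrightarrow>
      decomposable (\<pi> \<setminus> hd \<pi>)"
    and "decomposable (reverse_complement \<pi> \<setminus> 1) \<longleftrightarrow> decomposable (\<pi> \<setminus> length \<pi>)"
    and "decomposable (reverse_complement \<pi> \<setminus> length \<pi>) \<longleftrightarrow> decomposable (\<pi> \<setminus> 1)"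
proof -
  define n where "n = length \<pi>"
  have i: "is_perm (reverse_complement \<pi>)" "reverse_complement \<pi> \<noteq> []"
    using assms by (auto simp: is_perm_reverse_complement)
  have b: "1 \<le> fst q \<and> fst q \<le> n \<and> 1 \<le> snd q \<and> snd q \<le> n" if "q \<in> pts \<pi>" for q
    using pts_bounds[OF assms(1) that] by (simp add: n_def)
  have s: "{q \<in> reflect n ` pts \<pi>. fst q \<noteq> 1} = reflect n ` {q \<in> pts \<pi>. fst q \<noteq> n}"
    "{q \<in> reflect n ` pts \<pi>. fst q \<noteq> n} = reflect n ` {q \<in> pts \<pi>. fst q \<noteq> 1}"
    "{q \<in> reflect n ` pts \<pi>. snd q \<noteq> 1} = reflect n ` {q \<in> pts \<pi>. snd q \<noteq> n}"
    "{q \<in> reflect n ` pts \<pi>. snd q \<noteq> n} = reflect n ` {q \<in> pts \<pi>. snd q \<noteq> 1}"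
    using b by (force simp: reflect_def)+
  have r: "point_dec (reflect n ` {q \<in> pts \<pi>. P q}) \<longleftrightarrow> point_dec {q \<in> pts \<pi>. P q}" for P
    using b by (intro point_dec_reflect_iff) auto
  note D = decomposable_delete_value[OF assms(1)] decomposable_delete_value[OF i(1)]
    decomposable_delete_hd[OF i] decomposable_delete_last[OF i]
    decomposable_delete_hd[OF assms] decomposable_delete_last[OF assms]
    length_reverse_complement pts_reverse_complement[OF assms(1)] n_def[symmetric] s r
  show "decomposable (reverse_complement \<pi> \<setminus> hd (reverse_complement \<pi>)) \<longleftrightarrow>
      decomposable (\<pi> \<setminus> last \<pi>)"
    unfolding D(3,6,7-) ..
  show "decomposable (reverse_complement \<pi> \<setminus> last (reverse_complement \<pi>)) \<longleftrightarrow>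
      decomposable (\<pi> \<setminus> hd \<pi>)"
    unfolding D(4,5,7-) ..
  show "decomposable (reverse_complement \<pi> \<setminus> 1) \<longleftrightarrow> decomposable (\<pi> \<setminus> length \<pi>)"
    unfolding D(1,2,7-) ..
  show "decomposable (reverse_complement \<pi> \<setminus> length \<pi>) \<longleftrightarrow> decomposable (\<pi> \<setminus> 1)"
    unfolding D(1,2,7-) ..
qed

text \<open>An executable form of the inverse, since \<open>inv_into\<close> cannot be
  evaluated.\<close>

definition index_inverse :: "nat list \<Rightarrow> nat list" where
  "index_inverse \<pi> = map (\<lambda>v. Suc (length (takeWhile (\<lambda>u. u \<noteq> v) \<pi>))) [1..<Suc (length \<pi>)]"

lemma inverse_perm_eq_index_inverse:
  assumes "is_perm \<pi>"
  shows "inverse_perm \<pi> = index_inverse \<pi>"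
proof (rule nth_equalityI)
  show "length (inverse_perm \<pi>) = length (index_inverse \<pi>)" by (simp add: index_inverse_def del: upt_Suc)
  fix j assume "j < length (inverse_perm \<pi>)"
  then have j: "j < length \<pi>" by simp
  then obtain i where i: "i < length \<pi>" "\<pi> ! i = Suc j" "inverse_perm \<pi> ! (Suc j - 1) = Suc i"
    using inverse_perm_nth[OF assms, of "Suc j"] by auto
  have "takeWhile (\<lambda>u. u \<noteq> Suc j) \<pi> = take i \<pi>"
    using i assms nth_eq_iff_index_eq[of \<pi> _ i]
    by (intro takeWhile_eq_take_P_nth) (auto simp: is_perm_def)
  then show "inverse_perm \<pi> ! j = index_inverse \<pi> ! j"
    using i j by (simp add: index_inverse_def nth_upt del: upt_Suc)
qed

lemma inverse_perm_1324: "inverse_perm [1,3,2,4] = [1,3,2,4]"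
proof -
  have "is_perm [1,3,2,4]" by (auto simp: is_perm_def)
  then show ?thesis by (simp add: inverse_perm_eq_index_inverse) (simp add: index_inverse_def upt_rec)
qed

lemma reverse_complement_1324: "reverse_complement [1,3,2,4] = [1,3,2,4]"
  by (simp add: reverse_complement_def)

lemma is_perm_1324: "is_perm [1,3,2,4]"
  by (auto simp: is_perm_def)

lemma avoids_1324_inverse_perm:
  "is_perm \<pi> \<Longrightarrow> avoids (inverse_perm \<pi>) [1,3,2,4] \<longleftrightarrow> avoids \<pi> [1,3,2,4]"
  using avoids_inverse_perm[OF _ is_perm_1324] by (simp only: inverse_perm_1324)

lemma avoids_1324_reverse_complement:
  "is_perm \<pi> \<Longrightarrow> avoids (reverse_complement \<pi>) [1,3,2,4] \<longleftrightarrow> avoids \<pi> [1,3,2,4]"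
  using avoids_reverse_complement[OF _ is_perm_1324] by (simp only: reverse_complement_1324)

lemma is_perm_f_case1:
  assumes "is_perm \<pi>" "\<pi> \<noteq> []" "avoids \<pi> [1,3,2,4]" "decomposable (\<pi> \<setminus> hd \<pi>)"
  shows "is_perm (f_case1 \<pi>)"
  using assms f_case1_direct_sum(3) unfolding decomposable_def by metis

text \<open>The four hypotheses on case (1) belong to the four possible deletions in \<pi>: the
  first entry to \<open>p\<close>, the value 1 to its inverse, the last entry to its
  reverse-complement, and the largest value to the inverse of that.\<close>

lemma f_compatibleI:
  assumes p: "is_perm p" and "middle_free p"
    and "case1_avoids p" "case1_avoids (inverse_perm p)"
    and "strict_case1_avoids (reverse_complement p)"
    and "strict_case1_avoids (inverse_perm (reverse_complement p))"
  shows "f_compatible p"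
  unfolding f_compatible_def
proof (intro ballI impI)
  fix \<pi> assume "\<pi> \<in> Av {[1,3,2,4], p}" and dec: "decomposable \<pi> \<or> almost_decomposable \<pi>"
  then have \<pi>: "is_perm \<pi>" "avoids \<pi> [1,3,2,4]" "avoids \<pi> p" by (auto simp: Av_def)
  show "avoids (f_map \<pi>) p"
  proof (cases "decomposable \<pi>")
    case True
    then show ?thesis using f_tilde_avoids \<pi> assms(2) by (simp add: f_map_def)
  next
    case nd: False
    then have ne: "\<pi> \<noteq> []"
      and ex: "\<exists>e \<in> {1, hd \<pi>, length \<pi>, last \<pi>}. decomposable (\<pi> \<setminus> e)"
      using dec by (auto simp: almost_decomposable_def)
    \<comment> \<open>Stated for arbitrary \<open>\<rho>\<close> and \<open>q\<close> because it
      serves twice: for \<pi> in case (2) and for the reverse-complement of \<pi> in case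
      (3).\<close>
    have inv_case: "avoids (inverse_perm (f_case1 (inverse_perm \<rho>))) q"
      if \<rho>: "is_perm \<rho>" "\<rho> \<noteq> []" "avoids \<rho> [1,3,2,4]" "decomposable (\<rho> \<setminus> 1)" and q: "is_perm q"
        and a: "avoids (f_case1 (inverse_perm \<rho>)) (inverse_perm q)" for \<rho> q
    proof -
      have "is_perm (f_case1 (inverse_perm \<rho>))"
      proof (rule is_perm_f_case1)
        show "is_perm (inverse_perm \<rho>)" "inverse_perm \<rho> \<noteq> []"
          using \<rho> by (auto simp: is_perm_inverse_perm)
        show "avoids (inverse_perm \<rho>) [1,3,2,4]" using \<rho> by (simp only: avoids_1324_inverse_perm)
        show "decomposable (inverse_perm \<rho> \<setminus> hd (inverse_perm \<rho>))"
          unfolding decomposable_delete_inverse_perm(1)[OF \<rho>(1,2)] by fact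
      qed
      then have "avoids (inverse_perm (f_case1 (inverse_perm \<rho>))) (inverse_perm (inverse_perm q))"
        using a q by (simp add: avoids_inverse_perm is_perm_inverse_perm)
      then show ?thesis using q by (simp add: inverse_perm_inverse_perm)
    qed
    show ?thesis
    proof (cases "decomposable (\<pi> \<setminus> hd \<pi>)")
      case True
      then show ?thesis using assms(3) \<pi> nd unfolding case1_avoids_def f_map_def f_case12_def by auto
    next
      case nhd: False
      show ?thesis
      proof (cases "decomposable (\<pi> \<setminus> 1)")
        case True
        have "avoids (f_case1 (inverse_perm \<pi>)) (inverse_perm p)"
          using assms(4) \<pi> nd True ne p unfolding case1_avoids_def
          by (simp add: is_perm_inverse_perm avoids_1324_inverse_perm avoids_inverse_perm
              decomposable_inverse_perm decomposable_delete_inverse_perm del: One_nat_def)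
        then have "avoids (inverse_perm (f_case1 (inverse_perm \<pi>))) p"
          using inv_case \<pi> ne True p by blast
        then show ?thesis using nd nhd True by (simp add: f_map_def f_case12_def)
      next
        case n1: False
        define \<rho> where "\<rho> = reverse_complement \<pi>"
        define q where "q = reverse_complement p"
        have q: "is_perm q" using p by (simp add: q_def is_perm_reverse_complement)
        have \<rho>: "is_perm \<rho>" "avoids \<rho> [1,3,2,4]" "avoids \<rho> q" "\<rho> \<noteq> []" "\<not> decomposable \<rho>"
          "\<not> decomposable (\<rho> \<setminus> last \<rho>)" "\<not> decomposable (\<rho> \<setminus> length \<rho>)"
          using \<pi> p ne nd nhd n1
          by (auto simp: \<rho>_def q_def is_perm_reverse_complement avoids_1324_reverse_complement
              avoids_reverse_complement decomposable_reverse_complement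
              decomposable_delete_reverse_complement simp del: One_nat_def)
        have "decomposable (\<rho> \<setminus> hd \<rho>) \<or> decomposable (\<rho> \<setminus> 1)"
          using ex nhd n1 unfolding \<rho>_def decomposable_delete_reverse_complement[OF \<pi>(1) ne]
          by blast
        then have "is_perm (f_case12 \<rho>) \<and> avoids (f_case12 \<rho>) q"
        proof (cases "decomposable (\<rho> \<setminus> hd \<rho>)")
          case True
          then show ?thesis using assms(5) \<rho> unfolding strict_case1_avoids_def f_case12_def q_def
            by (auto intro: is_perm_f_case1)
        next
          case False
          assume "decomposable (\<rho> \<setminus> hd \<rho>) \<or> decomposable (\<rho> \<setminus> 1)"
          with False have 1: "decomposable (\<rho> \<setminus> 1)" by blast
          have i: "is_perm (inverse_perm \<rho>)" "inverse_perm \<rho> \<noteq> []" "avoids (inverse_perm \<rho>) [1,3,2,4]"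
            "decomposable (inverse_perm \<rho> \<setminus> hd (inverse_perm \<rho>))"
            "\<not> decomposable (inverse_perm \<rho> \<setminus> length (inverse_perm \<rho>))"
            "\<not> decomposable (inverse_perm \<rho>)" "avoids (inverse_perm \<rho>) (inverse_perm q)"
            using \<rho> 1 q by (auto simp: is_perm_inverse_perm avoids_1324_inverse_perm avoids_inverse_perm
              decomposable_inverse_perm decomposable_delete_inverse_perm simp del: One_nat_def)
          then have "avoids (f_case1 (inverse_perm \<rho>)) (inverse_perm q)"
            using assms(6) unfolding strict_case1_avoids_def q_def by blast
          then have "avoids (inverse_perm (f_case1 (inverse_perm \<rho>))) q"
            using inv_case \<rho> 1 q by blast
          moreover have "is_perm (f_case1 (inverse_perm \<rho>))" using i by (intro is_perm_f_case1)
          ultimately show ?thesis using False by (simp add: f_case12_def is_perm_inverse_perm)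
        qed
        then have "avoids (reverse_complement (f_case12 \<rho>)) (reverse_complement q)"
          using q by (simp add: avoids_reverse_complement)
        then show ?thesis using nd nhd n1 p
          by (simp add: f_map_def \<rho>_def q_def reverse_complement_reverse_complement)
      qed
    qed
  qed
qed

section \<open>The families of patterns that survive case (1)\<close>

lemma case1_avoids_Cons_max:
  assumes "\<not> list_dec t" "t \<noteq> []" "\<And>v. v \<in> set t \<Longrightarrow> v < a"
  shows "case1_avoids (a # t)"
  unfolding case1_avoids_def using f_case1_insertion insertion.avoids_F_Cons_max[OF _ assms] by blast

lemma case1_avoids_Cons_min:
  assumes "\<not> list_dec t" "2 \<le> length t" "\<And>v. v \<in> set t \<Longrightarrow> a < v"
  shows "case1_avoids (a # t)"
  unfolding case1_avoids_def using f_case1_insertion insertion.avoids_F_Cons_min[OF _ assms] by blast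

lemma case1_avoids_ascent:
  assumes "middle_free p" "p ! 0 < p ! 1" "1 < j" "j < k" "k < length p" "p ! j < p ! 1" "p ! 1 < p ! k"
  shows "case1_avoids p"
  unfolding case1_avoids_def using f_case1_insertion insertion.avoids_F_ascent[OF _ assms] by blast

text \<open>A maximal first entry would make the deletion of the first entry and that of the largest
  value coincide, but only the former is decomposable. This yields the bound on \<open>c\<close>
  needed by \<open>avoids_F_Cons_snoc\<close>.\<close>

lemma strict_case1_avoids_Cons_snoc:
  assumes "\<not> list_dec t" "i < j" "j < length t" "t ! j < t ! i"
    "\<And>v. v \<in> set t \<Longrightarrow> v < a" "a < q"
  shows "strict_case1_avoids (a # t @ [q])"
  unfolding strict_case1_avoids_def
proof (intro allI impI)
  fix \<pi> assume *: "is_perm \<pi>" "avoids \<pi> [1,3,2,4]" "avoids \<pi> (a # t @ [q])" "\<not> decomposable \<pi>"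
    "decomposable (\<pi> \<setminus> hd \<pi>)" "\<not> decomposable (\<pi> \<setminus> length \<pi>)"
  obtain x A B G where ins: "insertion (hd \<pi>) x A B G \<pi> (f_case1 \<pi>)"
    using f_case1_insertion * by blast
  have "\<pi> \<noteq> []" using insertion.pi[OF ins] by auto
  then have "hd \<pi> \<in> set \<pi>" by simp
  moreover have "hd \<pi> \<noteq> length \<pi>" using *(5,6) by auto
  ultimately have "hd \<pi> < length \<pi>" using *(1) by (auto simp: is_perm_def)
  then show "avoids (f_case1 \<pi>) (a # t @ [q])"
    using insertion.avoids_F_Cons_snoc[OF ins assms] *(3) by blast
qed

lemma strict_case1_avoidsI: "case1_avoids p \<Longrightarrow> strict_case1_avoids p"
  by (simp add: case1_avoids_def strict_case1_avoids_def)

lemma pts_iff: "(Suc i, v) \<in> pts xs \<longleftrightarrow> i < length xs \<and> xs ! i = v"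
  by (auto simp: pts_def)

text \<open>The rest of the pattern ends in its minimum and is therefore indecomposable. The
  hypotheses speak of two opposite corners of the diagram because both symmetries preserve that
  pair.\<close>

lemma case1_avoids_corners:
  assumes "is_perm p" "2 \<le> length p" "(1, length p) \<in> pts p" "(length p, 1) \<in> pts p"
  shows "case1_avoids p" "middle_free p"
proof -
  obtain a t where p: "p = a # t" using assms(2) by (cases p) auto
  have "a = length p" using assms(3) pts_iff[of 0 "length p" p] by (simp add: p)
  moreover have "set p = {1..length p}" "a \<notin> set t" using assms(1) by (auto simp: is_perm_def p)
  ultimately have max: "v < a" if "v \<in> set t" for v using that
    by (metis atLeastAtMost_iff le_neq_implies_less list.set_intros(2) p)
  have t: "t \<noteq> []" using assms(2) p by auto
  have "Suc (length p - 1) = length p" using assms(2) by simp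
  then have "p ! (length p - 1) = 1" using assms(4) pts_iff[of "length p - 1" 1 p] by metis
  then have last: "last t = 1" using t p by (simp add: last_conv_nth nth_Cons')
  have "\<not> list_dec t"
  proof
    assume "list_dec t"
    then obtain ys zs where *: "t = ys @ zs" "ys \<noteq> []" "zs \<noteq> []"
      "\<And>y z. y \<in> set ys \<Longrightarrow> z \<in> set zs \<Longrightarrow> y < z" unfolding list_dec_def by blast
    have "1 \<in> set zs" using last *(1,3) by (metis last_appendR last_in_set)
    moreover have "hd ys \<in> set ys" using *(2) by simp
    ultimately have "hd ys < 1" by (intro *(4))
    moreover have "hd ys \<in> set p" using \<open>hd ys \<in> set ys\<close> by (simp add: p *(1))
    ultimately show False using assms(1) by (simp add: is_perm_def)
  qed
  then show "case1_avoids p" unfolding p using t max by (rule case1_avoids_Cons_max)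
  show "middle_free p"
    using assms(2) max unfolding p by (intro middle_free_not_list_dec list_dec_Cons_max)
qed

lemma f_compatible_corners:
  assumes "is_perm p" "p \<noteq> []" "hd p = length p" "last p = 1"
  shows "f_compatible p"
proof (cases "2 \<le> length p")
  case True
  \<comment> \<open>The condition is closed under inverse and reverse-complement, so all four
    patterns in \<open>f_compatibleI\<close> are treated alike.\<close>
  define C where "C q \<longleftrightarrow> is_perm q \<and> 2 \<le> length q \<and> (1, length q) \<in> pts q \<and> (length q, 1) \<in> pts q" for q
  have "(1, length p) \<in> pts p" "(length p, 1) \<in> pts p"
    using assms True pts_iff[of 0 "length p" p] pts_iff[of "length p - 1" 1 p]
    by (simp_all add: hd_conv_nth last_conv_nth)
  then have C: "C p" using assms True by (simp add: C_def)
  have Ci: "C (inverse_perm q)" if "C q" for q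
    using that by (auto simp: C_def is_perm_inverse_perm pts_inverse_perm intro: rev_image_eqI)
  have Cr: "C (reverse_complement q)" if "C q" for q
    using that by (auto simp: C_def is_perm_reverse_complement pts_reverse_complement reflect_def
        intro: rev_image_eqI)
  have C1: "case1_avoids q" "middle_free q" if "C q" for q
    using that case1_avoids_corners by (simp_all add: C_def)
  show ?thesis using C Ci Cr C1 assms(1) by (intro f_compatibleI strict_case1_avoidsI) auto
next
  case False
  then have "length p = 1" using assms(2) by (cases p) (auto simp: not_le)
  \<comment> \<open>Every nonempty permutation contains this pattern, so there is no \<pi> to
    consider.\<close>
  then have p: "p = [1]" using assms(3) by (cases p) auto
  show ?thesis unfolding f_compatible_def
  proof (intro ballI impI)
    fix \<pi> assume "\<pi> \<in> Av {[1,3,2,4], p}" and dec: "decomposable \<pi> \<or> almost_decomposable \<pi>"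
    then have "avoids \<pi> [1]" by (simp add: Av_def p)
    moreover have "order_iso [hd \<pi>] [1]" by (simp add: order_iso_def)
    ultimately have "hd \<pi> \<notin> set \<pi>" unfolding avoids_def by (metis subseq_singleton_left)
    then have "\<pi> = []" by (cases \<pi>) auto
    then have False using dec by (auto simp: almost_decomposable_def decomposable_def direct_sum_def)
    then show "avoids (f_map \<pi>) p" ..
  qed
qed

section \<open>Witnesses and classification\<close>

definition case1_bad :: "nat list \<Rightarrow> nat list \<Rightarrow> bool" where
  "case1_bad \<pi> p \<longleftrightarrow> is_perm \<pi> \<and> \<pi> \<noteq> [] \<and> avoids \<pi> [1,3,2,4] \<and> avoids \<pi> p \<and>
     \<not> decomposable \<pi> \<and> decomposable (\<pi> \<setminus> hd \<pi>) \<and> \<not> avoids (f_case1 \<pi>) p"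

lemma not_f_compatible:
  assumes "is_perm \<pi>" "\<pi> \<noteq> []" "avoids \<pi> [1,3,2,4]" "avoids \<pi> p" "\<not> decomposable \<pi>"
    "e \<in> {1, hd \<pi>, length \<pi>, last \<pi>}" "decomposable (\<pi> \<setminus> e)" "\<not> avoids (f_map \<pi>) p"
  shows "\<not> f_compatible p"
proof -
  have "almost_decomposable \<pi>" using assms(1,2,5-7) unfolding almost_decomposable_def by blast
  moreover have "\<pi> \<in> Av {[1,3,2,4], p}" using assms(1,3,4) by (simp add: Av_def)
  ultimately show ?thesis using assms(8) unfolding f_compatible_def by blast
qed

lemma not_f_compatible_case1: "case1_bad \<pi> p \<Longrightarrow> \<not> f_compatible p"
  by (rule not_f_compatible[of \<pi> _ "hd \<pi>"]) (simp_all add: case1_bad_def f_map_def f_case12_def)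

lemma inverse_perm_case1_bad:
  assumes "is_perm p" "case1_bad \<pi> (inverse_perm p)"
  defines "\<rho> \<equiv> inverse_perm \<pi>"
  shows "is_perm \<rho>" "\<rho> \<noteq> []" "avoids \<rho> [1,3,2,4]" "avoids \<rho> p" "\<not> decomposable \<rho>"
    "decomposable (\<rho> \<setminus> 1)" "\<not> avoids (inverse_perm (f_case1 (inverse_perm \<rho>))) p"
    "is_perm (inverse_perm (f_case1 (inverse_perm \<rho>)))"
proof -
  have \<pi>: "is_perm \<pi>" "\<pi> \<noteq> []" "avoids \<pi> [1,3,2,4]" "avoids \<pi> (inverse_perm p)" "\<not> decomposable \<pi>"
    "decomposable (\<pi> \<setminus> hd \<pi>)" "\<not> avoids (f_case1 \<pi>) (inverse_perm p)"
    using assms(2) by (simp_all add: case1_bad_def)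
  have F: "is_perm (f_case1 \<pi>)" using \<pi> by (intro is_perm_f_case1)
  have transfer: "avoids (inverse_perm \<sigma>) p \<longleftrightarrow> avoids \<sigma> (inverse_perm p)" if "is_perm \<sigma>" for \<sigma>
    using avoids_inverse_perm[OF that is_perm_inverse_perm[OF assms(1)]]
    by (simp add: inverse_perm_inverse_perm assms(1))
  show "is_perm \<rho>" "\<rho> \<noteq> []" "\<not> decomposable \<rho>" using \<pi>
    by (simp_all add: \<rho>_def is_perm_inverse_perm decomposable_inverse_perm)
  show "avoids \<rho> [1,3,2,4]" using \<pi> by (simp only: \<rho>_def avoids_1324_inverse_perm)
  show "avoids \<rho> p" using \<pi> by (simp add: \<rho>_def transfer)
  show "decomposable (\<rho> \<setminus> 1)" unfolding \<rho>_def decomposable_delete_inverse_perm(3)[OF \<pi>(1,2)] by fact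
  show "\<not> avoids (inverse_perm (f_case1 (inverse_perm \<rho>))) p"
    "is_perm (inverse_perm (f_case1 (inverse_perm \<rho>)))"
    using \<pi> F by (simp_all add: \<rho>_def transfer inverse_perm_inverse_perm is_perm_inverse_perm)
qed

text \<open>The condition on deleting 1 from \<pi> says that the inverse has no decomposable
  deletion of its first entry, so \<open>f_case12\<close> takes its second branch there.\<close>

lemma not_f_compatible_case2:
  assumes "is_perm p" "case1_bad \<pi> (inverse_perm p)" "\<not> decomposable (\<pi> \<setminus> 1)"
  shows "\<not> f_compatible p"
proof -
  note I = inverse_perm_case1_bad[OF assms(1,2)]
  have \<pi>: "is_perm \<pi>" "\<pi> \<noteq> []" using assms(2) by (simp_all add: case1_bad_def)
  have "\<not> decomposable (inverse_perm \<pi> \<setminus> hd (inverse_perm \<pi>))"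
    unfolding decomposable_delete_inverse_perm(1)[OF \<pi>] by fact
  then have "f_map (inverse_perm \<pi>) = inverse_perm (f_case1 (inverse_perm (inverse_perm \<pi>)))"
    using I(5,6) by (simp add: f_map_def f_case12_def)
  then show ?thesis using I by (intro not_f_compatible[of "inverse_perm \<pi>" _ 1]) auto
qed

lemma not_f_compatible_case3:
  assumes p: "is_perm p" and \<rho>: "is_perm \<rho>" "\<rho> \<noteq> []" "avoids \<rho> [1,3,2,4]"
    "avoids \<rho> (reverse_complement p)" "\<not> decomposable \<rho>"
    "decomposable (\<rho> \<setminus> hd \<rho>) \<or> decomposable (\<rho> \<setminus> 1)"
    "\<not> decomposable (\<rho> \<setminus> last \<rho>)" "\<not> decomposable (\<rho> \<setminus> length \<rho>)"
    and F: "is_perm (f_case12 \<rho>)" "\<not> avoids (f_case12 \<rho>) (reverse_complement p)"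
  shows "\<not> f_compatible p"
proof -
  define \<pi> where "\<pi> = reverse_complement \<rho>"
  have transfer: "avoids (reverse_complement \<sigma>) p \<longleftrightarrow> avoids \<sigma> (reverse_complement p)"
    if "is_perm \<sigma>" for \<sigma>
    using avoids_reverse_complement[OF that is_perm_reverse_complement[OF p]]
    by (simp add: reverse_complement_reverse_complement p)
  have \<pi>: "is_perm \<pi>" "\<pi> \<noteq> []" "\<not> decomposable \<pi>" "avoids \<pi> p"
    using \<rho> by (simp_all add: \<pi>_def is_perm_reverse_complement decomposable_reverse_complement transfer)
  have av: "avoids \<pi> [1,3,2,4]" using \<rho> by (simp only: \<pi>_def avoids_1324_reverse_complement)
  note D = decomposable_delete_reverse_complement[OF \<rho>(1,2), folded \<pi>_def]
  have "f_map \<pi> = reverse_complement (f_case12 \<rho>)"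
    using \<pi>(3) \<rho>(7,8) D(1,3) unfolding f_map_def
    by (simp add: \<pi>_def reverse_complement_reverse_complement \<rho>(1))
  then have "\<not> avoids (f_map \<pi>) p" using F by (simp add: transfer)
  moreover have "decomposable (\<pi> \<setminus> last \<pi>) \<or> decomposable (\<pi> \<setminus> length \<pi>)"
    using \<rho>(6) D(2,4) by (simp add: \<pi>_def)
  ultimately show ?thesis
    using \<pi> av not_f_compatible[of \<pi> p "last \<pi>"] not_f_compatible[of \<pi> p "length \<pi>"] by blast
qed

text \<open>The last two conditions guarantee that cases (1) and (2) both fail for the
  reverse-complement of \<pi>, so that \<open>f_map\<close> really reaches case (3).\<close>

lemma not_f_compatible_case31:
  assumes "is_perm p" "case1_bad \<pi> (reverse_complement p)"
    "\<not> decomposable (\<pi> \<setminus> last \<pi>)" "\<not> decomposable (\<pi> \<setminus> length \<pi>)"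
  shows "\<not> f_compatible p"
proof (rule not_f_compatible_case3[OF assms(1), of \<pi>])
  show "is_perm (f_case12 \<pi>)" using assms(2) is_perm_f_case1 by (simp add: case1_bad_def f_case12_def)
qed (use assms in \<open>simp_all add: case1_bad_def f_case12_def\<close>)

text \<open>The condition on deleting 1 selects the second branch of \<open>f_case12\<close>; the
  other two make \<open>f_map\<close> reach case (3), exchanged compared with the previous lemma by
  the inverse.\<close>

lemma not_f_compatible_case32:
  assumes "is_perm p" "case1_bad \<pi> (inverse_perm (reverse_complement p))"
    "\<not> decomposable (\<pi> \<setminus> 1)" "\<not> decomposable (\<pi> \<setminus> length \<pi>)" "\<not> decomposable (\<pi> \<setminus> last \<pi>)"
  shows "\<not> f_compatible p"
proof -
  note I = inverse_perm_case1_bad[OF is_perm_reverse_complement[OF assms(1)] assms(2)]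
  have \<pi>: "is_perm \<pi>" "\<pi> \<noteq> []" using assms(2) by (simp_all add: case1_bad_def)
  note D = decomposable_delete_inverse_perm[OF \<pi>]
  have c12: "f_case12 (inverse_perm \<pi>) = inverse_perm (f_case1 (inverse_perm (inverse_perm \<pi>)))"
    using D(1) assms(3) unfolding f_case12_def by simp
  show ?thesis
    by (rule not_f_compatible_case3[OF assms(1) I(1-5)]) (use D I assms c12 in simp_all)
qed

section \<open>Executable tests for containment and decomposability\<close>

lemma order_iso_code [code]:
  "order_iso [] [] \<longleftrightarrow> True"
  "order_iso (x # xs) [] \<longleftrightarrow> False"
  "order_iso [] (y # ys) \<longleftrightarrow> False"
  "order_iso (x # xs) (y # ys) \<longleftrightarrow>
     list_all2 (\<lambda>u v. (x < u \<longleftrightarrow> y < v) \<and> (u < x \<longleftrightarrow> v < y)) xs ys \<and> order_iso xs ys"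
  unfolding order_iso_Cons_iff by (auto simp: order_iso_def list_all2_conv_all_nth)

fun subseqs_of_length :: "nat \<Rightarrow> 'a list \<Rightarrow> 'a list list" where
  "subseqs_of_length 0 xs = [[]]"
| "subseqs_of_length (Suc k) [] = []"
| "subseqs_of_length (Suc k) (x # xs) = map ((#) x) (subseqs_of_length k xs) @ subseqs_of_length (Suc k) xs"

lemma set_subseqs_of_length: "set (subseqs_of_length k xs) = {ys. subseq ys xs \<and> length ys = k}"
proof (induction k xs rule: subseqs_of_length.induct)
  case (3 k x xs)
  show ?case unfolding subseqs_of_length.simps set_append set_map 3
    by (auto simp: image_iff length_Suc_conv)
qed auto

lemma avoids_code [code]: "avoids \<pi> p \<longleftrightarrow> list_all (\<lambda>xs. \<not> order_iso xs p) (subseqs_of_length (length p) \<pi>)"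
  by (auto simp: avoids_def list_all_iff set_subseqs_of_length order_iso_def)

lemma is_perm_code [code]: "is_perm \<pi> \<longleftrightarrow> distinct \<pi> \<and> list_all (\<lambda>v. 1 \<le> v \<and> v \<le> length \<pi>) \<pi>"
proof
  assume "distinct \<pi> \<and> list_all (\<lambda>v. 1 \<le> v \<and> v \<le> length \<pi>) \<pi>"
  then have "set \<pi> \<subseteq> {1..length \<pi>}" "card (set \<pi>) = card {1..length \<pi>}" "distinct \<pi>"
    by (auto simp: list_all_iff distinct_card)
  then show "is_perm \<pi>" using card_subset_eq[of "{1..length \<pi>}" "set \<pi>"] by (simp add: is_perm_def)
qed (auto simp: is_perm_def list_all_iff)

lemma list_dec_code [code]:
  "list_dec xs \<longleftrightarrow>
    list_ex (\<lambda>k. list_all (\<lambda>y. list_all (\<lambda>z. y < z) (drop k xs)) (take k xs)) [1..<length xs]"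
proof
  assume "list_dec xs"
  then obtain ys zs where "xs = ys @ zs" "ys \<noteq> []" "zs \<noteq> []"
    "\<And>y z. y \<in> set ys \<Longrightarrow> z \<in> set zs \<Longrightarrow> y < z" unfolding list_dec_def by blast
  then show "list_ex (\<lambda>k. list_all (\<lambda>y. list_all (\<lambda>z. y < z) (drop k xs)) (take k xs)) [1..<length xs]"
    by (auto simp: list_ex_iff list_all_iff Suc_le_eq intro!: bexI[of _ "length ys"])
next
  assume "list_ex (\<lambda>k. list_all (\<lambda>y. list_all (\<lambda>z. y < z) (drop k xs)) (take k xs)) [1..<length xs]"
  then obtain k where "1 \<le> k" "k < length xs" "\<And>y z. y \<in> set (take k xs) \<Longrightarrow> z \<in> set (drop k xs) \<Longrightarrow> y < z"
    by (auto simp: list_ex_iff list_all_iff)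
  then show "list_dec xs" unfolding list_dec_def
    by (intro exI[of _ "take k xs"] exI[of _ "drop k xs"]) auto
qed

lemma decomposable_delete_value_list_dec:
  assumes "is_perm \<pi>"
  shows "decomposable (\<pi> \<setminus> e) \<longleftrightarrow> list_dec (removeAll e \<pi>)"
  using assms by (simp add: decomposable_delete_value list_dec_removeAll_iff)

text \<open>Describes a permutation by its first entry and a cut of the rest. By
  \<open>f_case1_direct_sum\<close> the image is obtained by replacing \<beta> with
  \<open>[1] \<oplus> \<beta>\<close>, so a witness can be checked without evaluating a
  \<open>THE\<close>.\<close>

definition base :: "nat \<Rightarrow> nat list \<Rightarrow> nat list \<Rightarrow> nat list" where
  "base c \<alpha> \<beta> = c # map (skip c) (\<alpha> \<oplus> \<beta>)"

definition base_bad :: "nat \<Rightarrow> nat list \<Rightarrow> nat list \<Rightarrow> nat list \<Rightarrow> bool" where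
  "base_bad c \<alpha> \<beta> p \<longleftrightarrow> is_perm \<alpha> \<and> is_perm \<beta> \<and> \<alpha> \<noteq> [] \<and> \<beta> \<noteq> [] \<and>
     is_perm (base c \<alpha> \<beta>) \<and> \<not> list_dec (base c \<alpha> \<beta>) \<and>
     avoids (base c \<alpha> \<beta>) [1,3,2,4] \<and> avoids (base c \<alpha> \<beta>) p \<and>
     \<not> avoids (base c \<alpha> ([1] \<oplus> \<beta>)) p"

lemma base_bad_imp_case1_bad:
  assumes "base_bad c \<alpha> \<beta> p"
  shows "case1_bad (base c \<alpha> \<beta>) p"
proof -
  have *: "is_perm \<alpha>" "is_perm \<beta>" "\<alpha> \<noteq> []" "\<beta> \<noteq> []" "is_perm (base c \<alpha> \<beta>)"
    "\<not> decomposable (base c \<alpha> \<beta>)" "avoids (base c \<alpha> \<beta>) [1,3,2,4]" "avoids (base c \<alpha> \<beta>) p"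
    "\<not> avoids (base c \<alpha> ([1] \<oplus> \<beta>)) p"
    using assms by (simp_all add: base_bad_def decomposable_iff_list_dec)
  have p: "is_perm (c # map (skip c) (\<alpha> \<oplus> \<beta>))" using *(5) by (simp add: base_def)
  from perm_Cons_eq_map_skip[OF p] have "\<alpha> \<oplus> \<beta> = standardize (map (skip c) (\<alpha> \<oplus> \<beta>))"
    by (simp add: inj_map_eq_map inj_skip)
  then have d: "base c \<alpha> \<beta> \<setminus> hd (base c \<alpha> \<beta>) = \<alpha> \<oplus> \<beta>"
    using delete_hd_Cons[OF p] by (simp add: base_def)
  have ne: "base c \<alpha> \<beta> \<noteq> []" by (simp add: base_def)
  have "f_case1 (base c \<alpha> \<beta>) = base c \<alpha> ([1] \<oplus> \<beta>)"
    using f_case1_direct_sum(2)[OF *(5) ne d *(1-4,7)] by (simp add: base_def)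
  then show ?thesis using * d ne decomposable_direct_sum[OF *(1-4)] by (simp add: case1_bad_def)
qed

text \<open>In an entry \<open>(p, s, c, \<alpha>, \<beta>)\<close> the number \<open>s\<close> selects the symmetry carrying the witness
  \<open>base c \<alpha> \<beta>\<close>, which falls under case (1), to one for \<open>p\<close>: the identity, the inverse (case (2)),
  and each of them followed by the reverse-complement (case (3)).\<close>

fun refutes :: "nat list \<times> nat \<times> nat \<times> nat list \<times> nat list \<Rightarrow> bool" where
  "refutes (p, s, c, \<alpha>, \<beta>) \<longleftrightarrow> is_perm p \<and> (let \<pi> = base c \<alpha> \<beta>; n = length \<pi> in
     if s = 0 then base_bad c \<alpha> \<beta> p
     else if s = 1 then base_bad c \<alpha> \<beta> (index_inverse p) \<and> \<not> list_dec (removeAll 1 \<pi>)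
     else if s = 2 then base_bad c \<alpha> \<beta> (reverse_complement p) \<and>
       \<not> list_dec (removeAll (last \<pi>) \<pi>) \<and> \<not> list_dec (removeAll n \<pi>)
     else base_bad c \<alpha> \<beta> (index_inverse (reverse_complement p)) \<and> \<not> list_dec (removeAll 1 \<pi>) \<and>
       \<not> list_dec (removeAll n \<pi>) \<and> \<not> list_dec (removeAll (last \<pi>) \<pi>))"

lemma refutes_imp_not_f_compatible:
  assumes "refutes (p, s, c, \<alpha>, \<beta>)"
  shows "\<not> f_compatible p"
proof -
  define \<pi> where "\<pi> = base c \<alpha> \<beta>"
  have p: "is_perm p" using assms by simp
  have "is_perm \<pi>" using assms by (auto simp: \<pi>_def base_bad_def Let_def split: if_splits)
  note D = decomposable_delete_value_list_dec[OF this]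
  have cb: "case1_bad \<pi> q" if "base_bad c \<alpha> \<beta> q" for q
    unfolding \<pi>_def using that by (rule base_bad_imp_case1_bad)
  have inv: "inverse_perm q = index_inverse q" if "is_perm q" for q
    using that by (rule inverse_perm_eq_index_inverse)
  consider "case1_bad \<pi> p"
    | "case1_bad \<pi> (inverse_perm p)" "\<not> decomposable (\<pi> \<setminus> 1)"
    | "case1_bad \<pi> (reverse_complement p)" "\<not> decomposable (\<pi> \<setminus> last \<pi>)"
      "\<not> decomposable (\<pi> \<setminus> length \<pi>)"
    | "case1_bad \<pi> (inverse_perm (reverse_complement p))" "\<not> decomposable (\<pi> \<setminus> 1)"
      "\<not> decomposable (\<pi> \<setminus> length \<pi>)" "\<not> decomposable (\<pi> \<setminus> last \<pi>)"
    using assms cb unfolding D inv[OF p] inv[OF is_perm_reverse_complement[OF p]]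
    by (auto simp: Let_def simp flip: \<pi>_def split: if_splits)
  then show ?thesis
    using p not_f_compatible_case1 not_f_compatible_case2 not_f_compatible_case31
      not_f_compatible_case32 by cases blast+
qed

section \<open>Exhaustive check in a fixed length\<close>

fun arrangements :: "nat \<Rightarrow> 'a list \<Rightarrow> 'a list list" where
  "arrangements 0 xs = [[]]"
| "arrangements (Suc k) xs = concat (map (\<lambda>x. map ((#) x) (arrangements k (removeAll x xs))) xs)"

lemma in_arrangements:
  "distinct p \<Longrightarrow> set p \<subseteq> set xs \<Longrightarrow> p \<in> set (arrangements (length p) xs)"
proof (induction p arbitrary: xs)
  case (Cons a p)
  then have "p \<in> set (arrangements (length p) (removeAll a xs))" by (intro Cons.IH) auto
  then show ?case using Cons.prems by (auto intro!: bexI[of _ a])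
qed simp

definition min_pattern :: "nat list \<Rightarrow> bool" where
  "min_pattern p \<longleftrightarrow> p \<noteq> [] \<and> \<not> list_dec (tl p) \<and> 2 \<le> length (tl p) \<and> list_all (\<lambda>v. hd p < v) (tl p)"

text \<open>Takes the 213 of \<open>avoids_F_ascent\<close> at the indices 1, 2 and the last one. In
  length five it is needed for 34125 and 34215, the reverse-complements of 14523 and 15423.\<close>

definition ascent_pattern :: "nat list \<Rightarrow> bool" where
  "ascent_pattern p \<longleftrightarrow> \<not> list_dec (butlast p) \<and> 4 \<le> length p \<and>
     list_all (\<lambda>v. v < last p) (butlast p) \<and> p ! 0 < p ! 1 \<and> p ! 2 < p ! 1"

text \<open>Covers 3214, 43125, 42315 and 43215, the reverse-complements of 1432, 14532, 15342 and
  15432. A descent is demanded because a one-entry middle would be indecomposable without having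
  one.\<close>

definition max_max_pattern :: "nat list \<Rightarrow> bool" where
  "max_max_pattern p \<longleftrightarrow> p = hd p # tl (butlast p) @ [last p] \<and> \<not> list_dec (tl (butlast p)) \<and>
     \<not> sorted (tl (butlast p)) \<and> list_all (\<lambda>v. v < hd p) (tl (butlast p)) \<and> hd p < last p"

lemma min_pattern_avoids:
  assumes "min_pattern p"
  shows "middle_free p" "case1_avoids p"
proof -
  obtain a t where p: "p = a # t" using assms by (cases p) (auto simp: min_pattern_def)
  have t: "\<not> list_dec t" "2 \<le> length t" "\<And>v. v \<in> set t \<Longrightarrow> a < v"
    using assms by (auto simp: min_pattern_def p list_all_iff)
  show "middle_free p" "case1_avoids p"
    unfolding p using middle_free_Cons_min[OF t] case1_avoids_Cons_min[OF t] by auto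
qed

lemma ascent_pattern_avoids:
  assumes "ascent_pattern p"
  shows "middle_free p" "case1_avoids p"
proof -
  obtain s q where p: "p = s @ [q]" using assms by (cases p rule: rev_cases) (auto simp: ascent_pattern_def)
  have s: "\<not> list_dec s" "3 \<le> length s" "\<And>v. v \<in> set s \<Longrightarrow> v < q" "p ! 0 < p ! 1" "p ! 2 < p ! 1"
    using assms by (auto simp: ascent_pattern_def p list_all_iff)
  then have "s ! 1 \<in> set s" by (intro nth_mem) simp
  then have "p ! 1 < p ! length s" using s by (simp add: p nth_append)
  moreover show "middle_free p" unfolding p using s by (intro middle_free_snoc_max) auto
  ultimately show "case1_avoids p" using s
    by (intro case1_avoids_ascent[of p 2 "length s"]) (auto simp: p)
qed

lemma max_max_pattern_avoids:
  assumes "max_max_pattern p"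
  shows "strict_case1_avoids p"
proof -
  define t where "t = tl (butlast p)"
  have t: "p = hd p # t @ [last p]" "\<not> list_dec t" "\<not> sorted t" "\<And>v. v \<in> set t \<Longrightarrow> v < hd p"
    "hd p < last p"
    using assms unfolding max_max_pattern_def t_def[symmetric] by (auto simp: list_all_iff)
  obtain i j where "i < j" "j < length t" "t ! j < t ! i"
    using t(3) unfolding sorted_iff_nth_mono_less not_le by (meson not_le)
  then show ?thesis using strict_case1_avoids_Cons_snoc[OF t(2) _ _ _ t(4,5)] t(1) by metis
qed

definition compatible_pattern :: "nat list \<Rightarrow> bool" where
  "compatible_pattern p \<longleftrightarrow> is_perm p \<and> p \<noteq> [] \<and> (hd p = length p \<and> last p = 1 \<or>
     (\<forall>q \<in> {p, index_inverse p}. min_pattern q \<or> ascent_pattern q) \<and>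
     (\<forall>q \<in> {reverse_complement p, index_inverse (reverse_complement p)}.
        min_pattern q \<or> ascent_pattern q \<or> max_max_pattern q))"

lemma compatible_pattern_imp_f_compatible:
  assumes "compatible_pattern p"
  shows "f_compatible p"
proof (cases "hd p = length p \<and> last p = 1")
  case True
  then show ?thesis using assms by (intro f_compatible_corners) (simp_all add: compatible_pattern_def)
next
  case False
  have p: "is_perm p" using assms by (simp add: compatible_pattern_def)
  have 1: "min_pattern q \<or> ascent_pattern q" if "q \<in> {p, inverse_perm p}" for q
    using assms False that
    unfolding compatible_pattern_def inverse_perm_eq_index_inverse[OF p] by blast
  have 2: "min_pattern q \<or> ascent_pattern q \<or> max_max_pattern q"
    if "q \<in> {reverse_complement p, inverse_perm (reverse_complement p)}" for q
    using assms False that unfolding compatible_pattern_def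
      inverse_perm_eq_index_inverse[OF is_perm_reverse_complement[OF p]] by blast
  show ?thesis
  proof (rule f_compatibleI[OF p])
    show "middle_free p" "case1_avoids p" "case1_avoids (inverse_perm p)"
      using 1[of p] 1[of "inverse_perm p"] min_pattern_avoids ascent_pattern_avoids by blast+
    show "strict_case1_avoids (reverse_complement p)"
      "strict_case1_avoids (inverse_perm (reverse_complement p))"
      using 2[of "reverse_complement p"] 2[of "inverse_perm (reverse_complement p)"]
        min_pattern_avoids(2) ascent_pattern_avoids(2) max_max_pattern_avoids strict_case1_avoidsI
      by blast+
  qed
qed

lemma f_compatible_classification:
  assumes "list_all refutes W" "list_all compatible_pattern C"
    "list_all (\<lambda>p. is_perm p \<and> length p = n \<and> avoids p [1,3,2,4]) C"
    "list_all (\<lambda>p. \<not> avoids p [1,3,2,4] \<or> p \<in> set C \<or> p \<in> set (map fst W)) (arrangements n [1..<Suc n])"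
  shows "{p. is_perm p \<and> length p = n \<and> avoids p [1,3,2,4] \<and> f_compatible p} = set C"
proof
  show "set C \<subseteq> {p. is_perm p \<and> length p = n \<and> avoids p [1,3,2,4] \<and> f_compatible p}"
    using assms(2,3) compatible_pattern_imp_f_compatible by (auto simp: list_all_iff)
  show "{p. is_perm p \<and> length p = n \<and> avoids p [1,3,2,4] \<and> f_compatible p} \<subseteq> set C"
  proof safe
    fix p assume p: "is_perm p" "n = length p" "avoids p [1,3,2,4]" "f_compatible p"
    have "p \<notin> set (map fst W)"
      using assms(1) p(4) refutes_imp_not_f_compatible by (fastforce simp: list_all_iff)
    moreover have "p \<in> set (arrangements (length p) [1..<Suc (length p)])"
      using p(1) by (intro in_arrangements) (auto simp: is_perm_def)
    ultimately show "p \<in> set C" using assms(4) p(2,3) by (auto simp: list_all_iff)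
  qed
qed

text \<open>All patterns except 1324 and the three compatible ones. For instance, the entry for 3214
  is the permutation 4213 with image 42135.\<close>

definition witnesses4 :: "(nat list \<times> nat \<times> nat \<times> nat list \<times> nat list) list" where
  "witnesses4 =
    [([1,2,3,4], 0, 4, [1], [1,2]),
     ([1,2,4,3], 0, 3, [1], [2,1]),
     ([1,3,4,2], 2, 4, [1], [3,1,2]),
     ([1,4,2,3], 3, 4, [1], [3,1,2]),
     ([2,1,3,4], 0, 4, [2,1], [1]),
     ([2,1,4,3], 0, 3, [1], [2,1]),
     ([2,3,1,4], 1, 3, [1], [1]),
     ([2,3,4,1], 1, 4, [1], [2,1]),
     ([2,4,1,3], 1, 4, [1], [2,1]),
     ([2,4,3,1], 0, 4, [1], [3,2,1]),
     ([3,1,2,4], 0, 3, [1], [1]),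
     ([3,1,4,2], 0, 4, [1], [2,1]),
     ([3,2,1,4], 0, 4, [2,1], [1]),
     ([3,2,4,1], 0, 5, [1], [2,3,1]),
     ([3,4,1,2], 0, 5, [1], [3,1,2]),
     ([3,4,2,1], 0, 5, [1], [3,2,1]),
     ([4,1,2,3], 0, 4, [1], [2,1]),
     ([4,1,3,2], 1, 4, [1], [3,2,1]),
     ([4,2,1,3], 1, 5, [1], [2,3,1]),
     ([4,3,1,2], 1, 5, [1], [3,2,1])]"

text \<open>Of the 103 permutations of length five avoiding 1324, these are the 91 that remain
  besides the twelve compatible ones.\<close>

definition witnesses5 :: "(nat list \<times> nat \<times> nat \<times> nat list \<times> nat list) list" where
  "witnesses5 =
    [([1,2,3,4,5], 0, 5, [1], [1,2,3]),
     ([1,2,3,5,4], 0, 4, [1], [1,3,2]),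
     ([1,2,4,5,3], 0, 3, [1], [2,3,1]),
     ([1,2,5,3,4], 0, 3, [1], [3,1,2]),
     ([1,2,5,4,3], 0, 3, [1], [3,2,1]),
     ([1,3,4,5,2], 2, 4, [1], [3,1,2]),
     ([1,3,5,4,2], 2, 5, [2,1], [3,1,2]),
     ([1,5,2,3,4], 3, 4, [1], [3,1,2]),
     ([1,5,2,4,3], 3, 5, [2,1], [3,1,2]),
     ([2,1,3,4,5], 0, 5, [2,1], [1,2]),
     ([2,1,3,5,4], 0, 4, [2,1], [2,1]),
     ([2,1,4,5,3], 0, 3, [1], [2,3,1]),
     ([2,1,5,3,4], 0, 3, [1], [3,1,2]),
     ([2,1,5,4,3], 0, 3, [1], [3,2,1]),
     ([2,3,1,4,5], 0, 5, [2,3,1], [1]),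
     ([2,3,1,5,4], 1, 3, [1], [2,1]),
     ([2,3,4,1,5], 1, 4, [1], [1,2]),
     ([2,3,4,5,1], 1, 5, [1], [1,3,2]),
     ([2,3,5,1,4], 1, 4, [1], [2,1]),
     ([2,3,5,4,1], 1, 5, [1], [2,3,1]),
     ([2,4,1,5,3], 1, 4, [1], [3,1,2]),
     ([2,4,5,1,3], 1, 5, [1], [3,1,2]),
     ([2,4,5,3,1], 0, 4, [1], [3,4,2,1]),
     ([2,5,1,3,4], 1, 4, [1], [2,3,1]),
     ([2,5,1,4,3], 1, 4, [1], [3,2,1]),
     ([2,5,3,1,4], 1, 5, [1], [2,3,1]),
     ([2,5,3,4,1], 0, 4, [1], [4,2,3,1]),
     ([2,5,4,1,3], 1, 5, [1], [3,2,1]),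
     ([2,5,4,3,1], 0, 4, [1], [4,3,2,1]),
     ([3,1,2,4,5], 0, 3, [1], [2,3,1]),
     ([3,1,2,5,4], 0, 3, [1], [2,1]),
     ([3,1,4,5,2], 0, 4, [1], [2,3,1]),
     ([3,1,5,2,4], 0, 4, [1], [3,1,2]),
     ([3,1,5,4,2], 0, 4, [1], [3,2,1]),
     ([3,2,1,4,5], 0, 5, [3,2,1], [1]),
     ([3,2,1,5,4], 0, 4, [2,1], [2,1]),
     ([3,2,4,1,5], 1, 4, [2,1], [1]),
     ([3,2,4,5,1], 1, 5, [2,1], [2,1]),
     ([3,2,5,1,4], 1, 5, [2,1], [2,1]),
     ([3,2,5,4,1], 0, 5, [1], [2,4,3,1]),
     ([3,4,1,5,2], 1, 5, [1], [4,1,2,3]),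
     ([3,4,2,1,5], 1, 5, [3,1,2], [1]),
     ([3,4,2,5,1], 3, 4, [1], [3,4,2,1]),
     ([3,4,5,1,2], 0, 5, [1], [3,4,1,2]),
     ([3,4,5,2,1], 0, 5, [1], [3,4,2,1]),
     ([3,5,1,2,4], 0, 5, [1], [4,1,2,3]),
     ([3,5,1,4,2], 0, 5, [1], [4,1,3,2]),
     ([3,5,2,1,4], 2, 4, [1], [4,3,1,2]),
     ([3,5,2,4,1], 0, 5, [1], [4,2,3,1]),
     ([3,5,4,1,2], 0, 5, [1], [4,3,1,2]),
     ([3,5,4,2,1], 0, 5, [1], [4,3,2,1]),
     ([4,1,2,3,5], 0, 4, [1], [1,2]),
     ([4,1,2,5,3], 0, 4, [1], [2,1]),
     ([4,1,3,5,2], 0, 5, [1], [2,3,1]),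
     ([4,1,5,2,3], 0, 5, [1], [3,1,2]),
     ([4,1,5,3,2], 0, 5, [1], [3,2,1]),
     ([4,2,1,3,5], 0, 4, [2,1], [1]),
     ([4,2,1,5,3], 0, 5, [2,1], [2,1]),
     ([4,2,3,1,5], 0, 5, [2,3,1], [1]),
     ([4,2,3,5,1], 0, 6, [1], [2,3,4,1]),
     ([4,2,5,1,3], 2, 5, [1], [4,1,3,2]),
     ([4,2,5,3,1], 0, 6, [1], [2,4,3,1]),
     ([4,3,1,2,5], 0, 5, [3,1,2], [1]),
     ([4,3,1,5,2], 3, 4, [1], [4,3,1,2]),
     ([4,3,2,1,5], 0, 5, [3,2,1], [1]),
     ([4,3,2,5,1], 3, 4, [1], [4,3,2,1]),
     ([4,3,5,1,2], 0, 6, [1], [3,4,1,2]),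
     ([4,3,5,2,1], 0, 6, [1], [3,4,2,1]),
     ([4,5,1,2,3], 0, 6, [1], [4,1,2,3]),
     ([4,5,1,3,2], 0, 6, [1], [4,1,3,2]),
     ([4,5,2,1,3], 1, 6, [1], [3,4,1,2]),
     ([4,5,2,3,1], 0, 6, [1], [4,2,3,1]),
     ([4,5,3,1,2], 0, 6, [1], [4,3,1,2]),
     ([4,5,3,2,1], 0, 6, [1], [4,3,2,1]),
     ([5,1,2,3,4], 0, 5, [1], [1,3,2]),
     ([5,1,2,4,3], 0, 5, [1], [2,3,1]),
     ([5,1,3,4,2], 1, 4, [1], [4,2,3,1]),
     ([5,1,4,2,3], 1, 4, [1], [3,4,2,1]),
     ([5,1,4,3,2], 1, 4, [1], [4,3,2,1]),
     ([5,2,1,3,4], 0, 5, [2,1], [2,1]),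
     ([5,2,1,4,3], 1, 5, [1], [2,4,3,1]),
     ([5,2,3,1,4], 1, 6, [1], [2,3,4,1]),
     ([5,2,4,1,3], 1, 6, [1], [2,4,3,1]),
     ([5,3,1,2,4], 2, 4, [1], [3,4,2,1]),
     ([5,3,1,4,2], 1, 5, [1], [4,2,3,1]),
     ([5,3,2,1,4], 2, 4, [1], [4,3,2,1]),
     ([5,3,4,1,2], 1, 6, [1], [4,2,3,1]),
     ([5,4,1,2,3], 1, 5, [1], [3,4,2,1]),
     ([5,4,1,3,2], 1, 5, [1], [4,3,2,1]),
     ([5,4,2,1,3], 1, 6, [1], [3,4,2,1]),
     ([5,4,3,1,2], 1, 6, [1], [4,3,2,1])]"

lemma refutes_witnesses4: "list_all refutes witnesses4"
  by code_simp

lemma refutes_witnesses5: "list_all refutes witnesses5"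
  by code_simp

theorem mainTheorem16:
  shows
    "{p. is_perm p \<and> length p = 4 \<and> avoids p [1,3,2,4] \<and> f_compatible p} =
       {[1,4,3,2], [4,2,3,1], [4,3,2,1]} \<and>
     {p. is_perm p \<and> length p = 5 \<and> avoids p [1,3,2,4] \<and> f_compatible p} =
       {[1,4,5,2,3], [1,4,5,3,2], [1,5,3,4,2], [1,5,4,2,3], [1,5,4,3,2], [3,4,1,2,5],
        [5,2,3,4,1], [5,2,4,3,1], [5,3,2,4,1], [5,3,4,2,1], [5,4,2,3,1], [5,4,3,2,1]} \<and>
     (\<forall>m p. is_perm p \<and> length p = m \<and> p \<noteq> [] \<and> hd p = m \<and> last p = 1 \<longrightarrow> f_compatible p)"
proof (intro conjI)
  have "{p. is_perm p \<and> length p = 4 \<and> avoids p [1,3,2,4] \<and> f_compatible p} =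
      set [[1,4,3,2], [4,2,3,1], [4,3,2,1]]"
    by (rule f_compatible_classification[OF refutes_witnesses4]; code_simp)
  then show "{p. is_perm p \<and> length p = 4 \<and> avoids p [1,3,2,4] \<and> f_compatible p} =
      {[1,4,3,2], [4,2,3,1], [4,3,2,1]}"
    by (simp only: list.set)
  have "{p. is_perm p \<and> length p = 5 \<and> avoids p [1,3,2,4] \<and> f_compatible p} =
      set [[1,4,5,2,3], [1,4,5,3,2], [1,5,3,4,2], [1,5,4,2,3], [1,5,4,3,2], [3,4,1,2,5],
        [5,2,3,4,1], [5,2,4,3,1], [5,3,2,4,1], [5,3,4,2,1], [5,4,2,3,1], [5,4,3,2,1]]"
    by (rule f_compatible_classification[OF refutes_witnesses5]; code_simp)
  then show "{p. is_perm p \<and> length p = 5 \<and> avoids p [1,3,2,4] \<and> f_compatible p} =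
      {[1,4,5,2,3], [1,4,5,3,2], [1,5,3,4,2], [1,5,4,2,3], [1,5,4,3,2], [3,4,1,2,5],
        [5,2,3,4,1], [5,2,4,3,1], [5,3,2,4,1], [5,3,4,2,1], [5,4,2,3,1], [5,4,3,2,1]}"
    by (simp only: list.set)
  show "\<forall>m p. is_perm p \<and> length p = m \<and> p \<noteq> [] \<and> hd p = m \<and> last p = 1 \<longrightarrow> f_compatible p"
    using f_compatible_corners by blast
qed

end
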